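(* Let $H_n=-\sum_{|x|=n}\Delta_x\log\Delta_x$ be the entropy of the random probability measure $\mu_n$ on the $n$-th generation given by the limiting relative subtree sizes $\Delta_x$ of the random growing tree. Then, with probability one, the limit $$h:=\lim_{n\to\infty}\frac1n H_n$$ exists, and it is constant with probability one (i.e. there is a deterministic number $h$ such that $\frac1nH_n\to h$ almost surely).
   Context: Fix an integer $K\ge 2$, let $\mathbb I=\{1,\dots,K\}$, and fix a weight function $w:\{0,1,\dots,K-1\}\to(0,\infty)$. Let $\mathcal N=\bigcup_{n\ge 0}\mathbb I^n$ be the set of finite words over $\mathbb I$ ($\mathbb I^0=\{\emptyset\}$, $\emptyset$ is the root); $xi$ is the $i$-th child of $x$, $|x|$ is the length of $x$, and $xy$ denotes concatenation. A finite rooted ordered tree is a finite set $G\subset\mathcal N$ containing $\emptyset$ and such that $yi\in G$ implies $y\in G$, and $y(i-1)\in G$ if $i>1$; $\deg(x,G)$ is the number of children of $x$ in $G$. The random tree $\Upsilon(t)$, $t\ge 0$, is the right-continuous continuous-time Markov chain on finite rooted ordered trees with $\Upsilon(0)=\{\emptyset\}$ such that from $G$, for every $x\in G$ with $\deg(x,G)=j<K$, it jumps to $G\cup\{x(j+1)\}$ with rate $w(j)$. Let $\tau_x$ be the birth time of $x$ (the first time $x$ is in the tree, $\tau_\emptyset=0$), $\sigma_\emptyset=0$, $\sigma_{y1}=\tau_{y1}-\tau_y$ and $\sigma_{yi}=\tau_{yi}-\tau_{y(i-1)}$ for $i\ge 2$. Equivalently in law: the $\sigma_{yi}$ ($y\in\mathcal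 N$, $i\in\mathbb I$) are independent, $\sigma_{yi}$ is exponential with parameter (rate) $w(i-1)$, $\tau_{yi}=\tau_y+\sigma_{y1}+\dots+\sigma_{yi}$, and $\Upsilon(t)=\{x:\tau_x\le t\}$. $\lambda^*>0$ denotes the unique positive root of $\sum_{j=1}^K\prod_{i=0}^{j-1}\frac{w(i)}{\lambda+w(i)}=1$. For $x\in\mathcal N$ let $\Theta_x=\lim_{t\to\infty}e^{-\lambda^*(t-\tau_x)}|\{y:xy\in\Upsilon(t)\}|$, and $\Theta=\Theta_\emptyset$ (it is known that these limits exist almost surely, lie in $(0,\infty)$, and have finite second moment). Let $$\Delta_x=\lim_{t\to\infty}\frac{|\{y:xy\in\Upsilon(t)\}|}{|\Upsilon(t)|}=\frac{e^{-\lambda^*\tau_x}\Theta_x}{\Theta}.$$ Almost surely $\Delta_\emptyset=1$ and $\Delta_y=\sum_{i=1}^K\Delta_{yi}$, so $\mu_n(\{x\})=\Delta_x$ ($|x|=n$) defines a random probability measure on the $n$-th generation. *)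

theory Defs
  imports "HOL-Probability.Probability"
begin

text \<open>
  The vertices are the words over \<open>{1..K}\<close>, written as lists; \<open>y @ [i]\<close> is the \<open>i\<close>-th child of \<open>y\<close>.
  The growing tree is built from the waiting times \<open>\<sigma> x\<close> of the nonempty words \<open>x\<close>: \<open>\<sigma> (y @ [1])\<close> is
  the time from the birth of \<open>y\<close> to the birth of its first child, and for \<open>i \<ge> 2\<close>, \<open>\<sigma> (y @ [i])\<close> is
  the time from the birth of \<open>y @ [i - 1]\<close> to the birth of \<open>y @ [i]\<close>.  If the \<open>\<sigma> (y @ [i])\<close> are
  independent and exponential with rate \<open>w (i - 1)\<close>, then \<open>growing_tree\<close> is (almost surely) the
  right-continuous Markov chain that starts from the root alone and, for every present vertex
  with \<open>j < K\<close> children, adds the next child at rate \<open>w j\<close>.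
\<close>

definition generation :: "nat \<Rightarrow> nat \<Rightarrow> nat list set" where
  "generation K n = {x \<in> lists {1..K}. length x = n}"

text \<open>Closed form of the recursion proved in \<open>birth_time_Nil\<close> and \<open>birth_time_snoc\<close>.\<close>

definition birth_time :: "(nat list \<Rightarrow> 'a \<Rightarrow> real) \<Rightarrow> nat list \<Rightarrow> 'a \<Rightarrow> real" where
  "birth_time \<sigma> x \<omega> = (\<Sum>k<length x. \<Sum>j=1..x ! k. \<sigma> (take k x @ [j]) \<omega>)"

lemma birth_time_Nil: "birth_time \<sigma> [] \<omega> = 0"
  by (simp add: birth_time_def)

lemma birth_time_snoc:
  "birth_time \<sigma> (y @ [i]) \<omega> = birth_time \<sigma> y \<omega> + (\<Sum>j=1..i. \<sigma> (y @ [j]) \<omega>)"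
  by (simp add: birth_time_def nth_append)

definition growing_tree :: "nat \<Rightarrow> (nat list \<Rightarrow> 'a \<Rightarrow> real) \<Rightarrow> real \<Rightarrow> 'a \<Rightarrow> nat list set" where
  "growing_tree K \<sigma> t \<omega> = {x \<in> lists {1..K}. birth_time \<sigma> x \<omega> \<le> t}"

text \<open>
  The limit exists almost surely; where it does not, \<open>Lim\<close> returns an unspecified value.
\<close>

definition relative_size :: "nat \<Rightarrow> (nat list \<Rightarrow> 'a \<Rightarrow> real) \<Rightarrow> nat list \<Rightarrow> 'a \<Rightarrow> real" where
  "relative_size K \<sigma> x \<omega> =
     Lim at_top (\<lambda>t. real (card {y. x @ y \<in> growing_tree K \<sigma> t \<omega>}) / real (card (growing_tree K \<sigma> t \<omega>)))"

definition generation_entropy :: "nat \<Rightarrow> (nat list \<Rightarrow> 'a \<Rightarrow> real) \<Rightarrow> nat \<Rightarrow> 'a \<Rightarrow> real" where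
  "generation_entropy K \<sigma> n \<omega> =
     - (\<Sum>x\<in>generation K n. relative_size K \<sigma> x \<omega> * ln (relative_size K \<sigma> x \<omega>))"

end

theory Submission
  imports Defs
begin

text \<open>
  Discounting a word \<open>x\<close> by \<open>exp (- lam * tau x)\<close>, where \<open>lam\<close> is the Malthusian parameter, turns every
  functional of the subtrees into a sum over the generation of \<open>x\<close> whose summands are independent given
  the earlier generations. Such sums with centred summands contract in \<open>L\<^sup>2\<close> by a constant factor per
  generation. This gives the limit \<open>W\<close> of the martingale of discounted generation sizes and, together
  with an exponentially fast renewal theorem for the mean, \<open>exp (- lam * t) * N t \<longlongrightarrow> c * W\<close> for the size
  \<open>N t\<close> of the tree. Hence the relative size of the subtree at \<open>x\<close> is \<open>exp (- lam * tau x) * W\<^sub>x / W\<close>. By the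
  chain rule for entropy, \<open>W * H n\<close> is the sum over \<open>k < n\<close> of the discounted sums over generation \<open>k\<close> of the
  first-generation entropies times \<open>W\<close> of the subtrees, and each of these sums is close to \<open>h * W\<close>, where \<open>h\<close>
  is the mean of the first-generation entropy times \<open>W\<close>.

  The error term of the renewal theorem is found as a fixed point: since the rate at which any vertex
  gives birth is at least a constant \<open>eps\<close> times its reproductive value, and the discounted total
  reproductive value has constant mean, the renewal equation can be rewritten with a defective kernel.
\<close>

section \<open>Trees of independent marks\<close>

text \<open>The contraction has one source: discounts enter second moments squared, and the sum of
  the means of \<open>exp (- 2 * lam * T i)\<close> is below 1 because the sum with exponent
  \<open>- lam\<close> is 1. Centring removes the cross terms, so each quantity is written as an
  iterate of one linear operator \<open>Psi\<close> applied to a centred functional, or of its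
  affine version applied to a functional whose mean is known. For the tree size the known mean is
  \<open>b\<close>. Giving it the value \<open>- c\<close> at negative times makes the remainder
  over generation \<open>n\<close> equal to \<open>- c * Wn n\<close> once that generation lies
  beyond \<open>t\<close>, and so the martingale limit enters the growth of the tree. The obstacle
  is the mean itself: the renewal kernel has mass 1, and more than 1 in a norm weighted by
  \<open>exp (d * t)\<close> with \<open>d > 0\<close>, so plain iteration does not contract.
  Conservation of reproductive value supplies an identity of which \<open>eps\<close> times can be
  subtracted, leaving a kernel of mass below 1. A rate \<open>d > 0\<close> is essential because the
  second moments must be summable along a grid of times.\<close>

locale iid_tree = prob_space Q for Q :: "'u measure" +
  fixes A :: "nat set"
  assumes finite_A: "finite A" and A_nonempty: "A \<noteq> {}"
begin

definition words :: "nat list set" where "words = lists A"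

definition tree_space :: "(nat list \<Rightarrow> 'u) measure" where
  "tree_space = PiM words (\<lambda>_. Q)"

definition shift :: "nat \<Rightarrow> (nat list \<Rightarrow> 'u) \<Rightarrow> nat list \<Rightarrow> 'u" where
  "shift i s = (\<lambda>y\<in>words. s (i # y))"

definition glue :: "'u \<Rightarrow> (nat \<Rightarrow> nat list \<Rightarrow> 'u) \<Rightarrow> nat list \<Rightarrow> 'u" where
  "glue u r = (\<lambda>x\<in>words. case x of [] \<Rightarrow> u | i # y \<Rightarrow> r i y)"

lemma Nil_in_words [simp]: "[] \<in> words"
  by (simp add: words_def)

lemma Cons_in_words [simp]: "i # y \<in> words \<longleftrightarrow> i \<in> A \<and> y \<in> words"
  by (simp add: words_def)

lemma countable_words: "countable words"
  by simp

lemma prob_space_tree_space: "prob_space tree_space"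
  unfolding tree_space_def by (intro prob_space_PiM prob_space_axioms)

sublocale tree: prob_space tree_space
  by (rule prob_space_tree_space)

sublocale forest: product_prob_space "\<lambda>_::nat. tree_space" A
  by unfold_locales

lemma measurable_coord [measurable (raw)]:
  "x \<in> words \<Longrightarrow> f \<in> measurable N tree_space \<Longrightarrow> (\<lambda>s. f s x) \<in> measurable N Q"
  unfolding tree_space_def by (erule measurable_compose) (rule measurable_component_singleton)

lemma measurable_coord' [measurable]: "x \<in> words \<Longrightarrow> (\<lambda>s. s x) \<in> measurable tree_space Q"
  unfolding tree_space_def by measurable

lemma measurable_shift [measurable]: "i \<in> A \<Longrightarrow> shift i \<in> measurable tree_space tree_space"
  unfolding shift_def tree_space_def by (intro measurable_restrict measurable_component_singleton) auto

lemma measurable_forest_coord: "i \<in> A \<Longrightarrow> (\<lambda>r. r i) \<in> measurable (PiM A (\<lambda>_. tree_space)) tree_space"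
  by measurable

lemma measurable_glue [measurable]:
  "(\<lambda>(u, r). glue u r) \<in> measurable (Q \<Otimes>\<^sub>M PiM A (\<lambda>_. tree_space)) tree_space"
  unfolding glue_def tree_space_def split_beta'
proof (rule measurable_restrict)
  fix x assume x: "x \<in> words"
  show "(\<lambda>p. case x of [] \<Rightarrow> fst p | i # y \<Rightarrow> snd p i y)
      \<in> measurable (Q \<Otimes>\<^sub>M PiM A (\<lambda>_. PiM words (\<lambda>_. Q))) Q"
  proof (cases x)
    case (Cons i y)
    with x have [measurable]: "i \<in> A" "y \<in> words" by auto
    have "(\<lambda>p. snd p i) \<in> measurable (Q \<Otimes>\<^sub>M PiM A (\<lambda>_. PiM words (\<lambda>_. Q))) (PiM words (\<lambda>_. Q))"
      by measurable
    from measurable_compose[OF this measurable_component_singleton[OF \<open>y \<in> words\<close>]]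
    show ?thesis unfolding Cons by simp
  qed simp
qed

lemma glue_Nil [simp]: "glue u r [] = u"
  by (simp add: glue_def)

lemma shift_glue: "i \<in> A \<Longrightarrow> r i \<in> space tree_space \<Longrightarrow> shift i (glue u r) = r i"
  unfolding shift_def glue_def tree_space_def
  by (auto simp: fun_eq_iff restrict_def space_PiM PiE_def extensional_def)

text \<open>The root coordinate and the subtrees of its children are independent.\<close>

lemma distr_glue:
  "distr (Q \<Otimes>\<^sub>M PiM A (\<lambda>_. tree_space)) tree_space (\<lambda>(u, r). glue u r) = tree_space"
    (is "?D = _")
proof -
  interpret P: product_prob_space "\<lambda>_::nat list. Q" words
    by unfold_locales
  interpret PP: pair_prob_space Q "PiM A (\<lambda>_. tree_space)"
    by unfold_locales
  have "?D = PiM words (\<lambda>_. Q)"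
  proof (rule P.PiM_eq)
    fix J F assume J: "finite J" "J \<subseteq> words" and F: "\<And>j. j \<in> J \<Longrightarrow> F j \<in> sets Q"
    \<comment> \<open>Constraints outside \<open>J\<close> become trivial, so the cylinder reads
      \<open>\<forall>x\<in>words. s x \<in> F' x\<close> and splits into a condition on the root
      and one cylinder per child.\<close>
    define F' where "F' x = (if x \<in> J then F x else space Q)" for x
    have F'[measurable]: "F' x \<in> sets Q" for x
      using F by (auto simp: F'_def)
    define J' where "J' i = {y. i # y \<in> J}" for i
    have J': "finite (J' i)" for i
    proof -
      have "J' i = (\<lambda>y. i # y) -` J" by (auto simp: J'_def)
      then show ?thesis using J by (simp add: finite_vimageI)
    qed
    have J'w: "J' i \<subseteq> words" for i using J(2) by (auto simp: J'_def)
    define G where "G i = prod_emb words (\<lambda>_. Q) (J' i) (\<Pi>\<^sub>E y\<in>J' i. F' (i # y))" for i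
    have G[measurable]: "G i \<in> sets tree_space" for i
      unfolding G_def tree_space_def using J' J'w by (intro sets_PiM_I) auto
    let ?X = "prod_emb words (\<lambda>_. Q) J (\<Pi>\<^sub>E j\<in>J. F j)"
    have X: "?X \<in> sets tree_space"
      unfolding tree_space_def using J F by (intro sets_PiM_I) auto
    have sub: "F' x \<subseteq> space Q" for x using sets.sets_into_space[OF F'] .
    have "(\<lambda>(u, r). glue u r) -` ?X \<inter> space (Q \<Otimes>\<^sub>M PiM A (\<lambda>_. tree_space)) = F' [] \<times> (\<Pi>\<^sub>E i\<in>A. G i)"
      (is "?L = ?R")
    proof (rule set_eqI)
      fix p :: "'u \<times> (nat \<Rightarrow> nat list \<Rightarrow> 'u)"
      obtain u r where p: "p = (u, r)" by (cases p)
      have inX: "s \<in> ?X \<longleftrightarrow> (\<forall>x\<in>words. s x \<in> F' x)" if "s \<in> extensional words" for s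
      proof -
        have "s \<in> ?X \<longleftrightarrow> (\<forall>x\<in>words. s x \<in> space Q) \<and> (\<forall>x\<in>J. s x \<in> F x)"
          using that J(2) by (auto simp: prod_emb_def PiE_iff)
        also have "\<dots> \<longleftrightarrow> (\<forall>x\<in>words. s x \<in> F' x)"
        proof (intro iffI conjI ballI)
          fix x assume "\<forall>x\<in>words. s x \<in> F' x" "x \<in> words"
          then show "s x \<in> space Q" using sub[of x] by auto
        next
          fix x assume "\<forall>x\<in>words. s x \<in> F' x" "x \<in> J"
          then show "s x \<in> F x" using J(2) by (auto simp: F'_def subset_eq split: if_splits)
        qed (auto simp: F'_def)
        finally show ?thesis .
      qed
      have inG: "s \<in> G i \<longleftrightarrow> s \<in> extensional words \<and> (\<forall>y\<in>words. s y \<in> F' (i # y))" for s i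
      proof -
        have "s \<in> G i \<longleftrightarrow> s \<in> extensional words \<and> (\<forall>y\<in>words. s y \<in> space Q) \<and> (\<forall>y\<in>J' i. s y \<in> F' (i # y))"
          unfolding G_def using J'w[of i] by (auto simp: prod_emb_def PiE_iff)
        also have "\<dots> \<longleftrightarrow> s \<in> extensional words \<and> (\<forall>y\<in>words. s y \<in> F' (i # y))"
        proof (intro iffI conjI ballI; (elim conjE)?)
          fix y assume "\<forall>y\<in>words. s y \<in> F' (i # y)" "y \<in> words"
          then show "s y \<in> space Q" using sub[of "i # y"] by auto
        next
          fix y assume "\<forall>y\<in>words. s y \<in> F' (i # y)" "y \<in> J' i"
          then show "s y \<in> F' (i # y)" using J'w[of i] by auto
        qed (auto simp: F'_def J'_def)
        finally show ?thesis .
      qed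
      have ex: "glue u r \<in> extensional words" by (simp add: glue_def)
      have "(\<forall>x\<in>words. glue u r x \<in> F' x) \<longleftrightarrow> u \<in> F' [] \<and> (\<forall>i\<in>A. \<forall>y\<in>words. r i y \<in> F' (i # y))"
        (is "?l \<longleftrightarrow> ?r")
      proof
        assume l: ?l
        show ?r
        proof (intro conjI ballI)
          show "u \<in> F' []" using l[rule_format, of "[]"] by simp
          fix i y assume "i \<in> A" "y \<in> words"
          then show "r i y \<in> F' (i # y)" using l[rule_format, of "i # y"] by (simp add: glue_def)
        qed
      next
        assume r: ?r
        show ?l
        proof
          fix x assume "x \<in> words"
          then show "glue u r x \<in> F' x" using r by (cases x) (auto simp: glue_def)
        qed
      qed
      then show "p \<in> ?L \<longleftrightarrow> p \<in> ?R"
        unfolding p using sub[of "[]"]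
        by (auto simp: space_pair_measure inX[OF ex] inG space_PiM PiE_iff tree_space_def
            dest!: set_mp[OF sub]) (metis Nil_in_words glue_Nil)+
    qed
    then have "emeasure ?D ?X = emeasure (Q \<Otimes>\<^sub>M PiM A (\<lambda>_. tree_space)) (F' [] \<times> (\<Pi>\<^sub>E i\<in>A. G i))"
      using X by (simp add: emeasure_distr)
    also have "\<dots> = emeasure Q (F' []) * (\<Prod>i\<in>A. emeasure tree_space (G i))"
      using finite_A by (subst forest.emeasure_pair_measure_Times) (auto simp: forest.emeasure_PiM intro!: sets_PiM_I_finite)
    also have "(\<Prod>i\<in>A. emeasure tree_space (G i)) = (\<Prod>i\<in>A. \<Prod>y\<in>J' i. emeasure Q (F' (i # y)))"
      unfolding G_def tree_space_def using J' J'w by (intro prod.cong refl P.emeasure_PiM_emb) auto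
    also have "\<dots> = (\<Prod>(i,y)\<in>Sigma A J'. emeasure Q (F' (i # y)))"
      using finite_A J' by (subst prod.Sigma) auto
    \<comment> \<open>A nonempty word of \<open>J\<close> is the same as its first letter together
      with the rest.\<close>
    also have "\<dots> = (\<Prod>x\<in>J - {[]}. emeasure Q (F' x))"
    proof (rule prod.reindex_bij_witness[of _ "\<lambda>x. (hd x, tl x)" "\<lambda>(i, y). i # y"])
      fix x assume x: "x \<in> J - {[]}"
      then obtain i y where "x = i # y" by (cases x) auto
      with x J show "(hd x, tl x) \<in> Sigma A J'" by (auto simp: J'_def)
    qed (auto simp: J'_def)
    also have "emeasure Q (F' []) * \<dots> = (\<Prod>x\<in>J. emeasure Q (F' x))"
    proof (cases "[] \<in> J")
      case True then show ?thesis using J by (simp add: prod.remove)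
    next
      case False then show ?thesis by (simp add: F'_def emeasure_space_1)
    qed
    also have "\<dots> = (\<Prod>x\<in>J. emeasure Q (F x))"
      by (intro prod.cong) (auto simp: F'_def)
    finally show "emeasure ?D ?X = (\<Prod>x\<in>J. emeasure Q (F x))" .
  qed (simp add: tree_space_def)
  then show ?thesis by (simp add: tree_space_def)
qed

lemma nn_integral_tree_space:
  assumes F[measurable]: "F \<in> borel_measurable tree_space"
  shows "(\<integral>\<^sup>+ s. F s \<partial>tree_space) = (\<integral>\<^sup>+ u. \<integral>\<^sup>+ r. F (glue u r) \<partial>PiM A (\<lambda>_. tree_space) \<partial>Q)"
proof -
  have "(\<integral>\<^sup>+ s. F s \<partial>tree_space) = (\<integral>\<^sup>+ p. F (glue (fst p) (snd p)) \<partial>(Q \<Otimes>\<^sub>M PiM A (\<lambda>_. tree_space)))"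
    by (subst distr_glue[symmetric]) (simp add: nn_integral_distr split_beta')
  also have "\<dots> = (\<integral>\<^sup>+ u. \<integral>\<^sup>+ r. F (glue u r) \<partial>PiM A (\<lambda>_. tree_space) \<partial>Q)"
    by (subst forest.nn_integral_fst[symmetric]) simp_all
  finally show ?thesis .
qed

end

text \<open>By independence the second moment is the squared mean plus the variances, and a variance
  is at most a second moment. With nonnegative integrals the bound makes sense without a case
  distinction in its statement: an infinite second moment makes the right-hand side
  infinite.\<close>

lemma (in prob_space) indep_vars_second_moment_bound:
  fixes X :: "'i \<Rightarrow> 'a \<Rightarrow> real"
  assumes fin: "finite I" and ind: "indep_vars (\<lambda>_. borel) X I"
  shows "(\<integral>\<^sup>+ x. ennreal ((a + (\<Sum>i\<in>I. X i x))\<^sup>2) \<partial>M)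
    \<le> ennreal ((a + (\<Sum>i\<in>I. expectation (X i)))\<^sup>2) + (\<Sum>i\<in>I. \<integral>\<^sup>+ x. ennreal ((X i x)\<^sup>2) \<partial>M)"
proof (cases "\<exists>i\<in>I. (\<integral>\<^sup>+ x. ennreal ((X i x)\<^sup>2) \<partial>M) = \<infinity>")
  case True
  then have "(\<Sum>i\<in>I. \<integral>\<^sup>+ x. ennreal ((X i x)\<^sup>2) \<partial>M) = \<infinity>"
    using fin by (auto simp: sum.remove)
  then show ?thesis by simp
next
  case False
  have rv: "random_variable borel (X i)" if "i \<in> I" for i
    using ind that by (auto simp: indep_vars_def)
  have int2: "integrable M (\<lambda>x. (X i x)\<^sup>2)" if "i \<in> I" for i
    using False that rv[OF that] by (intro integrableI_bounded) (auto simp: less_top)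
  have int: "integrable M (X i)" if "i \<in> I" for i
    using square_integrable_imp_integrable[OF rv int2] that by auto
  have "integrable M (\<lambda>x. (\<Sum>i\<in>J. X i x)\<^sup>2) \<and>
    expectation (\<lambda>x. (a + (\<Sum>i\<in>J. X i x))\<^sup>2) \<le> (a + (\<Sum>i\<in>J. expectation (X i)))\<^sup>2 + (\<Sum>i\<in>J. expectation (\<lambda>x. (X i x)\<^sup>2))"
    if "finite J" "J \<subseteq> I" for J
    using that
  proof (induction J rule: finite_induct)
    case empty
    show ?case by (simp add: prob_space)
  next
    case (insert i J)
    define S where "S x = (\<Sum>j\<in>J. X j x)" for x
    have i: "i \<in> I" and J: "J \<subseteq> I" using insert by auto
    have rvS[measurable]: "random_variable borel S"
      unfolding S_def using rv J by (intro borel_measurable_sum) auto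
    have rvi[measurable]: "random_variable borel (X i)" using rv i by auto
    have S2: "integrable M (\<lambda>x. (S x)\<^sup>2)" using insert J unfolding S_def by auto
    have S1: "integrable M S" using square_integrable_imp_integrable[OF rvS S2] by simp
    have ES: "expectation S = (\<Sum>j\<in>J. expectation (X j))"
      unfolding S_def using int J by (subst Bochner_Integration.integral_sum) auto
    have "indep_var borel (X i) borel S"
      unfolding S_def using insert by (intro indep_vars_sum indep_vars_subset[OF ind]) auto
    then have XS: "integrable M (\<lambda>x. X i x * S x)" "expectation (\<lambda>x. X i x * S x) = expectation (X i) * expectation S"
      using indep_var_integrable indep_var_lebesgue_integral int[OF i] S1 by blast+
    have IH: "expectation (\<lambda>x. (a + S x)\<^sup>2) \<le> (a + expectation S)\<^sup>2 + (\<Sum>j\<in>J. expectation (\<lambda>x. (X j x)\<^sup>2))"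
      using insert.IH J unfolding S_def[symmetric] ES by auto
    have "expectation (\<lambda>x. (a + (X i x + S x))\<^sup>2)
        = expectation (\<lambda>x. (a + S x)\<^sup>2 + 2 * a * X i x + 2 * (X i x * S x) + (X i x)\<^sup>2)"
      by (intro Bochner_Integration.integral_cong) (auto simp: power2_eq_square algebra_simps)
    also have "\<dots> = expectation (\<lambda>x. (a + S x)\<^sup>2) + 2 * a * expectation (X i)
        + 2 * (expectation (X i) * expectation S) + expectation (\<lambda>x. (X i x)\<^sup>2)"
    proof -
      have "integrable M (\<lambda>x. (a + S x)\<^sup>2)"
        using S1 S2 by (simp add: power2_sum)
      then show ?thesis using XS int[OF i] int2[OF i] by simp
    qed
    \<comment> \<open>Completing the square on the right adds the square of
      \<open>expectation (X i)\<close>, which is simply given away.\<close>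
    also have "\<dots> \<le> (a + (expectation (X i) + expectation S))\<^sup>2
        + (expectation (\<lambda>x. (X i x)\<^sup>2) + (\<Sum>j\<in>J. expectation (\<lambda>x. (X j x)\<^sup>2)))"
    proof -
      have "(a + (e + t))\<^sup>2 = (a + t)\<^sup>2 + 2 * a * e + 2 * (e * t) + e\<^sup>2" for e t :: real
        by (simp add: power2_eq_square algebra_simps)
      from this[of "expectation (X i)" "expectation S"] show ?thesis
        using IH zero_le_power2[of "expectation (X i)"] by linarith
    qed
    finally have "expectation (\<lambda>x. (a + (X i x + S x))\<^sup>2) \<le> \<dots>" .
    moreover have "integrable M (\<lambda>x. (X i x + S x)\<^sup>2)"
      using S2 XS int2[OF i] by (simp add: power2_sum mult.assoc)
    ultimately show ?case using insert.hyps by (simp add: S_def[symmetric] ES)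
  qed
  from this[OF fin order.refl] have
    1: "integrable M (\<lambda>x. (\<Sum>i\<in>I. X i x)\<^sup>2)" and
    2: "expectation (\<lambda>x. (a + (\<Sum>i\<in>I. X i x))\<^sup>2) \<le> (a + (\<Sum>i\<in>I. expectation (X i)))\<^sup>2 + (\<Sum>i\<in>I. expectation (\<lambda>x. (X i x)\<^sup>2))"
    by auto
  have 3: "integrable M (\<lambda>x. (a + (\<Sum>i\<in>I. X i x))\<^sup>2)"
    using int 1 by (simp add: power2_sum)
  show ?thesis
    using 2 3 int2 fin
    by (simp add: nn_integral_eq_integral sum_ennreal sum_nonneg flip: ennreal_plus)
qed

lemma (in product_prob_space) indep_vars_coordinates:
  assumes "I \<noteq> {}" "finite I"
  shows "P.indep_vars M (\<lambda>i x. x i) I"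
proof (subst P.indep_vars_iff_distr_eq_PiM')
  have "distr (PiM I M) (PiM I M) (\<lambda>x. \<lambda>i\<in>I. x i) = distr (PiM I M) (PiM I M) (\<lambda>x. x)"
    by (intro distr_cong refl) (auto simp: space_PiM PiE_def extensional_restrict)
  also have "\<dots> = PiM I M" by simp
  also have "\<dots> = PiM I (\<lambda>i. distr (PiM I M) (M i) (\<lambda>x. x i))"
    by (intro PiM_cong refl) (simp add: PiM_component)
  finally show "distr (PiM I M) (PiM I M) (\<lambda>x. \<lambda>i\<in>I. x i) = PiM I (\<lambda>i. distr (PiM I M) (M i) (\<lambda>x. x i))" .
qed (use assms in auto)

section \<open>Law of the root mark with one subtree, and conditional second moments\<close>

context iid_tree begin

lemma measurable_root_shift [measurable]:
  "i \<in> A \<Longrightarrow> (\<lambda>s. (s [], shift i s)) \<in> measurable tree_space (Q \<Otimes>\<^sub>M tree_space)"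
  by measurable

text \<open>Integrates \<open>distr_glue\<close> over the other subtrees. The \<open>i\<close>-th
  term of a sum over the children depends on this pair only.\<close>

lemma distr_root_shift:
  assumes i: "i \<in> A"
  shows "distr tree_space (Q \<Otimes>\<^sub>M tree_space) (\<lambda>s. (s [], shift i s)) = Q \<Otimes>\<^sub>M tree_space" (is "?D = _")
proof (rule measure_eqI)
  fix X assume "X \<in> sets ?D"
  then have X[measurable]: "X \<in> sets (Q \<Otimes>\<^sub>M tree_space)" by simp
  note [measurable] = measurable_shift[OF i] measurable_forest_coord[OF i]
  have "emeasure ?D X = (\<integral>\<^sup>+ p. indicator X p \<partial>?D)" by simp
  also have "\<dots> = (\<integral>\<^sup>+ s. indicator X (s [], shift i s) \<partial>tree_space)"
    by (rule nn_integral_distr) auto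
  also have "\<dots> = (\<integral>\<^sup>+ u. \<integral>\<^sup>+ r. indicator X (u, shift i (glue u r)) \<partial>PiM A (\<lambda>_. tree_space) \<partial>Q)"
    by (subst nn_integral_tree_space) auto
  also have "\<dots> = (\<integral>\<^sup>+ u. \<integral>\<^sup>+ r. indicator X (u, r i) \<partial>PiM A (\<lambda>_. tree_space) \<partial>Q)"
    using i by (intro nn_integral_cong) (auto simp: shift_glue space_PiM PiE_iff)
  also have "\<dots> = (\<integral>\<^sup>+ u. \<integral>\<^sup>+ s. indicator X (u, s) \<partial>tree_space \<partial>Q)"
  proof (rule nn_integral_cong)
    fix u assume "u \<in> space Q"
    then have "(\<integral>\<^sup>+ r. indicator X (u, r i) \<partial>PiM A (\<lambda>_. tree_space))
      = (\<integral>\<^sup>+ s. indicator X (u, s) \<partial>distr (PiM A (\<lambda>_. tree_space)) tree_space (\<lambda>r. r i))"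
      by (intro nn_integral_distr[symmetric]) auto
    then show "(\<integral>\<^sup>+ r. indicator X (u, r i) \<partial>PiM A (\<lambda>_. tree_space)) = (\<integral>\<^sup>+ s. indicator X (u, s) \<partial>tree_space)"
      using forest.PiM_component[OF i] by simp
  qed
  also have "\<dots> = emeasure (Q \<Otimes>\<^sub>M tree_space) X"
    by (rule tree.emeasure_pair_measure[symmetric]) auto
  finally show "emeasure ?D X = emeasure (Q \<Otimes>\<^sub>M tree_space) X" .
qed simp

lemma distr_shift:
  assumes i: "i \<in> A"
  shows "distr tree_space tree_space (shift i) = tree_space"
proof -
  have "distr tree_space tree_space (shift i)
      = distr (distr tree_space (Q \<Otimes>\<^sub>M tree_space) (\<lambda>s. (s [], shift i s))) tree_space snd"
    using measurable_root_shift[OF i] by (subst distr_distr) (auto simp: comp_def)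
  also have "\<dots> = tree_space"
    unfolding distr_root_shift[OF i]
  proof (rule measure_eqI)
    fix X assume "X \<in> sets (distr (Q \<Otimes>\<^sub>M tree_space) tree_space snd)"
    then have X: "X \<in> sets tree_space" by simp
    then have "snd -` X \<inter> space (Q \<Otimes>\<^sub>M tree_space) = space Q \<times> X"
      using sets.sets_into_space by (fastforce simp: space_pair_measure)
    then show "emeasure (distr (Q \<Otimes>\<^sub>M tree_space) tree_space snd) X = emeasure tree_space X"
      using X by (simp add: emeasure_distr tree.emeasure_pair_measure_Times
          prob_space.emeasure_space_1[OF prob_space_axioms])
  qed simp
  finally show ?thesis .
qed

lemma AE_shift: "i \<in> A \<Longrightarrow> AE s in tree_space. G s \<Longrightarrow> AE s in tree_space. G (shift i s)"
  by (rule AE_distrD[where M'=tree_space]) (simp, subst distr_shift)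

primrec shift_word :: "nat list \<Rightarrow> (nat list \<Rightarrow> 'u) \<Rightarrow> nat list \<Rightarrow> 'u" where
  "shift_word [] s = s"
| "shift_word (i # x) s = shift_word x (shift i s)"

lemma shift_word_apply:
  "y \<in> words \<Longrightarrow> z \<in> words \<Longrightarrow> shift_word y s z = s (y @ z)"
  by (induction y arbitrary: s) (auto simp: shift_def words_def)

lemma AE_shift_word: "x \<in> words \<Longrightarrow> AE s in tree_space. G s \<Longrightarrow> AE s in tree_space. G (shift_word x s)"
proof (induction x)
  case (Cons i x)
  then have "AE s in tree_space. G (shift_word x s)" by simp
  from AE_shift[OF _ this, of i] Cons show ?case by simp
qed simp

text \<open>Each \<open>shift_word x\<close> preserves the law and there are countably many words,
  so one null set serves all subtrees at once.\<close>

lemma AE_all_shift_word: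
  "AE s in tree_space. G s \<Longrightarrow> AE s in tree_space. \<forall>x\<in>words. G (shift_word x s)"
  by (intro AE_ball_countable' AE_shift_word countable_words)

text \<open>The summands are independent given the root coordinate.\<close>

lemma second_moment_bound:
  fixes a :: "'u \<Rightarrow> real" and Y :: "nat \<Rightarrow> 'u \<times> (nat list \<Rightarrow> 'u) \<Rightarrow> real"
  assumes a[measurable]: "a \<in> borel_measurable Q"
    and Y: "\<And>i. i \<in> A \<Longrightarrow> Y i \<in> borel_measurable (Q \<Otimes>\<^sub>M tree_space)"
  shows "(\<integral>\<^sup>+ s. ennreal ((a (s []) + (\<Sum>i\<in>A. Y i (s [], shift i s)))\<^sup>2) \<partial>tree_space)
    \<le> (\<integral>\<^sup>+ u. ennreal ((a u + (\<Sum>i\<in>A. \<integral>s. Y i (u, s) \<partial>tree_space))\<^sup>2) \<partial>Q)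
      + (\<Sum>i\<in>A. \<integral>\<^sup>+ u. \<integral>\<^sup>+ s. ennreal ((Y i (u, s))\<^sup>2) \<partial>tree_space \<partial>Q)"
proof -
  note [measurable] = Y
  have Yu[measurable]: "(\<lambda>s. Y i (u, s)) \<in> borel_measurable tree_space" if "u \<in> space Q" "i \<in> A" for u i
    using that by measurable
  let ?F = "PiM A (\<lambda>_. tree_space)"
  have "(\<integral>\<^sup>+ s. ennreal ((a (s []) + (\<Sum>i\<in>A. Y i (s [], shift i s)))\<^sup>2) \<partial>tree_space)
      = (\<integral>\<^sup>+ u. \<integral>\<^sup>+ r. ennreal ((a u + (\<Sum>i\<in>A. Y i (u, shift i (glue u r))))\<^sup>2) \<partial>?F \<partial>Q)"
    by (subst nn_integral_tree_space) auto
  also have "\<dots> = (\<integral>\<^sup>+ u. \<integral>\<^sup>+ r. ennreal ((a u + (\<Sum>i\<in>A. Y i (u, r i)))\<^sup>2) \<partial>?F \<partial>Q)"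
    by (intro nn_integral_cong) (auto simp: shift_glue space_PiM PiE_iff cong: sum.cong)
  also have "\<dots> \<le> (\<integral>\<^sup>+ u. (ennreal ((a u + (\<Sum>i\<in>A. \<integral>s. Y i (u, s) \<partial>tree_space))\<^sup>2)
      + (\<Sum>i\<in>A. \<integral>\<^sup>+ s. ennreal ((Y i (u, s))\<^sup>2) \<partial>tree_space)) \<partial>Q)"
  proof (rule nn_integral_mono)
    fix u assume u: "u \<in> space Q"
    have "forest.indep_vars (\<lambda>_. borel) (\<lambda>i r. Y i (u, r i)) A"
      using u by (intro forest.indep_vars_compose2[OF forest.indep_vars_coordinates] A_nonempty finite_A) auto
    note forest.indep_vars_second_moment_bound[OF finite_A this, of "a u"]
    also have "forest.expectation (\<lambda>r. Y i (u, r i)) = (\<integral>s. Y i (u, s) \<partial>tree_space)" if "i \<in> A" for i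
      using integral_distr[of "\<lambda>r. r i" ?F tree_space "\<lambda>s. Y i (u, s)"] forest.PiM_component[OF that] that u by simp
    hence "(\<Sum>i\<in>A. forest.expectation (\<lambda>r. Y i (u, r i))) = (\<Sum>i\<in>A. \<integral>s. Y i (u, s) \<partial>tree_space)" by simp
    also have "(\<integral>\<^sup>+ r. ennreal ((Y i (u, r i))\<^sup>2) \<partial>?F) = (\<integral>\<^sup>+ s. ennreal ((Y i (u, s))\<^sup>2) \<partial>tree_space)" if "i \<in> A" for i
      using nn_integral_distr[of "\<lambda>r. r i" ?F tree_space "\<lambda>s. ennreal ((Y i (u, s))\<^sup>2)"] forest.PiM_component[OF that] that u by simp
    hence "(\<Sum>i\<in>A. \<integral>\<^sup>+ r. ennreal ((Y i (u, r i))\<^sup>2) \<partial>?F) = (\<Sum>i\<in>A. \<integral>\<^sup>+ s. ennreal ((Y i (u, s))\<^sup>2) \<partial>tree_space)" by simp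
    finally show "(\<integral>\<^sup>+ r. ennreal ((a u + (\<Sum>i\<in>A. Y i (u, r i)))\<^sup>2) \<partial>?F)
      \<le> ennreal ((a u + (\<Sum>i\<in>A. \<integral>s. Y i (u, s) \<partial>tree_space))\<^sup>2)
      + (\<Sum>i\<in>A. \<integral>\<^sup>+ s. ennreal ((Y i (u, s))\<^sup>2) \<partial>tree_space)" .
  qed
  also have "\<dots> = (\<integral>\<^sup>+ u. ennreal ((a u + (\<Sum>i\<in>A. \<integral>s. Y i (u, s) \<partial>tree_space))\<^sup>2) \<partial>Q)
      + (\<Sum>i\<in>A. \<integral>\<^sup>+ u. \<integral>\<^sup>+ s. ennreal ((Y i (u, s))\<^sup>2) \<partial>tree_space \<partial>Q)"
  proof (subst nn_integral_add)
    show "(\<lambda>u. ennreal ((a u + (\<Sum>i\<in>A. \<integral>s. Y i (u, s) \<partial>tree_space))\<^sup>2)) \<in> borel_measurable Q"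
    proof -
      have [measurable]: "(\<lambda>u. \<integral>s. Y i (u, s) \<partial>tree_space) \<in> borel_measurable Q" if "i \<in> A" for i
        using that by (intro tree.borel_measurable_lebesgue_integral) (simp add: Y)
      show ?thesis by measurable
    qed
    show "(\<lambda>u. \<Sum>i\<in>A. \<integral>\<^sup>+ s. ennreal ((Y i (u, s))\<^sup>2) \<partial>tree_space) \<in> borel_measurable Q"
      by measurable
    show "(\<integral>\<^sup>+ u. ennreal ((a u + (\<Sum>i\<in>A. \<integral>s. Y i (u, s) \<partial>tree_space))\<^sup>2) \<partial>Q) +
    (\<integral>\<^sup>+ u. (\<Sum>i\<in>A. \<integral>\<^sup>+ s. ennreal ((Y i (u, s))\<^sup>2) \<partial>tree_space) \<partial>Q) =
    (\<integral>\<^sup>+ u. ennreal ((a u + (\<Sum>i\<in>A. \<integral>s. Y i (u, s) \<partial>tree_space))\<^sup>2) \<partial>Q)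
      + (\<Sum>i\<in>A. \<integral>\<^sup>+ u. \<integral>\<^sup>+ s. ennreal ((Y i (u, s))\<^sup>2) \<partial>tree_space \<partial>Q)"
      by (subst nn_integral_sum) auto
  qed
  finally show ?thesis .
qed

end

section \<open>Second moments of discounted sums over the generations\<close>

locale branching = iid_tree Q A for Q :: "'u measure" and A +
  fixes T :: "nat \<Rightarrow> 'u \<Rightarrow> real" and lam :: real
  assumes T_measurable [measurable]: "i \<in> A \<Longrightarrow> T i \<in> borel_measurable Q"
    and T_nonneg: "i \<in> A \<Longrightarrow> 0 \<le> T i u"
    and lam_pos: "0 < lam"
    and malthus: "(\<Sum>i\<in>A. \<integral>u. exp (- lam * T i u) \<partial>Q) = 1"
begin

text \<open>The smoothing operator of the branching recursion: \<open>F (t, s)\<close> is a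
  functional of the tree \<open>s\<close> at age \<open>t\<close>, a child born at
  \<open>T i\<close> has age \<open>t - T i\<close>, and its contribution is discounted. A negative
  age means that the child is not yet born.\<close>

definition Psi :: "(real \<times> (nat list \<Rightarrow> 'u) \<Rightarrow> real) \<Rightarrow> real \<times> (nat list \<Rightarrow> 'u) \<Rightarrow> real" where
  "Psi F = (\<lambda>(t, s). \<Sum>i\<in>A. exp (- lam * T i (s [])) * F (t - T i (s []), shift i s))"

lemma measurable_Psi [measurable]:
  assumes [measurable]: "F \<in> borel_measurable (borel \<Otimes>\<^sub>M tree_space)"
  shows "Psi F \<in> borel_measurable (borel \<Otimes>\<^sub>M tree_space)"
  unfolding Psi_def split_beta' by measurable

lemma measurable_Psi_power [measurable]:
  "F \<in> borel_measurable (borel \<Otimes>\<^sub>M tree_space) \<Longrightarrow> (Psi ^^ n) F \<in> borel_measurable (borel \<Otimes>\<^sub>M tree_space)"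
  by (induction n) auto

lemma measurable_section [measurable]:
  "F \<in> borel_measurable (borel \<Otimes>\<^sub>M tree_space) \<Longrightarrow> (\<lambda>s. F (t :: real, s)) \<in> borel_measurable tree_space"
  by (rule measurable_compose[of "Pair t"]) auto

text \<open>The bound is imposed at all real ages and grows towards negative ones. It therefore
  admits functionals that are constant and nonzero at negative ages, and the passage from
  \<open>t\<close> to \<open>t - T i\<close> takes no case distinction.\<close>

definition L2_bounded :: "real \<Rightarrow> real \<Rightarrow> (real \<Rightarrow> real) \<Rightarrow> (real \<times> (nat list \<Rightarrow> 'u) \<Rightarrow> real) \<Rightarrow> bool" where
  "L2_bounded d C f F \<longleftrightarrow> F \<in> borel_measurable (borel \<Otimes>\<^sub>M tree_space) \<and> 0 \<le> C \<and>
     (\<forall>t. (\<integral>\<^sup>+ s. ennreal ((F (t, s))\<^sup>2) \<partial>tree_space) \<le> ennreal (C * exp (- 2 * d * t)) \<and>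
          (\<integral>s. F (t, s) \<partial>tree_space) = f t)"

definition contraction :: "real \<Rightarrow> real" where
  "contraction d = (\<Sum>i\<in>A. \<integral>u. exp (- 2 * (lam - d) * T i u) \<partial>Q)"

lemma contraction_nonneg: "0 \<le> contraction d"
  unfolding contraction_def by (intro sum_nonneg) auto

lemma integrable_exp_T: "i \<in> A \<Longrightarrow> 0 \<le> k \<Longrightarrow> integrable Q (\<lambda>u. exp (- k * T i u))"
  by (rule integrable_const_bound[where B=1]) (auto simp: T_nonneg)

text \<open>Given the root mark the summands are independent. The conditional mean, including
  \<open>r t\<close>, is at most \<open>(R + card A * B) * exp (- d * t)\<close> in absolute value.
  The second moments of the summands produce \<open>contraction d\<close>, because
  \<open>exp (- 2 * lam * x)\<close> times \<open>exp (- 2 * d * (t - x))\<close> is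
  \<open>exp (- 2 * (lam - d) * x)\<close> times \<open>exp (- 2 * d * t)\<close>.\<close>

lemma L2_bounded_step:
  assumes F: "L2_bounded d C f F" and d: "0 \<le> d" "d < lam"
    and r[measurable]: "r \<in> borel_measurable borel" and f[measurable]: "f \<in> borel_measurable borel"
    and r_bound: "\<And>t. \<bar>r t\<bar> \<le> R * exp (- d * t)" and f_bound: "\<And>t. \<bar>f t\<bar> \<le> B * exp (- d * t)"
  shows "L2_bounded d ((R + real (card A) * B)\<^sup>2 + contraction d * C)
    (\<lambda>t. r t + (\<Sum>i\<in>A. \<integral>u. exp (- lam * T i u) * f (t - T i u) \<partial>Q))
    (\<lambda>(t, s). r t + Psi F (t, s))"
proof -
  have F_meas[measurable]: "F \<in> borel_measurable (borel \<Otimes>\<^sub>M tree_space)" and C: "0 \<le> C"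
    and F2: "(\<integral>\<^sup>+ s. ennreal ((F (t, s))\<^sup>2) \<partial>tree_space) \<le> ennreal (C * exp (- 2 * d * t))"
    and F1: "(\<integral>s. F (t, s) \<partial>tree_space) = f t" for t
    using F by (auto simp: L2_bounded_def)
  have B: "0 \<le> B" "0 \<le> R" using f_bound[of 0] r_bound[of 0] by auto
  define Y where "Y t i = (\<lambda>(u, s). exp (- lam * T i u) * F (t - T i u, s))" for t i
  have Y_meas[measurable]: "i \<in> A \<Longrightarrow> Y t i \<in> borel_measurable (Q \<Otimes>\<^sub>M tree_space)" for t i
    unfolding Y_def split_beta' by measurable
  have Psi_Y: "Psi F (t, s) = (\<Sum>i\<in>A. Y t i (s [], shift i s))" for t s
    by (simp add: Psi_def Y_def)
  have mean_Y: "(\<integral>s. Y t i (u, s) \<partial>tree_space) = exp (- lam * T i u) * f (t - T i u)" for t i u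
    by (simp add: Y_def F1)
  have exp_eq: "exp (- lam * x) * exp (- d * (t - x)) = exp (- (lam - d) * x) * exp (- d * t)" for t x
    by (simp add: algebra_simps flip: exp_add)
  have abs_mean_Y: "\<bar>exp (- lam * T i u) * f (t - T i u)\<bar> \<le> B * exp (- d * t)" if "i \<in> A" for t i u
  proof -
    have "\<bar>exp (- lam * T i u) * f (t - T i u)\<bar> \<le> exp (- lam * T i u) * (B * exp (- d * (t - T i u)))"
      using f_bound[of "t - T i u"] by (simp add: abs_mult)
    also have "\<dots> = B * (exp (- (lam - d) * T i u) * exp (- d * t))"
      using exp_eq[of "T i u" t] by (simp add: mult.left_commute)
    also have "\<dots> \<le> B * (1 * exp (- d * t))"
      using B d T_nonneg[OF that, of u] by (intro mult_left_mono mult_right_mono) (auto intro: mult_nonpos_nonneg)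
    finally show ?thesis by simp
  qed
  have Y2: "(\<integral>\<^sup>+ u. \<integral>\<^sup>+ s. ennreal ((Y t i (u, s))\<^sup>2) \<partial>tree_space \<partial>Q)
      \<le> ennreal (C * exp (- 2 * d * t) * (\<integral>u. exp (- 2 * (lam - d) * T i u) \<partial>Q))" if i: "i \<in> A" for t i
  proof -
    have "(\<integral>\<^sup>+ u. \<integral>\<^sup>+ s. ennreal ((Y t i (u, s))\<^sup>2) \<partial>tree_space \<partial>Q)
        \<le> (\<integral>\<^sup>+ u. ennreal (C * exp (- 2 * d * t) * exp (- 2 * (lam - d) * T i u)) \<partial>Q)"
    proof (rule nn_integral_mono)
      fix u
      have "(\<integral>\<^sup>+ s. ennreal ((Y t i (u, s))\<^sup>2) \<partial>tree_space)
          = (\<integral>\<^sup>+ s. ennreal ((exp (- lam * T i u))\<^sup>2) * ennreal ((F (t - T i u, s))\<^sup>2) \<partial>tree_space)"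
        by (intro nn_integral_cong) (simp add: Y_def power_mult_distrib ennreal_mult)
      also have "\<dots> = ennreal ((exp (- lam * T i u))\<^sup>2) * (\<integral>\<^sup>+ s. ennreal ((F (t - T i u, s))\<^sup>2) \<partial>tree_space)"
        by (intro nn_integral_cmult) measurable
      also have "\<dots> \<le> ennreal ((exp (- lam * T i u))\<^sup>2) * ennreal (C * exp (- 2 * d * (t - T i u)))"
        by (intro mult_left_mono F2) auto
      also have "\<dots> = ennreal ((exp (- lam * T i u))\<^sup>2 * (C * exp (- 2 * d * (t - T i u))))"
        using C by (subst ennreal_mult) auto
      also have "(exp (- lam * T i u))\<^sup>2 * (C * exp (- 2 * d * (t - T i u))) = C * exp (- 2 * d * t) * exp (- 2 * (lam - d) * T i u)"
        by (simp add: power2_eq_square algebra_simps flip: exp_add)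
      finally show "(\<integral>\<^sup>+ s. ennreal ((Y t i (u, s))\<^sup>2) \<partial>tree_space)
          \<le> ennreal (C * exp (- 2 * d * t) * exp (- 2 * (lam - d) * T i u))" .
    qed
    also have "\<dots> = ennreal (\<integral>u. C * exp (- 2 * d * t) * exp (- 2 * (lam - d) * T i u) \<partial>Q)"
      using C d integrable_exp_T[OF i, of "2 * (lam - d)"]
      by (intro nn_integral_eq_integral) (auto simp: mult.assoc)
    finally show ?thesis by simp
  qed
  have Y_int: "integrable (Q \<Otimes>\<^sub>M tree_space) (Y t i)" if i: "i \<in> A" for t i
  proof -
    have "(\<integral>\<^sup>+ p. ennreal ((Y t i p)\<^sup>2) \<partial>(Q \<Otimes>\<^sub>M tree_space)) = (\<integral>\<^sup>+ u. \<integral>\<^sup>+ s. ennreal ((Y t i (u, s))\<^sup>2) \<partial>tree_space \<partial>Q)"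
      using i by (intro tree.nn_integral_fst[symmetric]) auto
    also have "\<dots> < \<infinity>" using Y2[OF i, of t] by (rule le_less_trans) simp
    finally have fin: "(\<integral>\<^sup>+ p. ennreal ((Y t i p)\<^sup>2) \<partial>(Q \<Otimes>\<^sub>M tree_space)) < \<infinity>" .
    have Ym: "Y t i \<in> borel_measurable (Q \<Otimes>\<^sub>M tree_space)" using i by (rule Y_meas)
    have "integrable (Q \<Otimes>\<^sub>M tree_space) (\<lambda>p. (Y t i p)\<^sup>2)"
      by (rule integrableI_bounded) (use Ym fin in simp_all)
    with Ym show ?thesis
      by (rule finite_measure.square_integrable_imp_integrable[OF
          prob_space.finite_measure[OF prob_space_pair[OF prob_space_axioms prob_space_tree_space]]])
  qed
  show ?thesis unfolding L2_bounded_def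
  proof (intro conjI allI)
    show "(\<lambda>(t, s). r t + Psi F (t, s)) \<in> borel_measurable (borel \<Otimes>\<^sub>M tree_space)"
      unfolding split_beta' by measurable
    show "0 \<le> (R + real (card A) * B)\<^sup>2 + contraction d * C"
      using C contraction_nonneg by simp
    fix t
    have "(\<integral>\<^sup>+ s. ennreal ((r t + Psi F (t, s))\<^sup>2) \<partial>tree_space)
      \<le> (\<integral>\<^sup>+ u. ennreal ((r t + (\<Sum>i\<in>A. \<integral>s. Y t i (u, s) \<partial>tree_space))\<^sup>2) \<partial>Q)
      + (\<Sum>i\<in>A. \<integral>\<^sup>+ u. \<integral>\<^sup>+ s. ennreal ((Y t i (u, s))\<^sup>2) \<partial>tree_space \<partial>Q)"
      unfolding Psi_Y by (rule second_moment_bound) auto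
    also have "\<dots> \<le> ennreal ((R + real (card A) * B)\<^sup>2 * exp (- 2 * d * t))
      + (\<Sum>i\<in>A. ennreal (C * exp (- 2 * d * t) * (\<integral>u. exp (- 2 * (lam - d) * T i u) \<partial>Q)))"
    proof (intro add_mono sum_mono Y2)
      have "(\<integral>\<^sup>+ u. ennreal ((r t + (\<Sum>i\<in>A. \<integral>s. Y t i (u, s) \<partial>tree_space))\<^sup>2) \<partial>Q)
        \<le> (\<integral>\<^sup>+ u. ennreal ((R + real (card A) * B)\<^sup>2 * exp (- 2 * d * t)) \<partial>Q)"
      proof (intro nn_integral_mono ennreal_leI)
        fix u
        have "\<bar>r t + (\<Sum>i\<in>A. \<integral>s. Y t i (u, s) \<partial>tree_space)\<bar> \<le> \<bar>r t\<bar> + (\<Sum>i\<in>A. \<bar>\<integral>s. Y t i (u, s) \<partial>tree_space\<bar>)"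
          by (rule order.trans[OF abs_triangle_ineq]) simp
        also have "\<dots> \<le> R * exp (- d * t) + (\<Sum>i\<in>A. B * exp (- d * t))"
          unfolding mean_Y by (intro add_mono sum_mono r_bound abs_mean_Y)
        also have "\<dots> = (R + real (card A) * B) * exp (- d * t)"
          by (simp add: algebra_simps)
        finally have "(r t + (\<Sum>i\<in>A. \<integral>s. Y t i (u, s) \<partial>tree_space))\<^sup>2 \<le> ((R + real (card A) * B) * exp (- d * t))\<^sup>2"
          by (rule abs_le_square_iff[THEN iffD1, OF order.trans]) simp
        also have "\<dots> = (R + real (card A) * B)\<^sup>2 * exp (- 2 * d * t)"
          by (simp add: power_mult_distrib mult.assoc flip: exp_double)
        finally show "(r t + (\<Sum>i\<in>A. \<integral>s. Y t i (u, s) \<partial>tree_space))\<^sup>2 \<le> (R + real (card A) * B)\<^sup>2 * exp (- 2 * d * t)" .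
      qed
      then show "(\<integral>\<^sup>+ u. ennreal ((r t + (\<Sum>i\<in>A. \<integral>s. Y t i (u, s) \<partial>tree_space))\<^sup>2) \<partial>Q)
        \<le> ennreal ((R + real (card A) * B)\<^sup>2 * exp (- 2 * d * t))"
        using prob_space.emeasure_space_1[OF prob_space_axioms] by simp
    qed
    also have "\<dots> = ennreal (((R + real (card A) * B)\<^sup>2 + contraction d * C) * exp (- 2 * d * t))"
      using C by (simp add: sum_nonneg contraction_def sum_distrib_left sum_distrib_right algebra_simps flip: ennreal_plus)
    finally show "(\<integral>\<^sup>+ s. ennreal ((case (t, s) of (t, s) \<Rightarrow> r t + Psi F (t, s))\<^sup>2) \<partial>tree_space)
        \<le> ennreal (((R + real (card A) * B)\<^sup>2 + contraction d * C) * exp (- 2 * d * t))" by simp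
    have YP: "integrable tree_space (\<lambda>s. Y t i (s [], shift i s))"
      "(\<integral>s. Y t i (s [], shift i s) \<partial>tree_space) = (\<integral>u. exp (- lam * T i u) * f (t - T i u) \<partial>Q)" if i: "i \<in> A" for i
    proof -
      note m = measurable_root_shift[OF i]
      show "integrable tree_space (\<lambda>s. Y t i (s [], shift i s))"
        using Y_int[OF i, of t] by (subst (asm) distr_root_shift[OF i, symmetric], subst (asm) integrable_distr_eq[OF m]) (auto simp: i)
      have "(\<integral>s. Y t i (s [], shift i s) \<partial>tree_space) = (\<integral>p. Y t i p \<partial>(Q \<Otimes>\<^sub>M tree_space))"
        by (subst distr_root_shift[OF i, symmetric], subst integral_distr[OF m]) (auto simp: i)
      also have "\<dots> = (\<integral>u. \<integral>s. Y t i (u, s) \<partial>tree_space \<partial>Q)"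
      proof -
        interpret PP: pair_prob_space Q tree_space by unfold_locales
        show ?thesis by (rule PP.integral_fst'[symmetric, OF Y_int[OF i]])
      qed
      finally show "(\<integral>s. Y t i (s [], shift i s) \<partial>tree_space) = (\<integral>u. exp (- lam * T i u) * f (t - T i u) \<partial>Q)"
        by (simp add: mean_Y)
    qed
    have "(\<integral>s. r t + Psi F (t, s) \<partial>tree_space) = r t + (\<Sum>i\<in>A. \<integral>u. exp (- lam * T i u) * f (t - T i u) \<partial>Q)"
      unfolding Psi_Y using YP by (simp add: tree.prob_space)
    then show "(\<integral>s. (case (t, s) of (t, s) \<Rightarrow> r t + Psi F (t, s)) \<partial>tree_space)
        = r t + (\<Sum>i\<in>A. \<integral>u. exp (- lam * T i u) * f (t - T i u) \<partial>Q)" by simp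
  qed
qed

text \<open>For a centred functional the step applies with \<open>R = B = 0\<close>, so it only
  multiplies the constant by \<open>contraction d\<close>.\<close>

lemma L2_bounded_Psi_power:
  assumes F: "L2_bounded d C (\<lambda>_. 0) F" and d: "0 \<le> d" "d < lam"
  shows "L2_bounded d (contraction d ^ n * C) (\<lambda>_. 0) ((Psi ^^ n) F)"
proof (induction n)
  case (Suc n)
  from L2_bounded_step[OF this d, of "\<lambda>_. 0" 0 0] show ?case by (simp add: mult.assoc)
qed (use F in simp)

end

section \<open>From second moments to almost sure summability\<close>

lemma AE_summable_of_nn_integral:
  fixes X :: "nat \<Rightarrow> 'a \<Rightarrow> real"
  assumes [measurable]: "\<And>n. X n \<in> borel_measurable M"
    and nonneg: "\<And>n x. 0 \<le> X n x"
    and bound: "\<And>n. (\<integral>\<^sup>+ x. ennreal (X n x) \<partial>M) \<le> ennreal (c n)"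
    and c: "summable c" "\<And>n. 0 \<le> c n"
  shows "AE x in M. summable (\<lambda>n. X n x)"
proof -
  have "(\<integral>\<^sup>+ x. (\<Sum>n. ennreal (X n x)) \<partial>M) = (\<Sum>n. \<integral>\<^sup>+ x. ennreal (X n x) \<partial>M)"
    by (rule nn_integral_suminf) auto
  also have "\<dots> \<le> (\<Sum>n. ennreal (c n))" by (intro suminf_le bound) auto
  also have "\<dots> = ennreal (\<Sum>n. c n)" using c by (intro suminf_ennreal2) auto
  also have "\<dots> < \<infinity>" by simp
  finally have "AE x in M. (\<Sum>n. ennreal (X n x)) \<noteq> \<infinity>"
    by (intro nn_integral_noteq_infinite) auto
  then show ?thesis
    by eventually_elim (auto intro!: summable_suminf_not_top nonneg simp: top_ennreal_def[symmetric])
qed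

text \<open>Pointwise, \<open>2 * r * \<bar>X\<bar>\<close> is at most \<open>r * r + X * X\<close>.
  The parameter \<open>r\<close> is left free so that it can be balanced against the second
  moment.\<close>

lemma (in prob_space) integral_abs_le_of_second_moment:
  fixes X :: "'a \<Rightarrow> real"
  assumes X[measurable]: "X \<in> borel_measurable M"
    and bound: "(\<integral>\<^sup>+ x. ennreal ((X x)\<^sup>2) \<partial>M) \<le> ennreal E"
    and r: "0 < r" and E: "0 \<le> E"
  shows "integrable M X" "expectation (\<lambda>x. \<bar>X x\<bar>) \<le> r + E / r"
proof -
  have "(\<integral>\<^sup>+ x. ennreal ((X x)\<^sup>2) \<partial>M) < \<infinity>"
    using bound by (rule le_less_trans) simp
  then have int2: "integrable M (\<lambda>x. (X x)\<^sup>2)"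
    by (intro integrableI_bounded) auto
  then show int: "integrable M X"
    by (rule square_integrable_imp_integrable[OF X])
  have "expectation (\<lambda>x. (X x)\<^sup>2) \<le> E"
    using bound int2 E by (simp add: nn_integral_eq_integral)
  have "expectation (\<lambda>x. \<bar>X x\<bar>) \<le> expectation (\<lambda>x. r + (X x)\<^sup>2 / r)"
  proof (rule integral_mono)
    fix x
    have "0 \<le> (r - \<bar>X x\<bar>)\<^sup>2" by simp
    then have "2 * (r * \<bar>X x\<bar>) \<le> r * r + (X x)\<^sup>2"
      by (simp add: power2_eq_square algebra_simps)
    moreover have "0 \<le> r * \<bar>X x\<bar>" using r by simp
    ultimately have "r * \<bar>X x\<bar> \<le> r * r + (X x)\<^sup>2" by linarith
    then show "\<bar>X x\<bar> \<le> r + (X x)\<^sup>2 / r" using r by (simp add: field_simps)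
  qed (use int int2 in auto)
  also have "\<dots> = r + expectation (\<lambda>x. (X x)\<^sup>2) / r"
    using int2 by (simp add: prob_space)
  also have "\<dots> \<le> r + E / r"
    using r \<open>expectation (\<lambda>x. (X x)\<^sup>2) \<le> E\<close> by (simp add: divide_right_mono)
  finally show "expectation (\<lambda>x. \<bar>X x\<bar>) \<le> r + E / r" .
qed

lemma (in prob_space) summable_of_geometric_second_moment:
  fixes X :: "nat \<Rightarrow> 'a \<Rightarrow> real"
  assumes X[measurable]: "\<And>n. X n \<in> borel_measurable M"
    and bound: "\<And>n. (\<integral>\<^sup>+ x. ennreal ((X n x)\<^sup>2) \<partial>M) \<le> ennreal (q ^ n * C)"
    and q: "0 \<le> q" "q < 1" and C: "0 \<le> C"
  shows "AE x in M. summable (\<lambda>n. \<bar>X n x\<bar>)" "summable (\<lambda>n. expectation (\<lambda>x. \<bar>X n x\<bar>))"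
    "integrable M (X n)"
proof -
  \<comment> \<open>Strictly between \<open>q\<close> and 1, hence positive even for
    \<open>q = 0\<close>, so that \<open>r ^ n\<close> may serve as a divisor. With
    \<open>r * r = p\<close> the bound \<open>r ^ n + q ^ n * C / r ^ n\<close> is at most
    \<open>(1 + C) * r ^ n\<close>.\<close>
  define p where "p = (1 + q) / 2"
  have p: "0 < p" "q < p" "p < 1" using q by (auto simp: p_def)
  define r where "r = sqrt p"
  have r: "0 < r" "r < 1" "r * r = p" using p by (auto simp: r_def)
  have int: "integrable M (X n)" and le: "expectation (\<lambda>x. \<bar>X n x\<bar>) \<le> (1 + C) * r ^ n" for n
  proof -
    have "0 < r ^ n" "0 \<le> q ^ n * C" using r q C by auto
    note * = integral_abs_le_of_second_moment[OF X bound this]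
    show "integrable M (X n)" by (rule *(1))
    have "q ^ n * C \<le> p ^ n * C" using p q C by (intro mult_right_mono power_mono) auto
    also have "p ^ n = r ^ n * r ^ n" by (simp only: r(3)[symmetric] power_mult_distrib)
    finally have "q ^ n * C / r ^ n \<le> C * r ^ n" using r by (simp add: field_simps)
    then show "expectation (\<lambda>x. \<bar>X n x\<bar>) \<le> (1 + C) * r ^ n"
      using *(2) by (simp add: algebra_simps)
  qed
  show "integrable M (X n)" by (rule int)
  have "summable (\<lambda>n. (1 + C) * r ^ n)" using r by (intro summable_mult summable_geometric) auto
  then show s: "summable (\<lambda>n. expectation (\<lambda>x. \<bar>X n x\<bar>))"
    by (rule summable_comparison_test'[where N=0]) (use le in auto)
  show "AE x in M. summable (\<lambda>n. \<bar>X n x\<bar>)"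
    by (rule AE_summable_of_nn_integral[OF _ _ _ s]) (use int in \<open>auto simp: nn_integral_eq_integral\<close>)
qed

section \<open>Sums over the generations as iterates of the operator\<close>

context branching begin

primrec tau :: "nat list \<Rightarrow> (nat list \<Rightarrow> 'u) \<Rightarrow> real" where
  "tau [] s = 0"
| "tau (i # x) s = T i (s []) + tau x (shift i s)"

definition gen :: "nat \<Rightarrow> nat list set" where
  "gen n = {x \<in> words. length x = n}"

lemma gen_0 [simp]: "gen 0 = {[]}"
  by (auto simp: gen_def)

lemma gen_Suc: "gen (Suc n) = (\<lambda>(i, x). i # x) ` (A \<times> gen n)"
proof (rule set_eqI)
  fix x show "x \<in> gen (Suc n) \<longleftrightarrow> x \<in> (\<lambda>(i, x). i # x) ` (A \<times> gen n)"
    by (cases x) (auto simp: gen_def image_iff)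
qed

lemma finite_gen [simp]: "finite (gen n)"
  by (induction n) (simp_all add: gen_Suc finite_A)

lemma gen_words: "x \<in> gen n \<Longrightarrow> x \<in> words"
  by (simp add: gen_def)

lemma sum_gen_Suc: "(\<Sum>x\<in>gen (Suc n). f x) = (\<Sum>i\<in>A. \<Sum>x\<in>gen n. f (i # x))" for f :: "nat list \<Rightarrow> real"
proof -
  have "(\<Sum>x\<in>gen (Suc n). f x) = (\<Sum>(i, x)\<in>A \<times> gen n. f (i # x))"
    unfolding gen_Suc by (subst sum.reindex) (auto simp: inj_on_def split_beta')
  then show ?thesis by (simp add: sum.cartesian_product)
qed

lemma tau_measurable [measurable]: "x \<in> words \<Longrightarrow> tau x \<in> borel_measurable tree_space"
proof (induction x)
  case (Cons i x)
  then have [measurable]: "i \<in> A" "tau x \<in> borel_measurable tree_space" by auto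
  show ?case unfolding tau.simps by measurable
next
  case Nil
  have "tau [] = (\<lambda>_. 0)" by (rule ext) simp
  then show ?case by simp
qed

lemma tau_append: "tau (x @ y) s = tau x s + tau y (shift_word x s)"
  by (induction x arbitrary: s) auto

lemma shift_word_append: "shift_word (x @ y) s = shift_word y (shift_word x s)"
  by (induction x arbitrary: s) auto

lemma Psi_apply: "Psi F (t, s) = (\<Sum>i\<in>A. exp (- lam * T i (s [])) * F (t - T i (s []), shift i s))"
  by (simp add: Psi_def)

lemma exp_lam_add: "exp (- (lam * (x + y))) = exp (- (lam * x)) * exp (- (lam * y))"
  by (simp add: algebra_simps flip: exp_add)

lemma Psi_power: "(Psi ^^ n) F (t, s) = (\<Sum>x\<in>gen n. exp (- lam * tau x s) * F (t - tau x s, shift_word x s))"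
proof (induction n arbitrary: t s)
  case (Suc n)
  have "(Psi ^^ Suc n) F (t, s) = (\<Sum>i\<in>A. exp (- lam * T i (s [])) * (Psi ^^ n) F (t - T i (s []), shift i s))"
    by (simp add: Psi_apply)
  also have "\<dots> = (\<Sum>i\<in>A. \<Sum>x\<in>gen n. exp (- lam * tau (i # x) s) * F (t - tau (i # x) s, shift_word (i # x) s))"
    unfolding Suc sum_distrib_left by (intro sum.cong refl) (simp add: exp_lam_add diff_diff_eq)
  finally show ?case by (simp only: sum_gen_Suc)
qed simp

lemma Psi_power_diff: "(Psi ^^ n) (\<lambda>p. F p - G p) p = (Psi ^^ n) F p - (Psi ^^ n) G p"
  by (cases p) (simp add: Psi_power right_diff_distrib sum_subtractf)

lemma Psi_power_snd:
  "(Psi ^^ n) (\<lambda>p. G (snd p)) (t, s) = (\<Sum>x\<in>gen n. exp (- lam * tau x s) * G (shift_word x s))"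
  by (simp add: Psi_power)

text \<open>Explores \<open>n\<close> generations exactly and replaces each unexplored subtree by
  its mean \<open>f\<close>. When \<open>f\<close> solves the mean equation, the iterates play the
  role of conditional expectations given the first \<open>n\<close> generations.\<close>

primrec affine_iter :: "(real \<Rightarrow> real) \<Rightarrow> (real \<Rightarrow> real) \<Rightarrow> nat \<Rightarrow> real \<times> (nat list \<Rightarrow> 'u) \<Rightarrow> real" where
  "affine_iter r f 0 = (\<lambda>p. f (fst p))"
| "affine_iter r f (Suc n) = (\<lambda>(t, s). r t + Psi (affine_iter r f n) (t, s))"

lemma affine_iter_eq:
  "affine_iter r f n (t, s) =
     (\<Sum>k<n. \<Sum>x\<in>gen k. exp (- lam * tau x s) * r (t - tau x s)) + (\<Sum>x\<in>gen n. exp (- lam * tau x s) * f (t - tau x s))"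
proof (induction n arbitrary: t s)
  case (Suc n)
  have "(\<Sum>k<Suc n. \<Sum>x\<in>gen k. exp (- lam * tau x s) * r (t - tau x s))
      = r t + (\<Sum>k<n. \<Sum>x\<in>gen (Suc k). exp (- lam * tau x s) * r (t - tau x s))"
    by (subst sum.lessThan_Suc_shift) simp
  also have "(\<Sum>k<n. \<Sum>x\<in>gen (Suc k). exp (- lam * tau x s) * r (t - tau x s))
     = (\<Sum>i\<in>A. exp (- lam * T i (s [])) *
        (\<Sum>k<n. \<Sum>x\<in>gen k. exp (- lam * tau x (shift i s)) * r (t - T i (s []) - tau x (shift i s))))"
    unfolding sum_gen_Suc sum_distrib_left
    by (subst sum.swap, intro sum.cong refl) (simp add: exp_lam_add diff_diff_eq)
  finally have 1: "(\<Sum>k<Suc n. \<Sum>x\<in>gen k. exp (- lam * tau x s) * r (t - tau x s)) = r t + \<dots>" .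
  have 2: "(\<Sum>x\<in>gen (Suc n). exp (- lam * tau x s) * f (t - tau x s))
     = (\<Sum>i\<in>A. exp (- lam * T i (s [])) *
        (\<Sum>x\<in>gen n. exp (- lam * tau x (shift i s)) * f (t - T i (s []) - tau x (shift i s))))"
    unfolding sum_gen_Suc sum_distrib_left by (intro sum.cong refl) (simp add: exp_lam_add diff_diff_eq)
  show ?case
    unfolding 1 2 by (simp add: Psi_apply Suc distrib_left sum.distrib)
qed simp

lemma L2_bounded_mono: "L2_bounded d C f F \<Longrightarrow> C \<le> C' \<Longrightarrow> L2_bounded d C' f F"
  unfolding L2_bounded_def by (fastforce elim: order.trans intro: ennreal_leI mult_right_mono)

text \<open>Since \<open>f\<close> is a fixed point of the mean equation, all iterates have mean
  \<open>f\<close> and every step uses the same \<open>R\<close> and \<open>B\<close>. The constants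
  thus follow an affine recursion of slope \<open>contraction d\<close>, which is below 1.\<close>

lemma L2_bounded_affine_iter:
  assumes d: "0 \<le> d" "d < lam" "contraction d < 1"
    and r[measurable]: "r \<in> borel_measurable borel" and f[measurable]: "f \<in> borel_measurable borel"
    and r_bound: "\<And>t. \<bar>r t\<bar> \<le> R * exp (- d * t)" and f_bound: "\<And>t. \<bar>f t\<bar> \<le> B * exp (- d * t)"
    and fixed_point: "\<And>t. f t = r t + (\<Sum>i\<in>A. \<integral>u. exp (- lam * T i u) * f (t - T i u) \<partial>Q)"
  shows "\<exists>C. \<forall>n. L2_bounded d C f (affine_iter r f n)"
proof -
  define H where "H = (R + real (card A) * B)\<^sup>2"
  \<comment> \<open>The first summand covers iterate 0; the second is the fixed point of
    \<open>C \<mapsto> H + contraction d * C\<close>, so their sum is not exceeded after a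
    step.\<close>
  define C where "C = B\<^sup>2 + H / (1 - contraction d)"
  have H: "0 \<le> H" by (simp add: H_def)
  have C: "B\<^sup>2 \<le> C" "0 \<le> C" using H d by (auto simp: C_def)
  have "H = (1 - contraction d) * (H / (1 - contraction d))" using d by simp
  also have "\<dots> \<le> (1 - contraction d) * C"
    using d by (intro mult_left_mono) (auto simp: C_def)
  finally have step: "H + contraction d * C \<le> C" by (simp add: algebra_simps)
  have "L2_bounded d C f (affine_iter r f n)" for n
  proof (induction n)
    case 0
    have "(f t)\<^sup>2 \<le> C * exp (- 2 * d * t)" for t
    proof -
      have "(f t)\<^sup>2 \<le> (B * exp (- d * t))\<^sup>2"
        using f_bound[of t] by (rule abs_le_square_iff[THEN iffD1, OF order.trans]) simp
      also have "\<dots> = B\<^sup>2 * exp (- 2 * d * t)" by (simp add: power_mult_distrib mult.assoc flip: exp_double)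
      also have "\<dots> \<le> C * exp (- 2 * d * t)" using C by (intro mult_right_mono) auto
      finally show ?thesis .
    qed
    then have bound: "ennreal ((f t)\<^sup>2) \<le> ennreal (C * exp (- 2 * d * t))" for t
      by (rule ennreal_leI)
    show ?case
      unfolding L2_bounded_def affine_iter.simps fst_conv
    proof (intro conjI allI)
      show "(\<lambda>p. f (fst p)) \<in> borel_measurable (borel \<Otimes>\<^sub>M tree_space)" by measurable
      show "(\<integral>\<^sup>+ s. ennreal ((f t)\<^sup>2) \<partial>tree_space) \<le> ennreal (C * exp (- 2 * d * t))" for t
        using bound[of t] by (simp only: nn_integral_const tree.emeasure_space_1 mult_1_right)
      show "(\<integral>s. f t \<partial>tree_space) = f t" for t
        by (simp only: lebesgue_integral_const tree.prob_space) simp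
    qed (rule C)
  next
    case (Suc n)
    have "(\<lambda>t. r t + (\<Sum>i\<in>A. \<integral>u. exp (- lam * T i u) * f (t - T i u) \<partial>Q)) = f"
      by (intro ext fixed_point[symmetric])
    with L2_bounded_step[OF Suc d(1,2) r f r_bound f_bound]
    have "L2_bounded d (H + contraction d * C) f (affine_iter r f (Suc n))"
      by (simp only: H_def affine_iter.simps)
    then show ?case using step by (rule L2_bounded_mono)
  qed
  then show ?thesis by blast
qed

end

section \<open>The martingale limit\<close>

text \<open>
  The function \<open>b\<close> is the deviation of \<open>exp (- lam * t) * m t\<close> from its limit \<open>c\<close>,
  where \<open>m t\<close> is the mean number of words born until time \<open>t\<close>.
\<close>

locale branching_renewal = branching Q A T lam
  for Q :: "'u measure" and A T lam +
  fixes d c B :: real and b :: "real \<Rightarrow> real"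
  assumes card_A: "2 \<le> card A"
    and d: "0 < d" "d < lam" "contraction d < 1"
    and c_pos: "0 < c"
    and b_measurable [measurable]: "b \<in> borel_measurable borel"
    and b_neg: "\<And>t. t < 0 \<Longrightarrow> b t = - c"
    and b_bound: "\<And>t. \<bar>b t\<bar> \<le> B * exp (- d * t)"
    and b_renewal: "\<And>t. b t = (if 0 \<le> t then exp (- lam * t) else 0)
      + (\<Sum>i\<in>A. \<integral>u. exp (- lam * T i u) * b (t - T i u) \<partial>Q)"
begin

lemma contraction_0: "contraction 0 < 1"
proof -
  have "contraction 0 \<le> contraction d"
    unfolding contraction_def
  proof (intro sum_mono integral_mono)
    fix i u assume i: "i \<in> A"
    show "integrable Q (\<lambda>u. exp (- 2 * (lam - 0) * T i u))" "integrable Q (\<lambda>u. exp (- 2 * (lam - d) * T i u))"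
      using integrable_exp_T[OF i, of "2 * lam"] integrable_exp_T[OF i, of "2 * (lam - d)"] lam_pos d by auto
    show "exp (- 2 * (lam - 0) * T i u) \<le> exp (- 2 * (lam - d) * T i u)"
      using T_nonneg[OF i, of u] d by (simp add: algebra_simps mult_right_mono)
  qed
  with d show ?thesis by simp
qed

definition Wn :: "nat \<Rightarrow> (nat list \<Rightarrow> 'u) \<Rightarrow> real" where
  "Wn n s = (\<Sum>x\<in>gen n. exp (- lam * tau x s))"

definition W :: "(nat list \<Rightarrow> 'u) \<Rightarrow> real" where
  "W s = lim (\<lambda>n. Wn n s)"

lemma Wn_measurable [measurable]: "Wn n \<in> borel_measurable tree_space"
  unfolding Wn_def by (auto intro!: borel_measurable_sum simp: gen_words)

lemma W_measurable [measurable]: "W \<in> borel_measurable tree_space"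
  unfolding W_def by (rule borel_measurable_lim_metric) measurable

lemma Wn_0 [simp]: "Wn 0 s = 1"
  by (simp add: Wn_def)

lemma Wn_Suc: "Wn (Suc n) s = (\<Sum>i\<in>A. exp (- lam * T i (s [])) * Wn n (shift i s))"
  unfolding Wn_def sum_gen_Suc sum_distrib_left by (simp add: exp_lam_add)

lemma Wn_nonneg: "0 \<le> Wn n s"
  unfolding Wn_def by (intro sum_nonneg) auto

lemma Psi_power_one: "(Psi ^^ n) (\<lambda>_. 1) (t, s) = Wn n s"
  by (simp add: Psi_power Wn_def)

text \<open>Brings the martingale increments into the form of iterates of a centred functional, to
  which \<open>L2_bounded_Psi_power\<close> applies.\<close>

lemma W_increment: "(Psi ^^ n) (\<lambda>p. Psi (\<lambda>_. 1) p - 1) (t, s) = Wn (Suc n) s - Wn n s"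
proof -
  have "(Psi ^^ n) (\<lambda>p. Psi (\<lambda>_. 1) p - 1) (t, s) = (Psi ^^ n) (Psi (\<lambda>_. 1)) (t, s) - (Psi ^^ n) (\<lambda>_. 1) (t, s)"
    by (rule Psi_power_diff)
  also have "(Psi ^^ n) (Psi (\<lambda>_. 1)) = (Psi ^^ Suc n) (\<lambda>_. 1)" by (simp add: funpow_swap1)
  finally show ?thesis by (simp only: Psi_power_one)
qed

text \<open>The mean vanishes by \<open>malthus\<close>; the second moment is finite because each of
  the \<open>card A\<close> discount factors lies in the unit interval.\<close>

lemma W_increment_bounded: "\<exists>C. L2_bounded 0 C (\<lambda>_. 0) (\<lambda>p. Psi (\<lambda>_. 1) p - 1)"
proof -
  have 1: "L2_bounded 0 1 (\<lambda>_. 1) (\<lambda>_. 1)"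
    by (simp add: L2_bounded_def tree.emeasure_space_1 tree.prob_space)
  obtain C where "L2_bounded 0 C (\<lambda>t. 0 + (\<Sum>i\<in>A. \<integral>u. exp (- lam * T i u) * 1 \<partial>Q)) (\<lambda>(t, s). 0 + Psi (\<lambda>_. 1) (t, s))"
    using L2_bounded_step[OF 1 order.refl lam_pos, of "\<lambda>_. 0" 0 1] by auto
  then have mean: "(\<integral>s. Psi (\<lambda>_. 1) (t, s) \<partial>tree_space) = 1" for t
    using malthus by (simp add: L2_bounded_def)
  have eq: "Psi (\<lambda>_. 1) (t, s) = Wn 1 s" for t s using Psi_power_one[of 1 t s] by simp
  have bound: "\<bar>Wn 1 s - 1\<bar> \<le> real (card A) + 1" for s
  proof -
    have "Wn 1 s \<le> (\<Sum>i\<in>A. 1)"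
      unfolding One_nat_def Wn_Suc using lam_pos T_nonneg by (intro sum_mono) auto
    then show ?thesis using Wn_nonneg[of 1 s] by auto
  qed
  have int: "integrable tree_space (\<lambda>s. Wn 1 s - 1)"
    using bound by (intro tree.integrable_const_bound[where B="real (card A) + 1"]) auto
  then have "integrable tree_space (\<lambda>s. (Wn 1 s - 1) + 1)" by (rule Bochner_Integration.integrable_add) simp
  then have "(\<integral>s. Wn 1 s - 1 \<partial>tree_space) = 0"
    using mean by (simp add: eq tree.prob_space)
  moreover have "(\<integral>\<^sup>+ s. ennreal ((Wn 1 s - 1)\<^sup>2) \<partial>tree_space) \<le> ennreal ((real (card A) + 1)\<^sup>2)"
  proof -
    have "(\<integral>\<^sup>+ s. ennreal ((Wn 1 s - 1)\<^sup>2) \<partial>tree_space) \<le> (\<integral>\<^sup>+ s. ennreal ((real (card A) + 1)\<^sup>2) \<partial>tree_space)"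
      by (intro nn_integral_mono ennreal_leI abs_le_square_iff[THEN iffD1] order.trans[OF bound]) simp
    then show ?thesis by (simp add: tree.emeasure_space_1)
  qed
  moreover have "(\<lambda>p. Psi (\<lambda>_. 1) p - 1) \<in> borel_measurable (borel \<Otimes>\<^sub>M tree_space)" by measurable
  ultimately have "L2_bounded 0 ((real (card A) + 1)\<^sup>2) (\<lambda>_. 0) (\<lambda>p. Psi (\<lambda>_. 1) p - 1)"
    by (simp add: L2_bounded_def eq)
  then show ?thesis by blast
qed

lemma W_increment_summable:
  "AE s in tree_space. summable (\<lambda>n. \<bar>Wn (Suc n) s - Wn n s\<bar>)"
  "summable (\<lambda>n. \<integral>s. \<bar>Wn (Suc n) s - Wn n s\<bar> \<partial>tree_space)"
  "integrable tree_space (\<lambda>s. Wn (Suc n) s - Wn n s)"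
  "(\<integral>s. Wn (Suc n) s - Wn n s \<partial>tree_space) = 0"
proof -
  obtain C where C: "L2_bounded 0 C (\<lambda>_. 0) (\<lambda>p. Psi (\<lambda>_. 1) p - 1)"
    using W_increment_bounded by blast
  have *: "L2_bounded 0 (contraction 0 ^ n * C) (\<lambda>_. 0) ((Psi ^^ n) (\<lambda>p. Psi (\<lambda>_. 1) p - 1))" for n
    by (rule L2_bounded_Psi_power[OF C order.refl lam_pos])
  have C0: "0 \<le> C" using C by (simp add: L2_bounded_def)
  have bound: "(\<integral>\<^sup>+ s. ennreal ((Wn (Suc n) s - Wn n s)\<^sup>2) \<partial>tree_space) \<le> ennreal (contraction 0 ^ n * C)" for n
    using *[of n] unfolding L2_bounded_def W_increment by simp
  have m: "(\<lambda>s. Wn (Suc n) s - Wn n s) \<in> borel_measurable tree_space" for n by measurable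
  note r = tree.summable_of_geometric_second_moment[OF m bound contraction_nonneg contraction_0 C0]
  show "AE s in tree_space. summable (\<lambda>n. \<bar>Wn (Suc n) s - Wn n s\<bar>)"
    "summable (\<lambda>n. \<integral>s. \<bar>Wn (Suc n) s - Wn n s\<bar> \<partial>tree_space)"
    "integrable tree_space (\<lambda>s. Wn (Suc n) s - Wn n s)" by (fact r)+
  show "(\<integral>s. Wn (Suc n) s - Wn n s \<partial>tree_space) = 0"
    using *[of n] unfolding L2_bounded_def W_increment by simp
qed

lemma Wn_telescope: "Wn n s = 1 + (\<Sum>k<n. Wn (Suc k) s - Wn k s)"
  by (subst sum_lessThan_telescope) simp

lemma W_sums:
  assumes "summable (\<lambda>n. \<bar>Wn (Suc n) s - Wn n s\<bar>)"
  shows "(\<lambda>n. Wn n s) \<longlonglongrightarrow> W s" "W s = 1 + (\<Sum>n. Wn (Suc n) s - Wn n s)"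
proof -
  have "(\<lambda>n. 1 + (\<Sum>k<n. Wn (Suc k) s - Wn k s)) \<longlonglongrightarrow> 1 + (\<Sum>n. Wn (Suc n) s - Wn n s)"
    using summable_rabs_cancel[OF assms] by (intro tendsto_intros summable_LIMSEQ)
  then have 1: "(\<lambda>n. Wn n s) \<longlonglongrightarrow> 1 + (\<Sum>n. Wn (Suc n) s - Wn n s)"
    by (simp only: Wn_telescope[symmetric])
  then show 2: "W s = 1 + (\<Sum>n. Wn (Suc n) s - Wn n s)"
    unfolding W_def by (rule limI)
  show "(\<lambda>n. Wn n s) \<longlonglongrightarrow> W s" using 1 2 by simp
qed

lemma AE_Wn_tendsto: "AE s in tree_space. (\<lambda>n. Wn n s) \<longlonglongrightarrow> W s"
  using W_increment_summable(1) by eventually_elim (rule W_sums)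

lemma expectation_W: "integrable tree_space W" "(\<integral>s. W s \<partial>tree_space) = 1"
proof -
  let ?S = "\<lambda>s. \<Sum>n. Wn (Suc n) s - Wn n s"
  have int: "integrable tree_space ?S" and zero: "(\<integral>s. ?S s \<partial>tree_space) = 0"
  proof -
    have n: "AE s in tree_space. summable (\<lambda>n. norm (Wn (Suc n) s - Wn n s))"
      "summable (\<lambda>n. \<integral>s. norm (Wn (Suc n) s - Wn n s) \<partial>tree_space)"
      using W_increment_summable(1,2) by (simp_all only: real_norm_def)
    show "integrable tree_space ?S" by (rule integrable_suminf[OF W_increment_summable(3) n])
    show "(\<integral>s. ?S s \<partial>tree_space) = 0"
      by (subst integral_suminf[OF W_increment_summable(3) n]) (simp only: W_increment_summable(4) suminf_zero)
  qed
  have AE: "AE s in tree_space. W s = 1 + ?S s"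
    using W_increment_summable(1) by eventually_elim (rule W_sums)
  have i1: "integrable tree_space (\<lambda>s. 1 + ?S s)" using int by simp
  show "integrable tree_space W"
    by (rule integrable_cong_AE_imp[OF i1 W_measurable]) (use AE in \<open>eventually_elim, simp\<close>)
  have "(\<integral>s. W s \<partial>tree_space) = (\<integral>s. 1 + ?S s \<partial>tree_space)"
    by (rule integral_cong_AE[OF W_measurable borel_measurable_integrable[OF i1] AE])
  also have "\<dots> = 1" using int zero by (simp add: tree.prob_space)
  finally show "(\<integral>s. W s \<partial>tree_space) = 1" .
qed

text \<open>\<open>Wn\<close> is the affine iterate with \<open>r = 0\<close> and
  \<open>f = 1\<close>, where 1 is a fixed point by \<open>malthus\<close>. Its second moments are
  therefore bounded uniformly in \<open>n\<close>, and Fatou's lemma passes the bound to the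
  limit.\<close>

lemma second_moment_W: "\<exists>C. (\<integral>\<^sup>+ s. ennreal ((W s)\<^sup>2) \<partial>tree_space) \<le> ennreal C"
proof -
  have "\<exists>C. \<forall>n. L2_bounded 0 C (\<lambda>_. 1) (affine_iter (\<lambda>_. 0) (\<lambda>_. 1) n)"
    using lam_pos contraction_0 malthus by (intro L2_bounded_affine_iter[where R=0 and B=1]) auto
  then obtain C where C: "\<And>n. L2_bounded 0 C (\<lambda>_. 1) (affine_iter (\<lambda>_. 0) (\<lambda>_. 1) n)" by blast
  have bound: "(\<integral>\<^sup>+ s. ennreal ((Wn n s)\<^sup>2) \<partial>tree_space) \<le> ennreal C" for n
    using C[of n] by (simp add: L2_bounded_def affine_iter_eq Wn_def)
  have "(\<integral>\<^sup>+ s. ennreal ((W s)\<^sup>2) \<partial>tree_space) = (\<integral>\<^sup>+ s. liminf (\<lambda>n. ennreal ((Wn n s)\<^sup>2)) \<partial>tree_space)"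
    using AE_Wn_tendsto
    by (intro nn_integral_cong_AE, eventually_elim)
       (intro lim_imp_Liminf[symmetric] tendsto_ennrealI tendsto_power trivial_limit_sequentially, assumption)
  also have "\<dots> \<le> liminf (\<lambda>n. \<integral>\<^sup>+ s. ennreal ((Wn n s)\<^sup>2) \<partial>tree_space)"
    by (intro nn_integral_liminf) measurable
  also have "\<dots> \<le> ennreal C" by (intro Liminf_le) (use bound in auto)
  finally show ?thesis by blast
qed

lemma W_recursion:
  assumes "\<And>i. i \<in> A \<Longrightarrow> (\<lambda>n. Wn n (shift i s)) \<longlonglongrightarrow> W (shift i s)"
  shows "W s = (\<Sum>i\<in>A. exp (- lam * T i (s [])) * W (shift i s))"
proof -
  have "(\<lambda>n. Wn (Suc n) s) \<longlonglongrightarrow> (\<Sum>i\<in>A. exp (- lam * T i (s [])) * W (shift i s))"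
    unfolding Wn_Suc by (intro tendsto_intros assms)
  then have "(\<lambda>n. Wn n s) \<longlonglongrightarrow> (\<Sum>i\<in>A. exp (- lam * T i (s [])) * W (shift i s))"
    by (rule LIMSEQ_imp_Suc)
  then show ?thesis unfolding W_def by (rule limI)
qed

lemma AE_shift_all: "AE s in tree_space. G s \<Longrightarrow> AE s in tree_space. \<forall>i\<in>A. G (shift i s)"
  by (intro AE_finite_allI finite_A AE_shift)

lemma AE_W_recursion: "AE s in tree_space. W s = (\<Sum>i\<in>A. exp (- lam * T i (s [])) * W (shift i s))"
  using AE_shift_all[OF AE_Wn_tendsto] by eventually_elim (rule W_recursion, blast)

lemma AE_W_nonneg: "AE s in tree_space. 0 \<le> W s"
  using AE_Wn_tendsto by eventually_elim (rule LIMSEQ_le_const, auto simp: Wn_nonneg)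

text \<open>The probability \<open>p\<close> of \<open>W = 0\<close> satisfies \<open>p = p ^ K\<close> and is not \<open>1\<close>.\<close>

lemma AE_W_pos: "AE s in tree_space. 0 < W s"
proof -
  define Z where "Z = {s \<in> space tree_space. W s = 0}"
  have Z[measurable]: "Z \<in> sets tree_space" unfolding Z_def by measurable
  define p where "p = tree.prob Z"
  have "emeasure tree_space Z \<le> (\<integral>\<^sup>+ s. (\<Prod>i\<in>A. indicator Z (shift i s)) \<partial>tree_space)"
  proof -
    have "emeasure tree_space Z = (\<integral>\<^sup>+ s. indicator Z s \<partial>tree_space)" by simp
    also have "\<dots> \<le> (\<integral>\<^sup>+ s. (\<Prod>i\<in>A. indicator Z (shift i s)) \<partial>tree_space)"
    proof (rule nn_integral_mono_AE)
      have "AE s in tree_space. W s = (\<Sum>i\<in>A. exp (- lam * T i (s [])) * W (shift i s))" by (rule AE_W_recursion)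
      moreover have "AE s in tree_space. \<forall>i\<in>A. 0 \<le> W (shift i s) \<and> shift i s \<in> space tree_space"
        using AE_shift_all[of "\<lambda>s. 0 \<le> W s \<and> s \<in> space tree_space"] AE_W_nonneg by simp
      ultimately show "AE s in tree_space. indicator Z s \<le> (\<Prod>i\<in>A. indicator Z (shift i s) :: ennreal)"
      proof eventually_elim
        case (elim s)
        show ?case
        proof (cases "s \<in> Z")
          case True
          then have "(\<Sum>i\<in>A. exp (- lam * T i (s [])) * W (shift i s)) = 0" using elim by (simp add: Z_def)
          then have "\<forall>i\<in>A. exp (- lam * T i (s [])) * W (shift i s) = 0"
            using elim(2) by (subst (asm) sum_nonneg_eq_0_iff) (auto simp: finite_A)
          then have 0: "\<forall>i\<in>A. W (shift i s) = 0" by simp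
          have "shift i s \<in> Z" if "i \<in> A" for i
            unfolding Z_def using that 0 elim(2) by blast
          then have "(\<Prod>i\<in>A. indicator Z (shift i s) :: ennreal) = (\<Prod>i\<in>A. 1)"
            by (intro prod.cong) auto
          then show ?thesis by (simp only: prod.neutral_const) (simp add: indicator_def)
        qed simp
      qed
    qed
    finally show ?thesis .
  qed
  also have "\<dots> = (\<integral>\<^sup>+ u. \<integral>\<^sup>+ r. (\<Prod>i\<in>A. indicator Z (shift i (glue u r))) \<partial>PiM A (\<lambda>_. tree_space) \<partial>Q)"
    by (rule nn_integral_tree_space) measurable
  also have "\<dots> = (\<integral>\<^sup>+ u. \<integral>\<^sup>+ r. (\<Prod>i\<in>A. indicator Z (r i)) \<partial>PiM A (\<lambda>_. tree_space) \<partial>Q)"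
    by (intro nn_integral_cong prod.cong refl) (auto simp: shift_glue space_PiM PiE_iff)
  also have "\<dots> = emeasure tree_space Z ^ card A"
    by (subst forest.product_nn_integral_prod)
       (use finite_A in \<open>auto simp: prob_space.emeasure_space_1[OF prob_space_axioms]\<close>)
  finally have "p \<le> p ^ card A"
    by (simp add: p_def tree.emeasure_eq_measure ennreal_power)
  also have "\<dots> \<le> p ^ 2" using card_A by (intro power_decreasing) (auto simp: p_def)
  finally have "p \<le> p * p" by (simp add: power2_eq_square)
  then have "p = 0 \<or> p = 1"
  proof -
    have "p * (p - 1) \<ge> 0" using \<open>p \<le> p * p\<close> by (simp add: algebra_simps)
    moreover have "p \<le> 1" "0 \<le> p" by (auto simp: p_def)
    ultimately show ?thesis by (auto simp: zero_le_mult_iff)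
  qed
  moreover have "p \<noteq> 1"
  proof
    assume "p = 1"
    then have "AE s in tree_space. s \<in> Z" unfolding p_def by (rule tree.AE_prob_1)
    then have "(\<integral>s. W s \<partial>tree_space) = (\<integral>s. 0 \<partial>tree_space)"
      by (intro integral_cong_AE) (auto simp: Z_def)
    with expectation_W(2) show False by simp
  qed
  ultimately have "p = 0" by simp
  then have "AE s in tree_space. s \<notin> Z"
    using Z by (simp add: p_def AE_iff_measurable[OF Z] tree.emeasure_eq_measure AE_not_in null_setsI)
  with AE_W_nonneg AE_space show ?thesis
    by eventually_elim (auto simp: Z_def)
qed

end

section \<open>Growth of the tree\<close>

text \<open>
  The grid is dense enough to control \<open>exp (- k * t) * N t\<close> between its points by monotonicity of \<open>N\<close>,
  and sparse enough for errors of order \<open>exp (- 2 * d * t)\<close> to be summable along it.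
\<close>

lemma tendsto_exp_growth_of_log_grid:
  fixes N :: "real \<Rightarrow> real" and k d L :: real
  defines "g \<equiv> (\<lambda>n. ln (real n + 1) / d)"
  assumes mono: "\<And>s t. s \<le> t \<Longrightarrow> N s \<le> N t" and nonneg: "\<And>t. 0 \<le> N t"
    and k: "0 < k" and d: "0 < d"
    and grid: "(\<lambda>n. exp (- k * g n) * N (g n)) \<longlonglongrightarrow> L"
  shows "((\<lambda>t. exp (- k * t) * N t) \<longlongrightarrow> L) at_top"
proof -
  \<comment> \<open>For \<open>t\<close> between consecutive grid points, monotonicity puts
    \<open>exp (- k * t) * N t\<close> between \<open>l n\<close> and \<open>u n\<close>. Both
    differ from grid values by the factor \<open>exp\<close> of \<open>k\<close> times the gap, up
    to sign, and the gaps tend to 0.\<close>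
  define l where "l n = exp (- k * g (Suc n)) * N (g n)" for n
  define u where "u n = exp (- k * g n) * N (g (Suc n))" for n
  have gap: "(\<lambda>n. g (Suc n) - g n) \<longlonglongrightarrow> 0"
  proof -
    have "(\<lambda>n. ln (1 + inverse (real (Suc n)))) \<longlonglongrightarrow> ln (1 + 0)"
      by (intro tendsto_intros LIMSEQ_inverse_real_of_nat) simp
    moreover have "ln (1 + inverse (real (Suc n))) = ln (real n + 2) - ln (real n + 1)" for n
    proof -
      have "1 + inverse (real (Suc n)) = (real n + 2) / (real n + 1)" by (simp add: field_simps)
      then show ?thesis by (simp add: ln_div)
    qed
    ultimately have "(\<lambda>n. ln (real n + 2) - ln (real n + 1)) \<longlonglongrightarrow> 0" by simp
    then have "(\<lambda>n. (ln (real n + 2) - ln (real n + 1)) / d) \<longlonglongrightarrow> 0 / d"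
      using d by (intro tendsto_intros) auto
    then show ?thesis by (simp add: g_def diff_divide_distrib add.commute)
  qed
  have "l = (\<lambda>n. exp (- k * g n) * N (g n) * exp (- k * (g (Suc n) - g n)))"
    by (rule ext) (simp add: l_def algebra_simps flip: exp_add)
  moreover have "(\<lambda>n. exp (- k * g n) * N (g n) * exp (- k * (g (Suc n) - g n))) \<longlonglongrightarrow> L * exp (- k * 0)"
    by (intro tendsto_intros grid gap)
  ultimately have l: "l \<longlonglongrightarrow> L" by simp
  have "u = (\<lambda>n. exp (- k * g (Suc n)) * N (g (Suc n)) * exp (k * (g (Suc n) - g n)))"
    by (rule ext) (simp add: u_def algebra_simps flip: exp_add)
  moreover have "(\<lambda>n. exp (- k * g (Suc n)) * N (g (Suc n)) * exp (k * (g (Suc n) - g n))) \<longlonglongrightarrow> L * exp (k * 0)"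
    by (intro tendsto_intros LIMSEQ_Suc[OF grid] gap)
  ultimately have u: "u \<longlonglongrightarrow> L" by simp
  \<comment> \<open>Inverts the grid: as \<open>g n\<close> is \<open>ln (n + 1) / d\<close>, the
    index just below \<open>t\<close> is the integer part of \<open>exp (d * t)\<close> minus
    1.\<close>
  define f where "f t = nat \<lfloor>exp (d * t)\<rfloor> - 1" for t
  have "filterlim (\<lambda>t. exp (d * t)) at_top at_top"
    using d by (intro filterlim_compose[OF exp_at_top] filterlim_tendsto_pos_mult_at_top[OF tendsto_const _ filterlim_ident])
  then have f: "filterlim f sequentially at_top"
    unfolding f_def
    by (intro filterlim_compose[OF filterlim_minus_const_nat_at_top]
        filterlim_compose[OF filterlim_nat_sequentially] filterlim_compose[OF filterlim_floor_sequentially])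
  have f_bounds: "g (f t) \<le> t" "t \<le> g (Suc (f t))" if "0 \<le> t" for t
  proof -
    have 1: "1 \<le> exp (d * t)" using that d by simp
    then have *: "real (f t) + 1 = of_int \<lfloor>exp (d * t)\<rfloor>" by (simp add: f_def of_nat_diff le_nat_iff)
    then have "real (f t) + 1 \<le> exp (d * t)" "exp (d * t) \<le> real (f t) + 2" by linarith+
    then have "ln (real (f t) + 1) \<le> ln (exp (d * t))" "ln (exp (d * t)) \<le> ln (real (f t) + 2)"
      by (auto simp del: ln_exp)
    then have "ln (real (f t) + 1) \<le> d * t" "d * t \<le> ln (real (f t) + 2)" by simp_all
    then show "g (f t) \<le> t" "t \<le> g (Suc (f t))"
      using d by (auto simp: g_def field_simps add.commute)
  qed
  show ?thesis
  proof (rule tendsto_sandwich)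
    show "((\<lambda>t. l (f t)) \<longlongrightarrow> L) at_top" "((\<lambda>t. u (f t)) \<longlongrightarrow> L) at_top"
      by (rule filterlim_compose[OF l f] filterlim_compose[OF u f])+
    show "\<forall>\<^sub>F t in at_top. l (f t) \<le> exp (- k * t) * N t"
      using eventually_ge_at_top[of 0]
      by eventually_elim (use f_bounds k in \<open>auto simp: l_def intro!: mult_mono mono nonneg\<close>)
    show "\<forall>\<^sub>F t in at_top. exp (- k * t) * N t \<le> u (f t)"
      using eventually_ge_at_top[of 0]
      by eventually_elim (use f_bounds k in \<open>auto simp: u_def intro!: mult_mono mono nonneg\<close>)
  qed
qed

context branching_renewal begin

text \<open>The branching recursion multiplies the mean by \<open>contraction 0\<close> per
  generation. The exponent is doubled because with \<open>- lam\<close> the mean would be 1 in every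
  generation and nothing would decay.\<close>

lemma nn_integral_sum_exp_double_tau:
  "(\<integral>\<^sup>+ s. ennreal (\<Sum>x\<in>gen n. exp (- 2 * lam * tau x s)) \<partial>tree_space) = ennreal (contraction 0 ^ n)"
proof (induction n)
  case 0
  show ?case by (simp add: tree.emeasure_space_1)
next
  case (Suc n)
  define Z where "Z s = (\<Sum>x\<in>gen n. exp (- 2 * lam * tau x s))" for s
  have Z[measurable]: "Z \<in> borel_measurable tree_space"
    unfolding Z_def by (auto intro!: borel_measurable_sum simp: gen_words)
  have Z0: "0 \<le> Z s" for s unfolding Z_def by (intro sum_nonneg) auto
  have eq: "(\<Sum>x\<in>gen (Suc n). exp (- 2 * lam * tau x s)) = (\<Sum>i\<in>A. exp (- 2 * lam * T i (s [])) * Z (shift i s))" for s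
    unfolding Z_def sum_gen_Suc sum_distrib_left by (intro sum.cong refl) (simp add: algebra_simps flip: exp_add)
  have "(\<integral>\<^sup>+ s. ennreal (\<Sum>x\<in>gen (Suc n). exp (- 2 * lam * tau x s)) \<partial>tree_space)
     = (\<integral>\<^sup>+ s. (\<Sum>i\<in>A. ennreal (exp (- 2 * lam * T i (s [])) * Z (shift i s))) \<partial>tree_space)"
    unfolding eq using Z0 by (intro nn_integral_cong) (simp add: sum_ennreal)
  also have "\<dots> = (\<Sum>i\<in>A. \<integral>\<^sup>+ s. ennreal (exp (- 2 * lam * T i (s [])) * Z (shift i s)) \<partial>tree_space)"
    by (intro nn_integral_sum) measurable
  also have "\<dots> = (\<Sum>i\<in>A. ennreal ((\<integral>u. exp (- 2 * lam * T i u) \<partial>Q) * contraction 0 ^ n))"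
  proof (intro sum.cong refl)
    fix i assume i[measurable]: "i \<in> A"
    have "(\<integral>\<^sup>+ s. ennreal (exp (- 2 * lam * T i (s [])) * Z (shift i s)) \<partial>tree_space)
      = (\<integral>\<^sup>+ p. ennreal (exp (- 2 * lam * T i (fst p)) * Z (snd p)) \<partial>(Q \<Otimes>\<^sub>M tree_space))"
      by (subst distr_root_shift[OF i, symmetric], subst nn_integral_distr) auto
    also have "\<dots> = (\<integral>\<^sup>+ u. \<integral>\<^sup>+ s. ennreal (exp (- 2 * lam * T i u) * Z s) \<partial>tree_space \<partial>Q)"
      by (subst tree.nn_integral_fst[symmetric]) auto
    also have "\<dots> = (\<integral>\<^sup>+ u. ennreal (exp (- 2 * lam * T i u)) * (\<integral>\<^sup>+ s. ennreal (Z s) \<partial>tree_space) \<partial>Q)"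
      by (intro nn_integral_cong) (simp add: ennreal_mult' nn_integral_cmult)
    also have "\<dots> = (\<integral>\<^sup>+ u. ennreal (exp (- 2 * lam * T i u)) \<partial>Q) * ennreal (contraction 0 ^ n)"
      using Suc by (simp add: Z_def nn_integral_multc)
    also have "(\<integral>\<^sup>+ u. ennreal (exp (- 2 * lam * T i u)) \<partial>Q) = ennreal (\<integral>u. exp (- 2 * lam * T i u) \<partial>Q)"
      using integrable_exp_T[OF i, of "2 * lam"] lam_pos by (intro nn_integral_eq_integral) auto
    finally show "(\<integral>\<^sup>+ s. ennreal (exp (- 2 * lam * T i (s [])) * Z (shift i s)) \<partial>tree_space)
      = ennreal ((\<integral>u. exp (- 2 * lam * T i u) \<partial>Q) * contraction 0 ^ n)"
      by (simp add: ennreal_mult'' contraction_nonneg)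
  qed
  also have "\<dots> = ennreal (contraction 0 ^ Suc n)"
    using contraction_nonneg[of 0]
    by (subst sum_ennreal) (auto simp: contraction_def[of 0] sum_distrib_right)
  finally show ?case .
qed

text \<open>The doubled sums are almost surely summable, hence tend to 0, and a sum below
  \<open>exp (- 2 * lam * t)\<close> leaves no word of that generation born by time
  \<open>t\<close>. This excludes explosion.\<close>

lemma AE_tau_tendsto:
  "AE s in tree_space. \<forall>t. \<forall>\<^sub>F n in sequentially. \<forall>x\<in>gen n. t < tau x s"
proof -
  have "AE s in tree_space. summable (\<lambda>n. \<Sum>x\<in>gen n. exp (- 2 * lam * tau x s))"
  proof (rule AE_summable_of_nn_integral)
    show "summable (\<lambda>n. contraction 0 ^ n)"
      using contraction_nonneg[of 0] contraction_0 by (intro summable_geometric) auto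
    show "(\<lambda>s. \<Sum>x\<in>gen n. exp (- 2 * lam * tau x s)) \<in> borel_measurable tree_space" for n
      by (auto intro!: borel_measurable_sum simp: gen_words)
  qed (auto simp only: nn_integral_sum_exp_double_tau intro!: sum_nonneg zero_le_power contraction_nonneg, auto)
  then show ?thesis
  proof eventually_elim
    case (elim s)
    show ?case
    proof
      fix t
      have "\<forall>\<^sub>F n in sequentially. (\<Sum>x\<in>gen n. exp (- 2 * lam * tau x s)) < exp (- 2 * lam * t)"
        using summable_LIMSEQ_zero[OF elim] by (rule order_tendstoD) simp
      then show "\<forall>\<^sub>F n in sequentially. \<forall>x\<in>gen n. t < tau x s"
      proof eventually_elim
        case (elim n)
        show ?case
        proof
          fix x assume "x \<in> gen n"
          then have "exp (- 2 * lam * tau x s) \<le> (\<Sum>x\<in>gen n. exp (- 2 * lam * tau x s))"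
            by (intro member_le_sum) auto
          with elim have "exp (- 2 * lam * tau x s) < exp (- 2 * lam * t)" by linarith
          then show "t < tau x s" using lam_pos by simp
        qed
      qed
    qed
  qed
qed

definition alive :: "real \<Rightarrow> (nat list \<Rightarrow> 'u) \<Rightarrow> nat list set" where
  "alive t s = {x \<in> words. tau x s \<le> t}"

lemma alive_eq:
  assumes "\<forall>\<^sub>F n in sequentially. \<forall>x\<in>gen n. t < tau x s"
  shows "finite (alive t s)"
    and "\<forall>\<^sub>F n in sequentially. real (card (alive t s)) = (\<Sum>k<n. \<Sum>x\<in>gen k. if tau x s \<le> t then 1 else 0)"
proof -
  obtain m where m: "\<And>n x. m \<le> n \<Longrightarrow> x \<in> gen n \<Longrightarrow> t < tau x s"
    using assms by (auto simp: eventually_sequentially)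
  have eq: "alive t s = (\<Union>k\<in>{..<n}. {x \<in> gen k. tau x s \<le> t})" if n: "m \<le> n" for n
  proof (intro set_eqI iffI)
    fix x assume "x \<in> alive t s"
    then have x: "x \<in> gen (length x)" "tau x s \<le> t" by (auto simp: alive_def gen_def)
    then have "length x < n" using m[of "length x" x] n by (cases "length x < n") auto
    with x show "x \<in> (\<Union>k\<in>{..<n}. {x \<in> gen k. tau x s \<le> t})" by blast
  qed (auto simp: alive_def gen_words)
  show "finite (alive t s)" unfolding eq[OF order.refl] by auto
  have "real (card (alive t s)) = (\<Sum>k<n. \<Sum>x\<in>gen k. if tau x s \<le> t then 1 else 0)" if n: "m \<le> n" for n
  proof -
    have "card (alive t s) = (\<Sum>k<n. card {x \<in> gen k. tau x s \<le> t})"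
      unfolding eq[OF n] by (intro card_UN_disjoint) (auto intro: finite_subset[OF _ finite_gen], auto simp: gen_def)
    then show ?thesis
      by (simp add: sum.If_cases Int_def of_nat_sum)
  qed
  then show "\<forall>\<^sub>F n in sequentially. real (card (alive t s)) = (\<Sum>k<n. \<Sum>x\<in>gen k. if tau x s \<le> t then 1 else 0)"
    unfolding eventually_sequentially by blast
qed

definition discounted :: "real \<Rightarrow> real" where
  "discounted t = (if 0 \<le> t then exp (- lam * t) else 0)"

text \<open>Once generation \<open>n\<close> lies beyond \<open>t\<close>, the closed form is exact:
  every living word contributes \<open>exp (- lam * t)\<close>, and the remainder is
  \<open>- c * Wn n s\<close> because \<open>b\<close> is \<open>- c\<close> at negative
  ages.\<close>

lemma affine_iter_tendsto:
  assumes ev: "\<forall>\<^sub>F n in sequentially. \<forall>x\<in>gen n. t < tau x s" and W: "(\<lambda>n. Wn n s) \<longlonglongrightarrow> W s"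
  shows "(\<lambda>n. affine_iter discounted b n (t, s)) \<longlonglongrightarrow> exp (- lam * t) * real (card (alive t s)) - c * W s"
proof -
  have "\<forall>\<^sub>F n in sequentially. exp (- lam * t) * real (card (alive t s)) - c * Wn n s = affine_iter discounted b n (t, s)"
    using ev alive_eq(2)[OF ev]
  proof eventually_elim
    case (elim n)
    have "exp (- lam * tau x s) * discounted (t - tau x s) = exp (- lam * t) * (if tau x s \<le> t then 1 else 0)" for x
      by (simp add: discounted_def algebra_simps flip: exp_add)
    moreover have "(\<Sum>x\<in>gen n. exp (- lam * tau x s) * b (t - tau x s)) = (\<Sum>x\<in>gen n. exp (- lam * tau x s) * - c)"
      using elim by (intro sum.cong refl) (simp add: b_neg)
    ultimately show ?case
      by (simp only: affine_iter_eq elim Wn_def sum_distrib_left[symmetric] sum_distrib_right[symmetric]) simp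
  qed
  moreover have "(\<lambda>n. exp (- lam * t) * real (card (alive t s)) - c * Wn n s) \<longlonglongrightarrow> exp (- lam * t) * real (card (alive t s)) - c * W s"
    by (intro tendsto_intros W)
  ultimately show ?thesis by (rule Lim_transform_eventually[rotated])
qed

text \<open>The second moments of the iterates are at most \<open>C * exp (- 2 * d * t)\<close>
  uniformly in \<open>n\<close>, and by Fatou so is that of their limit, the deviation from
  \<open>c * W\<close>. At the time \<open>ln (k + 1) / d\<close> this bound is
  \<open>C / (k + 1)^2\<close>, which is summable.\<close>

lemma AE_alive_growth:
  "AE s in tree_space. ((\<lambda>t. exp (- lam * t) * real (card (alive t s))) \<longlongrightarrow> c * W s) at_top"
proof -
  have [measurable]: "discounted \<in> borel_measurable borel"
    unfolding discounted_def by measurable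
  have bound: "\<bar>discounted t\<bar> \<le> 1 * exp (- d * t)" for t
    using d by (auto simp: discounted_def mult_right_mono)
  have renewal: "b t = discounted t + (\<Sum>i\<in>A. \<integral>u. exp (- lam * T i u) * b (t - T i u) \<partial>Q)" for t
    unfolding discounted_def by (rule b_renewal)
  obtain C where C: "\<And>n. L2_bounded d C b (affine_iter discounted b n)"
    using L2_bounded_affine_iter[OF less_imp_le[OF d(1)] d(2,3) \<open>discounted \<in> _\<close> b_measurable bound b_bound renewal]
    by blast
  have C0: "0 \<le> C" using C[of 0] by (simp add: L2_bounded_def)
  have m[measurable]: "affine_iter discounted b n \<in> borel_measurable (borel \<Otimes>\<^sub>M tree_space)" for n
    using C[of n] by (simp add: L2_bounded_def)
  define g where "g n = ln (real n + 1) / d" for n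
  \<comment> \<open>A lower limit exists and is measurable for every \<open>s\<close>; where the
    iterates converge it is the squared deviation from \<open>c * W s\<close>.\<close>
  define V where "V k s = liminf (\<lambda>n. ennreal ((affine_iter discounted b n (g k, s))\<^sup>2))" for k s
  have V[measurable]: "V k \<in> borel_measurable tree_space" for k
    unfolding V_def by measurable
  have V_le: "(\<integral>\<^sup>+ s. V k s \<partial>tree_space) \<le> ennreal (C * (1 / (real k + 1)\<^sup>2))" for k
  proof -
    have "(\<integral>\<^sup>+ s. V k s \<partial>tree_space) \<le> liminf (\<lambda>n. \<integral>\<^sup>+ s. ennreal ((affine_iter discounted b n (g k, s))\<^sup>2) \<partial>tree_space)"
      unfolding V_def by (intro nn_integral_liminf) measurable
    also have "\<dots> \<le> ennreal (C * exp (- 2 * d * g k))"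
      using C by (intro Liminf_le) (auto simp: L2_bounded_def)
    also have "exp (- 2 * d * g k) = 1 / (real k + 1)\<^sup>2"
    proof -
      have "exp (- 2 * d * g k) = exp (- (2 * ln (real k + 1)))" using d by (simp add: g_def)
      also have "\<dots> = inverse (exp (ln (real k + 1)) ^ 2)"
        by (simp only: exp_minus exp_double)
      finally show ?thesis by (simp add: inverse_eq_divide add_pos_nonneg)
    qed
    finally show ?thesis .
  qed
  have "AE s in tree_space. summable (\<lambda>k. enn2real (V k s))"
  proof (rule AE_summable_of_nn_integral)
    show "summable (\<lambda>k. C * (1 / (real k + 1)\<^sup>2))"
      using summable_Suc_iff[THEN iffD2, OF inverse_power_summable[of 2, where 'a=real]]
      by (intro summable_mult) (simp add: inverse_eq_divide add.commute)
    show "(\<integral>\<^sup>+ s. ennreal (enn2real (V k s)) \<partial>tree_space) \<le> ennreal (C * (1 / (real k + 1)\<^sup>2))" for k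
      by (rule order.trans[OF nn_integral_mono V_le]) (metis enn2real_nonneg ennreal_enn2real_if order.refl zero_le)
  qed (use C0 in auto)
  then show ?thesis
    using AE_tau_tendsto AE_Wn_tendsto
  proof eventually_elim
    case (elim s)
    define N where "N t = real (card (alive t s))" for t
    have fin: "finite (alive t s)" for t using alive_eq(1) elim(2) by blast
    have V_eq: "enn2real (V k s) = (exp (- lam * g k) * N (g k) - c * W s)\<^sup>2" for k
    proof -
      have "(\<lambda>n. ennreal ((affine_iter discounted b n (g k, s))\<^sup>2)) \<longlonglongrightarrow> ennreal ((exp (- lam * g k) * N (g k) - c * W s)\<^sup>2)"
        unfolding N_def using elim(2,3) by (intro tendsto_ennrealI tendsto_power affine_iter_tendsto) auto
      then have "V k s = ennreal ((exp (- lam * g k) * N (g k) - c * W s)\<^sup>2)"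
        unfolding V_def by (intro lim_imp_Liminf) auto
      then show ?thesis by simp
    qed
    have "(\<lambda>k. (exp (- lam * g k) * N (g k) - c * W s)\<^sup>2) \<longlonglongrightarrow> 0"
      using summable_LIMSEQ_zero[OF elim(1)] by (simp only: V_eq)
    then have "(\<lambda>k. sqrt ((exp (- lam * g k) * N (g k) - c * W s)\<^sup>2)) \<longlonglongrightarrow> sqrt 0"
      by (rule tendsto_real_sqrt)
    then have "(\<lambda>k. exp (- lam * g k) * N (g k) - c * W s) \<longlonglongrightarrow> 0"
      by (simp add: tendsto_rabs_zero_iff)
    then have "(\<lambda>k. exp (- lam * g k) * N (g k)) \<longlonglongrightarrow> c * W s"
      by (simp add: LIM_zero_iff)
    then have "((\<lambda>t. exp (- lam * t) * N t) \<longlongrightarrow> c * W s) at_top"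
      unfolding g_def
    proof (rule tendsto_exp_growth_of_log_grid[rotated -1])
      show "N t \<le> N t'" if "t \<le> t'" for t t'
        unfolding N_def using that fin by (auto simp: alive_def intro!: card_mono)
    qed (use lam_pos d in \<open>auto simp: N_def\<close>)
    then show ?case by (simp only: N_def)
  qed
qed

end

section \<open>Entropy of the generations\<close>

text \<open>The upper bound is \<open>ln x \<le> x - 1\<close> at \<open>x = q / p\<close>. It makes
  the first-generation entropy at most linear in the masses, so that the second moment of
  \<open>W\<close> controls that of \<open>ent\<close>.\<close>

lemma neg_mult_ln_bounds:
  fixes p q :: real
  assumes "0 < p" "p \<le> q"
  shows "0 \<le> - (p * ln (p / q))" "- (p * ln (p / q)) \<le> q"
proof -
  have q: "0 < q" using assms by linarith
  have "ln (p / q) \<le> 0" using assms q by (subst ln_le_zero_iff) auto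
  then show "0 \<le> - (p * ln (p / q))" using assms by (simp add: mult_nonneg_nonpos)
  have "- ln (p / q) = ln (q / p)" using assms q by (simp add: ln_div)
  also have "\<dots> \<le> q / p - 1" using assms q by (intro ln_le_minus_one) auto
  finally have "p * (- ln (p / q)) \<le> p * (q / p - 1)" using assms by (intro mult_left_mono) auto
  also have "\<dots> \<le> q" using assms by (simp add: algebra_simps)
  finally show "- (p * ln (p / q)) \<le> q" by simp
qed

context branching_renewal begin

definition child_mass :: "nat \<Rightarrow> (nat list \<Rightarrow> 'u) \<Rightarrow> real" where
  "child_mass i s = exp (- lam * T i (s [])) * W (shift i s)"

text \<open>The entropy of the first generation, multiplied by \<open>W\<close>.\<close>

definition ent :: "(nat list \<Rightarrow> 'u) \<Rightarrow> real" where
  "ent s = - (\<Sum>i\<in>A. child_mass i s * ln (child_mass i s / W s))"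

definition mass :: "nat list \<Rightarrow> (nat list \<Rightarrow> 'u) \<Rightarrow> real" where
  "mass x s = exp (- lam * tau x s) * W (shift_word x s)"

text \<open>What the pathwise chain rule demands at a single vertex; strict positivity lets the
  logarithms of products and quotients split.\<close>

definition regular :: "(nat list \<Rightarrow> 'u) \<Rightarrow> bool" where
  "regular s \<longleftrightarrow> 0 < W s \<and> W s = (\<Sum>i\<in>A. child_mass i s) \<and> (\<forall>i\<in>A. 0 < child_mass i s)"

lemma child_mass_measurable [measurable]: "i \<in> A \<Longrightarrow> child_mass i \<in> borel_measurable tree_space"
  unfolding child_mass_def by measurable

lemma ent_measurable [measurable]: "ent \<in> borel_measurable tree_space"
  unfolding ent_def by measurable

lemma AE_regular: "AE s in tree_space. regular s"
  using AE_W_pos AE_W_recursion AE_shift_all[OF AE_W_pos]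
  by eventually_elim (auto simp: regular_def child_mass_def)

lemma ent_bounds:
  assumes "regular s"
  shows "\<bar>ent s\<bar> \<le> real (card A) * W s"
proof -
  have pos: "0 < child_mass i s" and le: "child_mass i s \<le> W s" if "i \<in> A" for i
  proof -
    show "0 < child_mass i s" using assms that by (simp add: regular_def)
    have "child_mass i s \<le> (\<Sum>i\<in>A. child_mass i s)"
      using assms that finite_A by (intro member_le_sum) (auto simp: regular_def less_imp_le)
    then show "child_mass i s \<le> W s" using assms by (simp add: regular_def)
  qed
  have eq: "ent s = (\<Sum>i\<in>A. - (child_mass i s * ln (child_mass i s / W s)))"
    by (simp add: ent_def sum_negf)
  have "0 \<le> ent s" unfolding eq by (intro sum_nonneg neg_mult_ln_bounds pos le)
  moreover have "ent s \<le> (\<Sum>i\<in>A. W s)" unfolding eq by (intro sum_mono neg_mult_ln_bounds pos le)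
  ultimately show ?thesis by simp
qed

lemma integrable_ent: "integrable tree_space ent"
proof (rule Bochner_Integration.integrable_bound)
  show "integrable tree_space (\<lambda>s. real (card A) * W s)" using expectation_W by simp
  show "AE s in tree_space. norm (ent s) \<le> norm (real (card A) * W s)"
    using AE_regular by eventually_elim (use ent_bounds in force)
qed measurable

definition ent_mean :: real where
  "ent_mean = (\<integral>s. ent s \<partial>tree_space)"

text \<open>The centring term is \<open>ent_mean * W\<close> and not \<open>ent_mean\<close>: the
  discounted sum of \<open>W\<close> over any generation reproduces \<open>W\<close> of the root, so
  \<open>Psi ^^ n\<close> turns this term into \<open>ent_mean * W s\<close>. The mean is zero
  because \<open>W\<close> has mean 1.\<close>

lemma ent_deviation_bounded:
  "\<exists>C. L2_bounded 0 C (\<lambda>_. 0) (\<lambda>p. ent (snd p) - ent_mean * W (snd p))"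
proof -
  obtain C where C: "(\<integral>\<^sup>+ s. ennreal ((W s)\<^sup>2) \<partial>tree_space) \<le> ennreal C"
    using second_moment_W by blast
  define k where "k = (real (card A) + \<bar>ent_mean\<bar>)\<^sup>2"
  have "(\<integral>\<^sup>+ s. ennreal ((ent s - ent_mean * W s)\<^sup>2) \<partial>tree_space) \<le> (\<integral>\<^sup>+ s. ennreal k * ennreal ((W s)\<^sup>2) \<partial>tree_space)"
  proof (rule nn_integral_mono_AE)
    show "AE s in tree_space. ennreal ((ent s - ent_mean * W s)\<^sup>2) \<le> ennreal k * ennreal ((W s)\<^sup>2)"
      using AE_regular
    proof eventually_elim
      case (elim s)
      then have W: "0 < W s" by (simp add: regular_def)
      have "\<bar>ent s - ent_mean * W s\<bar> \<le> \<bar>ent s\<bar> + \<bar>ent_mean * W s\<bar>" by linarith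
      also have "\<dots> \<le> (real (card A) + \<bar>ent_mean\<bar>) * W s"
        using ent_bounds[OF elim] W by (simp add: abs_mult algebra_simps)
      finally have "(ent s - ent_mean * W s)\<^sup>2 \<le> ((real (card A) + \<bar>ent_mean\<bar>) * W s)\<^sup>2"
        by (rule abs_le_square_iff[THEN iffD1, OF order.trans]) simp
      then show ?case by (simp add: k_def power_mult_distrib ennreal_leI flip: ennreal_mult)
    qed
  qed
  also have "\<dots> = ennreal k * (\<integral>\<^sup>+ s. ennreal ((W s)\<^sup>2) \<partial>tree_space)"
    by (intro nn_integral_cmult) measurable
  also have "\<dots> \<le> ennreal k * ennreal C" by (intro mult_left_mono C) simp
  also have "\<dots> = ennreal (k * max 0 C)" by (simp add: k_def ennreal_mult' max_def ennreal_neg)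
  finally have 1: "(\<integral>\<^sup>+ s. ennreal ((ent s - ent_mean * W s)\<^sup>2) \<partial>tree_space) \<le> ennreal (k * max 0 C)" .
  have 2: "(\<integral>s. ent s - ent_mean * W s \<partial>tree_space) = 0"
    using integrable_ent expectation_W by (simp add: ent_mean_def)
  have 3: "(\<lambda>p. ent (snd p) - ent_mean * W (snd p)) \<in> borel_measurable (borel \<Otimes>\<^sub>M tree_space)"
    by measurable
  have 4: "0 \<le> k * max 0 C" by (simp add: k_def)
  show ?thesis
    unfolding L2_bounded_def using 1 2 3 4 by (intro exI[of _ "k * max 0 C"]) simp
qed

lemma mass_Nil [simp]: "mass [] s = W s"
  by (simp add: mass_def)

lemma mass_snoc: "mass (x @ [i]) s = exp (- lam * tau x s) * child_mass i (shift_word x s)"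
  by (simp add: mass_def child_mass_def tau_append shift_word_append exp_lam_add)

text \<open>Refines generation \<open>n\<close> at its leaves, as the chain rule requires, whereas
  \<open>sum_gen_Suc\<close> splits at the root.\<close>

lemma sum_gen_snoc: "(\<Sum>x\<in>gen (Suc n). f x) = (\<Sum>x\<in>gen n. \<Sum>i\<in>A. f (x @ [i]))" for f :: "nat list \<Rightarrow> real"
proof (induction n arbitrary: f)
  case 0
  show ?case by (simp add: sum_gen_Suc)
next
  case (Suc n)
  show ?case by (subst sum_gen_Suc, subst Suc, subst sum_gen_Suc) simp
qed

text \<open>Purely pathwise: the deviations of the successive entropy increments from
  \<open>ent_mean * W s\<close> are absolutely summable, so their partial sums stay bounded and
  vanish after division by \<open>n\<close>.\<close>

lemma entropy_tendsto:
  assumes reg: "\<And>x. x \<in> words \<Longrightarrow> regular (shift_word x s)"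
    and summable: "summable (\<lambda>n. \<bar>(Psi ^^ n) (\<lambda>p. ent (snd p) - ent_mean * W (snd p)) (0, s)\<bar>)"
  shows "(\<lambda>n. - (\<Sum>x\<in>gen n. mass x s / W s * ln (mass x s / W s)) / real n) \<longlonglongrightarrow> ent_mean"
proof -
  have W: "0 < W s" using reg[of "[]"] by (simp add: regular_def)
  have pos: "0 < mass x s" if "x \<in> words" for x
    using reg[OF that] by (simp add: regular_def mass_def)
  have split: "(\<Sum>i\<in>A. mass (x @ [i]) s) = mass x s" if "x \<in> words" for x
    using reg[OF that] by (simp add: mass_snoc regular_def mass_def[of x] flip: sum_distrib_left)
  have total: "(\<Sum>x\<in>gen n. mass x s) = W s" for n
  proof (induction n)
    case (Suc n)
    have "(\<Sum>x\<in>gen n. \<Sum>i\<in>A. mass (x @ [i]) s) = (\<Sum>x\<in>gen n. mass x s)"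
      by (intro sum.cong refl split gen_words)
    with Suc show ?case by (simp add: sum_gen_snoc)
  qed simp
  \<comment> \<open>Entropy sum of the unnormalised masses. As these add up to \<open>W s\<close>,
    the entropy of generation \<open>n\<close> times \<open>W s\<close> is
    \<open>S n - S 0\<close>.\<close>
  define S where "S n = - (\<Sum>x\<in>gen n. mass x s * ln (mass x s))" for n
  define U where "U n = (\<Sum>x\<in>gen n. exp (- lam * tau x s) * ent (shift_word x s))" for n
  \<comment> \<open>The chain rule: in the ratio of the masses of a child and of its parent the
    discount up to the parent cancels, which leaves \<open>child_mass i / W\<close> of the parent's
    subtree.\<close>
  have U_eq: "U n = S (Suc n) - S n" for n
  proof -
    have "exp (- lam * tau x s) * ent (shift_word x s) = mass x s * ln (mass x s) - (\<Sum>i\<in>A. mass (x @ [i]) s * ln (mass (x @ [i]) s))"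
      if x: "x \<in> words" for x
    proof -
      have r: "regular (shift_word x s)" by (rule reg[OF x])
      have "exp (- lam * tau x s) * ent (shift_word x s) =
          - (\<Sum>i\<in>A. mass (x @ [i]) s * ln (child_mass i (shift_word x s) / W (shift_word x s)))"
        by (simp add: ent_def mass_snoc sum_distrib_left mult.assoc)
      also have "\<dots> = - (\<Sum>i\<in>A. mass (x @ [i]) s * (ln (mass (x @ [i]) s) - ln (mass x s)))"
      proof (intro arg_cong[where f=uminus] sum.cong refl arg_cong2[where f="(*)"])
        fix i assume "i \<in> A"
        then have p: "0 < child_mass i (shift_word x s)" "0 < W (shift_word x s)" using r by (auto simp: regular_def)
        then show "ln (child_mass i (shift_word x s) / W (shift_word x s)) = ln (mass (x @ [i]) s) - ln (mass x s)"
          unfolding mass_snoc mass_def[of x] by (simp add: ln_div ln_mult)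
      qed
      also have "\<dots> = (\<Sum>i\<in>A. mass (x @ [i]) s) * ln (mass x s) - (\<Sum>i\<in>A. mass (x @ [i]) s * ln (mass (x @ [i]) s))"
        by (simp add: right_diff_distrib sum_subtractf sum_distrib_right)
      finally show ?thesis unfolding split[OF x] .
    qed
    then have "U n = (\<Sum>x\<in>gen n. mass x s * ln (mass x s) - (\<Sum>i\<in>A. mass (x @ [i]) s * ln (mass (x @ [i]) s)))"
      unfolding U_def by (intro sum.cong refl) (simp add: gen_words)
    then show ?thesis by (simp add: S_def sum_gen_snoc sum_subtractf)
  qed
  have dev: "(Psi ^^ n) (\<lambda>p. ent (snd p) - ent_mean * W (snd p)) (0, s) = U n - ent_mean * W s" for n
  proof -
    have "(Psi ^^ n) (\<lambda>p. ent (snd p) - ent_mean * W (snd p)) (0, s) =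
      (\<Sum>x\<in>gen n. exp (- lam * tau x s) * (ent (shift_word x s) - ent_mean * W (shift_word x s)))"
      by (rule Psi_power_snd[of n "\<lambda>s. ent s - ent_mean * W s"])
    also have "\<dots> = U n - ent_mean * (\<Sum>x\<in>gen n. mass x s)"
      by (simp add: U_def mass_def right_diff_distrib sum_subtractf sum_distrib_left mult_ac)
    finally show ?thesis by (simp only: total)
  qed
  have "(\<lambda>n. \<Sum>k<n. U k - ent_mean * W s) \<longlonglongrightarrow> (\<Sum>k. U k - ent_mean * W s)"
    using summable_LIMSEQ[OF summable_rabs_cancel[OF summable]] by (simp only: dev)
  then have "(\<lambda>n. (\<Sum>k<n. U k - ent_mean * W s) * inverse (real n)) \<longlonglongrightarrow> (\<Sum>k. U k - ent_mean * W s) * 0"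
    by (intro tendsto_mult tendsto_inverse_0_at_top filterlim_real_sequentially)
  then have "(\<lambda>n. (\<Sum>k<n. U k - ent_mean * W s) * inverse (real n) / W s + ent_mean) \<longlonglongrightarrow> 0 / W s + ent_mean"
    using W by (intro tendsto_intros) auto
  then have lim: "(\<lambda>n. (\<Sum>k<n. U k - ent_mean * W s) * inverse (real n) / W s + ent_mean) \<longlonglongrightarrow> ent_mean" by simp
  have eq: "- (\<Sum>x\<in>gen n. mass x s / W s * ln (mass x s / W s)) = (\<Sum>k<n. U k) / W s" for n
  proof -
    have "(\<Sum>x\<in>gen n. mass x s / W s * ln (mass x s / W s)) = (\<Sum>x\<in>gen n. (mass x s * ln (mass x s) - mass x s * ln (W s)) / W s)"
      using pos W by (intro sum.cong refl) (simp add: ln_div gen_words right_diff_distrib)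
    also have "\<dots> = ((\<Sum>x\<in>gen n. mass x s * ln (mass x s)) - (\<Sum>x\<in>gen n. mass x s) * ln (W s)) / W s"
      by (simp add: sum_divide_distrib[symmetric] sum_subtractf sum_distrib_right)
    also have "\<dots> = - (S n - S 0) / W s"
      by (simp add: total S_def)
    also have "S n - S 0 = (\<Sum>k<n. U k)"
      by (simp add: U_eq sum_lessThan_telescope)
    finally show ?thesis by simp
  qed
  have "\<forall>\<^sub>F n in sequentially. (\<Sum>k<n. U k - ent_mean * W s) * inverse (real n) / W s + ent_mean
      = - (\<Sum>x\<in>gen n. mass x s / W s * ln (mass x s / W s)) / real n"
    using eventually_gt_at_top[of 0]
  proof eventually_elim
    case (elim n)
    show ?case unfolding eq using elim W by (simp add: sum_subtractf field_simps)
  qed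
  then show ?thesis using lim by (rule Lim_transform_eventually[rotated])
qed

lemma alive_subtree:
  assumes "x \<in> words"
  shows "{y. x @ y \<in> alive t s} = alive (t - tau x s) (shift_word x s)"
  using assms by (auto simp: alive_def words_def tau_append)

text \<open>At time \<open>t\<close> the subtree at \<open>x\<close> is a tree of age
  \<open>t - tau x s\<close>. The time shift becomes the factor
  \<open>exp (- lam * tau x s)\<close>, and \<open>c\<close> cancels in the quotient.\<close>

lemma relative_size_tendsto:
  assumes x: "x \<in> words" and W: "0 < W s"
    and growth: "((\<lambda>t. exp (- lam * t) * real (card (alive t s))) \<longlongrightarrow> c * W s) at_top"
    and growth_x: "((\<lambda>t. exp (- lam * t) * real (card (alive t (shift_word x s)))) \<longlongrightarrow> c * W (shift_word x s)) at_top"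
  shows "((\<lambda>t. real (card {y. x @ y \<in> alive t s}) / real (card (alive t s))) \<longlongrightarrow> mass x s / W s) at_top"
proof -
  have "filterlim (\<lambda>t. - tau x s + t) at_top at_top"
    by (intro filterlim_tendsto_add_at_top[OF tendsto_const] filterlim_ident)
  from filterlim_compose[OF growth_x this]
  have shifted: "((\<lambda>t. exp (- lam * (- tau x s + t)) * real (card (alive (- tau x s + t) (shift_word x s)))) \<longlongrightarrow> c * W (shift_word x s)) at_top" .
  have "((\<lambda>t. exp (- lam * tau x s) * (exp (- lam * (- tau x s + t)) * real (card (alive (- tau x s + t) (shift_word x s))))
      / (exp (- lam * t) * real (card (alive t s)))) \<longlongrightarrow> exp (- lam * tau x s) * (c * W (shift_word x s)) / (c * W s)) at_top"
    by (rule tendsto_divide[OF tendsto_mult[OF tendsto_const shifted] growth]) (use W c_pos in simp)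
  also have "exp (- lam * tau x s) * (c * W (shift_word x s)) / (c * W s) = mass x s / W s"
    using c_pos by (simp add: mass_def)
  also have "(\<lambda>t. exp (- lam * tau x s) * (exp (- lam * (- tau x s + t)) * real (card (alive (- tau x s + t) (shift_word x s))))
      / (exp (- lam * t) * real (card (alive t s)))) = (\<lambda>t. real (card {y. x @ y \<in> alive t s}) / real (card (alive t s)))"
  proof
    fix t
    have "exp (- lam * tau x s) * exp (- lam * (- tau x s + t)) = exp (- lam * t)"
      by (simp add: algebra_simps flip: exp_add)
    then show "exp (- lam * tau x s) * (exp (- lam * (- tau x s + t)) * real (card (alive (- tau x s + t) (shift_word x s))))
      / (exp (- lam * t) * real (card (alive t s))) = real (card {y. x @ y \<in> alive t s}) / real (card (alive t s))"
      unfolding alive_subtree[OF x] by (simp add: mult.assoc[symmetric])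
  qed
  finally show ?thesis .
qed

lemma AE_entropy_tendsto:
  "AE s in tree_space. (\<forall>x\<in>words. ((\<lambda>t. real (card {y. x @ y \<in> alive t s}) / real (card (alive t s))) \<longlongrightarrow> mass x s / W s) at_top)
    \<and> (\<lambda>n. - (\<Sum>x\<in>gen n. mass x s / W s * ln (mass x s / W s)) / real n) \<longlonglongrightarrow> ent_mean"
proof -
  obtain C where C: "L2_bounded 0 C (\<lambda>_. 0) (\<lambda>p. ent (snd p) - ent_mean * W (snd p))"
    using ent_deviation_bounded by blast
  define F where "F = (\<lambda>p :: real \<times> _. ent (snd p) - ent_mean * W (snd p))"
  have *: "L2_bounded 0 (contraction 0 ^ n * C) (\<lambda>_. 0) ((Psi ^^ n) F)" for n
    using L2_bounded_Psi_power[OF C order.refl lam_pos] by (simp only: F_def)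
  have C0: "0 \<le> C" using C by (simp add: L2_bounded_def)
  have bound: "(\<integral>\<^sup>+ s. ennreal (((Psi ^^ n) F (0, s))\<^sup>2) \<partial>tree_space) \<le> ennreal (contraction 0 ^ n * C)" for n
    using *[of n] unfolding L2_bounded_def by (auto dest: spec[of _ 0])
  have m: "(\<lambda>s. (Psi ^^ n) F (0, s)) \<in> borel_measurable tree_space" for n
    using *[of n] unfolding L2_bounded_def by (intro measurable_section) blast
  have "AE s in tree_space. summable (\<lambda>n. \<bar>(Psi ^^ n) F (0, s)\<bar>)"
    by (rule tree.summable_of_geometric_second_moment(1)[OF m bound contraction_nonneg contraction_0 C0])
  with AE_all_shift_word[OF AE_regular] AE_all_shift_word[OF AE_alive_growth]
  show ?thesis
  proof eventually_elim
    case (elim s)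
    have "0 < W s" using elim(1)[rule_format, of "[]"] by (simp add: regular_def)
    moreover have "((\<lambda>t. exp (- lam * t) * real (card (alive t s))) \<longlongrightarrow> c * W s) at_top"
      using elim(2)[rule_format, of "[]"] by simp
    ultimately show ?case
      using elim unfolding F_def by (intro conjI ballI relative_size_tendsto entropy_tendsto) auto
  qed
qed

end

section \<open>The renewal equation\<close>

abbreviation exp_measure :: "real \<Rightarrow> real measure" where
  "exp_measure a \<equiv> density lborel (exponential_density a)"

text \<open>Exponential tilting: the density of rate \<open>a\<close> times
  \<open>exp (- k * x)\<close> is \<open>a / (a + k)\<close> times the density of rate
  \<open>a + k\<close>.\<close>

lemma exp_measure_moment:
  assumes a: "0 < a" and k: "0 < a + k"
  shows "integrable (exp_measure a) (\<lambda>x. exp (- k * x))" "(\<integral>x. exp (- k * x) \<partial>exp_measure a) = a / (a + k)"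
proof -
  interpret E: prob_space "exp_measure (a + k)" by (rule prob_space_exponential_density[OF k])
  have eq: "exponential_density a x * exp (- k * x) = exponential_density (a + k) x * (a / (a + k))" for x
  proof -
    have e: "exp (- x * a) * exp (- k * x) = exp (- x * (a + k))"
      by (simp add: algebra_simps flip: exp_add)
    show ?thesis using k by (simp add: exponential_density_def mult.assoc e[simplified])
  qed
  have nn: "AE x in lborel. 0 \<le> exponential_density a x" "AE x in lborel. 0 \<le> exponential_density (a + k) x"
    using exponential_density_nonneg[OF a] exponential_density_nonneg[OF k] by auto
  have "integrable (exp_measure (a + k)) (\<lambda>_. a / (a + k))" by simp
  then have "integrable lborel (\<lambda>x. exponential_density (a + k) x * (a / (a + k)))"
    by (subst (asm) integrable_density) (use nn in auto)
  then have "integrable lborel (\<lambda>x. exponential_density a x * exp (- k * x))" by (simp only: eq)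
  then show "integrable (exp_measure a) (\<lambda>x. exp (- k * x))"
    by (subst integrable_density) (use nn in auto)
  have "(\<integral>x. exp (- k * x) \<partial>exp_measure a) = (\<integral>x. exponential_density a x * exp (- k * x) \<partial>lborel)"
    by (subst integral_density) (use nn in auto)
  also have "\<dots> = (\<integral>x. exponential_density (a + k) x * (a / (a + k)) \<partial>lborel)" by (simp only: eq)
  also have "\<dots> = (\<integral>x. a / (a + k) \<partial>exp_measure (a + k))"
    by (subst integral_density) (use nn in auto)
  also have "\<dots> = a / (a + k)" using E.prob_space by simp
  finally show "(\<integral>x. exp (- k * x) \<partial>exp_measure a) = a / (a + k)" .
qed

lemma AE_exp_measure_pos:
  assumes "0 < a" shows "AE x in exp_measure a. 0 < x"
proof (subst AE_density)
  have "AE x::real in lborel. x \<noteq> 0" by (rule AE_lborel_singleton)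
  then show "AE x in lborel. 0 < ennreal (exponential_density a x) \<longrightarrow> 0 < x"
    by eventually_elim (auto simp: exponential_density_def)
qed measurable

definition exp_conv :: "real \<Rightarrow> real \<Rightarrow> (real \<Rightarrow> real) \<Rightarrow> real \<Rightarrow> real" where
  "exp_conv k a h t = (\<integral>x. exp (- k * x) * h (t - x) \<partial>exp_measure a)"

text \<open>A ball of the space with norm \<open>sup \<bar>h t\<bar> * exp (d * t)\<close> over the
  whole line. For \<open>d > 0\<close> this forces decay at infinity but admits nonzero constants on
  the negative axis.\<close>

definition exp_bounded :: "real \<Rightarrow> real \<Rightarrow> (real \<Rightarrow> real) \<Rightarrow> bool" where
  "exp_bounded d C h \<longleftrightarrow> h \<in> borel_measurable borel \<and> 0 \<le> C \<and> (\<forall>t. \<bar>h t\<bar> \<le> C * exp (- d * t))"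

lemma exp_bounded_measurable: "exp_bounded d C h \<Longrightarrow> h \<in> borel_measurable borel"
  by (simp add: exp_bounded_def)

lemma exp_conv_integrable:
  assumes h: "exp_bounded d C h" and a: "0 < a" "0 < a + k - d"
  shows "integrable (exp_measure a) (\<lambda>x. exp (- k * x) * h (t - x))"
proof (rule Bochner_Integration.integrable_bound)
  have [measurable]: "h \<in> borel_measurable borel" by (rule exp_bounded_measurable[OF h])
  show "integrable (exp_measure a) (\<lambda>x. C * exp (- d * t) * exp (- (k - d) * x))"
    using exp_measure_moment(1)[of a "k - d"] a by simp
  show "(\<lambda>x. exp (- k * x) * h (t - x)) \<in> borel_measurable (exp_measure a)" by measurable
  show "AE x in exp_measure a. norm (exp (- k * x) * h (t - x)) \<le> norm (C * exp (- d * t) * exp (- (k - d) * x))"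
  proof (rule AE_I2)
    fix x
    have "norm (exp (- k * x) * h (t - x)) \<le> exp (- k * x) * (C * exp (- d * (t - x)))"
      using h by (simp add: abs_mult exp_bounded_def)
    also have "\<dots> = C * exp (- d * t) * exp (- (k - d) * x)"
      by (simp add: algebra_simps flip: exp_add)
    finally show "norm (exp (- k * x) * h (t - x)) \<le> norm (C * exp (- d * t) * exp (- (k - d) * x))"
      using h by (simp add: exp_bounded_def abs_mult)
  qed
qed

lemma exp_bounded_exp_conv:
  assumes h: "exp_bounded d C h" and a: "0 < a" "0 < a + k - d"
  shows "exp_bounded d (C * (a / (a + k - d))) (exp_conv k a h)"
  unfolding exp_bounded_def
proof (intro conjI allI)
  interpret E: prob_space "exp_measure a" by (rule prob_space_exponential_density[OF a(1)])
  have [measurable]: "h \<in> borel_measurable borel" by (rule exp_bounded_measurable[OF h])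
  show "exp_conv k a h \<in> borel_measurable borel"
    unfolding exp_conv_def[abs_def] by measurable
  show "0 \<le> C * (a / (a + k - d))" using h a by (simp add: exp_bounded_def)
  fix t
  have "\<bar>exp_conv k a h t\<bar> \<le> (\<integral>x. \<bar>exp (- k * x) * h (t - x)\<bar> \<partial>exp_measure a)"
    unfolding exp_conv_def by (rule integral_abs_bound)
  also have "\<dots> \<le> (\<integral>x. C * exp (- d * t) * exp (- (k - d) * x) \<partial>exp_measure a)"
  proof (rule integral_mono)
    show "integrable (exp_measure a) (\<lambda>x. C * exp (- d * t) * exp (- (k - d) * x))"
      using exp_measure_moment(1)[of a "k - d"] a by simp
    show "integrable (exp_measure a) (\<lambda>x. \<bar>exp (- k * x) * h (t - x)\<bar>)"
      using exp_conv_integrable[OF h a] by simp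
    fix x
    have "\<bar>exp (- k * x) * h (t - x)\<bar> \<le> exp (- k * x) * (C * exp (- d * (t - x)))"
      using h by (simp add: abs_mult exp_bounded_def)
    also have "\<dots> = C * exp (- d * t) * exp (- (k - d) * x)"
      by (simp add: algebra_simps flip: exp_add)
    finally show "\<bar>exp (- k * x) * h (t - x)\<bar> \<le> C * exp (- d * t) * exp (- (k - d) * x)" .
  qed
  also have "\<dots> = C * (a / (a + k - d)) * exp (- d * t)"
    using exp_measure_moment(2)[of a "k - d"] a by (simp add: algebra_simps)
  finally show "\<bar>exp_conv k a h t\<bar> \<le> C * (a / (a + k - d)) * exp (- d * t)" .
qed

lemma exp_conv_diff:
  assumes "exp_bounded d C f" "exp_bounded d C' g" "0 < a" "0 < a + k - d"
  shows "exp_conv k a (\<lambda>t. f t - g t) t = exp_conv k a f t - exp_conv k a g t"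
  using exp_conv_integrable[OF assms(1,3,4)] exp_conv_integrable[OF assms(2,3,4)]
  by (simp add: exp_conv_def right_diff_distrib)

lemma exp_conv_const_on_negative:
  assumes a: "0 < a" "0 < k" and h: "\<And>t. t < 0 \<Longrightarrow> h t = e" and t: "t \<le> 0"
    and [measurable]: "h \<in> borel_measurable borel"
  shows "exp_conv k a h t = e * (a / (a + k))"
proof -
  have "exp_conv k a h t = (\<integral>x. exp (- k * x) * e \<partial>exp_measure a)"
    unfolding exp_conv_def
  proof (rule integral_cong_AE)
    show "AE x in exp_measure a. exp (- k * x) * h (t - x) = exp (- k * x) * e"
      using AE_exp_measure_pos[OF a(1)] by eventually_elim (use h t in auto)
  qed measurable
  then show ?thesis using exp_measure_moment(2)[of a k] a by simp
qed

text \<open>The exponential kernel makes the convolution \<open>y\<close> a solution of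
  \<open>y' = a * h - (k + a) * y\<close>. The derivative is one-sided at 0, since \<open>h\<close>
  may jump there, as \<open>source\<close> does.\<close>

lemma exp_conv_has_derivative:
  assumes h: "exp_bounded d C h" and a: "0 < a" "0 < k" "0 < a + k - d"
    and neg: "\<And>t. t < 0 \<Longrightarrow> h t = e" and cont: "continuous_on {0..} h" and t: "0 \<le> t"
  shows "(exp_conv k a h has_real_derivative a * h t - (k + a) * exp_conv k a h t) (at t within {0..})"
proof -
  have hm[measurable]: "h \<in> borel_measurable borel" by (rule exp_bounded_measurable[OF h])
  \<comment> \<open>Subtracting \<open>e\<close> removes negative arguments, so the integral runs
    over \<open>{0..t}\<close> only. After the substitution \<open>y = t - x\<close> the time enters
    through the upper limit and one exponential factor.\<close>
  define G where "G t = integral {0..t} (\<lambda>y. a * exp ((k + a) * y) * (h y - e))" for t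
  have eq: "exp_conv k a h t = e * (a / (a + k)) + exp (- (k + a) * t) * G t" if t: "0 \<le> t" for t
  proof -
    let ?f = "\<lambda>y. a * exp ((k + a) * y) * (h y - e)"
    have cf: "continuous_on {0..t} ?f"
      by (intro continuous_intros continuous_on_subset[OF cont]) auto
    have int: "set_integrable lborel {0..t} ?f"
      by (rule borel_integrable_atLeastAtMost') (rule cf)
    have "exp_conv k a h t = (\<integral>x. exp (- k * x) * e + exp (- k * x) * (h (t - x) - e) \<partial>exp_measure a)"
      by (simp add: exp_conv_def algebra_simps)
    also have "\<dots> = (\<integral>x. exp (- k * x) * e \<partial>exp_measure a) + (\<integral>x. exp (- k * x) * (h (t - x) - e) \<partial>exp_measure a)"
    proof (rule Bochner_Integration.integral_add)
      show 1: "integrable (exp_measure a) (\<lambda>x. exp (- k * x) * e)"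
        using exp_measure_moment(1)[of a k] a by simp
      show "integrable (exp_measure a) (\<lambda>x. exp (- k * x) * (h (t - x) - e))"
        using Bochner_Integration.integrable_diff[OF exp_conv_integrable[OF h a(1,3), of t] 1]
        by (simp add: right_diff_distrib)
    qed
    also have "(\<integral>x. exp (- k * x) * e \<partial>exp_measure a) = e * (a / (a + k))"
      using exp_measure_moment(2)[of a k] a by simp
    also have "(\<integral>x. exp (- k * x) * (h (t - x) - e) \<partial>exp_measure a)
        = (\<integral>x. exponential_density a x * (exp (- k * x) * (h (t - x) - e)) \<partial>lborel)"
      using exponential_density_nonneg[OF a(1)] by (subst integral_density) auto
    also have "\<dots> = (\<integral>x. indicator {0..t} (t - x) * (exp (- (k + a) * t) * ?f (t - x)) \<partial>lborel)"
    proof (intro Bochner_Integration.integral_cong refl)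
      fix x
      show "exponential_density a x * (exp (- k * x) * (h (t - x) - e)) =
        indicator {0..t} (t - x) * (exp (- (k + a) * t) * ?f (t - x))"
        using neg[of "t - x"]
        by (auto simp: exponential_density_def indicator_def algebra_simps simp flip: exp_add)
    qed
    also have "\<dots> = (\<integral>y. indicator {0..t} y * (exp (- (k + a) * t) * ?f y) \<partial>lborel)"
      by (subst (2) lborel_integral_real_affine[where c="-1" and t=t]) auto
    also have "\<dots> = exp (- (k + a) * t) * (LINT y:{0..t}|lborel. ?f y)"
      unfolding set_lebesgue_integral_def integral_mult_right_zero[symmetric] real_scaleR_def
      by (simp only: mult.left_commute)
    also have "(LINT y:{0..t}|lborel. ?f y) = G t"
      unfolding G_def by (rule set_borel_integral_eq_integral(2)[OF int])
    finally show ?thesis .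
  qed
  have "(G has_real_derivative a * exp ((k + a) * t) * (h t - e)) (at t within {0..t + 1})"
    unfolding G_def
    by (rule integral_has_real_derivative)
       (use t in \<open>auto intro!: continuous_intros continuous_on_subset[OF cont]\<close>)
  moreover have "at t within {0..t + 1} = at t within {0..}"
    using t by (intro at_within_nhd[of _ "{..<t + 1}"]) auto
  ultimately have G: "(G has_real_derivative a * exp ((k + a) * t) * (h t - e)) (at t within {0..})" by simp
  have "((\<lambda>t. e * (a / (a + k)) + exp (- (k + a) * t) * G t) has_real_derivative
      a * h t - (k + a) * exp_conv k a h t) (at t within {0..})"
    by (rule derivative_eq_intros G refl)+
       (use a in \<open>simp add: eq[OF t] field_simps flip: exp_add\<close>)
  then show ?thesis
    by (rule has_field_derivative_transform_within[OF _ zero_less_one]) (use t eq in auto)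
qed

lemma exp_bounded_sum:
  assumes "finite J" "\<And>j. j \<in> J \<Longrightarrow> exp_bounded d (C j) (h j)" "\<And>j. j \<in> J \<Longrightarrow> 0 \<le> r j"
  shows "exp_bounded d (\<Sum>j\<in>J. r j * C j) (\<lambda>t. \<Sum>j\<in>J. r j * h j t)"
  unfolding exp_bounded_def
proof (intro conjI allI)
  show "(\<lambda>t. \<Sum>j\<in>J. r j * h j t) \<in> borel_measurable borel"
    using assms exp_bounded_measurable by (intro borel_measurable_sum borel_measurable_times) auto
  show "0 \<le> (\<Sum>j\<in>J. r j * C j)" using assms by (intro sum_nonneg mult_nonneg_nonneg) (auto simp: exp_bounded_def)
  fix t
  have "\<bar>\<Sum>j\<in>J. r j * h j t\<bar> \<le> (\<Sum>j\<in>J. r j * (C j * exp (- d * t)))"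
  proof (rule order.trans[OF sum_abs], rule sum_mono)
    fix j assume j: "j \<in> J"
    then have "\<bar>h j t\<bar> \<le> C j * exp (- d * t)" using assms(2) by (auto simp: exp_bounded_def)
    then show "\<bar>r j * h j t\<bar> \<le> r j * (C j * exp (- d * t))"
      using assms(3)[OF j] by (simp add: abs_mult mult_left_mono)
  qed
  then show "\<bar>\<Sum>j\<in>J. r j * h j t\<bar> \<le> (\<Sum>j\<in>J. r j * C j) * exp (- d * t)"
    by (simp add: sum_distrib_right mult.assoc)
qed

section \<open>Reproductive values and the defective renewal kernel\<close>

locale malthusian_rates =
  fixes K :: nat and w :: "nat \<Rightarrow> real" and lam :: real
  assumes w_pos: "\<And>j. j < K \<Longrightarrow> 0 < w j"
    and lam_pos: "0 < lam"
    and root: "(\<Sum>j<K. \<Prod>i<Suc j. w i / (w i + lam)) = 1"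
begin

text \<open>The Laplace transform, at \<open>lam - d\<close>, of the waiting time until the
  \<open>j\<close>-th child.\<close>

definition discount :: "real \<Rightarrow> nat \<Rightarrow> real" where
  "discount d j = (\<Prod>i<j. w i / (w i + lam - d))"

text \<open>With \<open>S\<close> the waiting time until the \<open>j\<close>-th child, this is the
  mean of \<open>exp (- lam * S) * h (t - S)\<close>, see \<open>iter_conv_eq_integral\<close>.
  Convolving one waiting time after the other gives one first-order equation per step.\<close>

primrec iter_conv :: "nat \<Rightarrow> (real \<Rightarrow> real) \<Rightarrow> real \<Rightarrow> real" where
  "iter_conv 0 h = h"
| "iter_conv (Suc j) h = exp_conv lam (w j) (iter_conv j h)"

lemma discount_pos: "d < lam \<Longrightarrow> j \<le> K \<Longrightarrow> 0 < discount d j"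
  unfolding discount_def
proof (intro prod_pos ballI)
  fix i assume "d < lam" "j \<le> K" "i \<in> {..<j}"
  then show "0 < w i / (w i + lam - d)" using w_pos[of i] by auto
qed

lemma discount_Suc: "discount d (Suc j) = discount d j * (w j / (w j + lam - d))"
  by (simp add: discount_def)

lemma discount_0 [simp]: "discount d 0 = 1"
  by (simp add: discount_def)

lemma sum_discount: "(\<Sum>j<K. discount 0 (Suc j)) = 1"
  using root by (simp add: discount_def)

lemma K_pos: "0 < K"
  using root by (cases K) auto

lemma exp_bounded_iter_conv:
  assumes "exp_bounded d C h" "d < lam"
  shows "j \<le> K \<Longrightarrow> exp_bounded d (C * discount d j) (iter_conv j h)"
proof (induction j)
  case (Suc j)
  have "exp_bounded d (C * discount d j * (w j / (w j + lam - d))) (exp_conv lam (w j) (iter_conv j h))"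
    using Suc assms w_pos[of j] by (intro exp_bounded_exp_conv) auto
  then show ?case by (simp add: discount_Suc mult.assoc)
qed (use assms in simp)

lemma iter_conv_diff:
  assumes f: "exp_bounded d C f" and g: "exp_bounded d C' g" and d: "d < lam"
  shows "j \<le> K \<Longrightarrow> iter_conv j (\<lambda>t. f t - g t) = (\<lambda>t. iter_conv j f t - iter_conv j g t)"
proof (induction j)
  case (Suc j)
  then have "exp_bounded d (C * discount d j) (iter_conv j f)" "exp_bounded d (C' * discount d j) (iter_conv j g)"
    using exp_bounded_iter_conv[OF f d, of j] exp_bounded_iter_conv[OF g d, of j] by auto
  with Suc d w_pos[of j] show ?case by (auto intro!: ext exp_conv_diff)
qed simp

lemma iter_conv_const_on_negative:
  assumes h: "exp_bounded d C h" and d: "d < lam" and e: "\<And>t. t < 0 \<Longrightarrow> h t = e"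
  shows "j \<le> K \<Longrightarrow> t < 0 \<Longrightarrow> iter_conv j h t = e * discount 0 j"
    and "j < K \<Longrightarrow> t \<le> 0 \<Longrightarrow> iter_conv (Suc j) h t = e * discount 0 (Suc j)"
proof -
  have step: "iter_conv (Suc j) h t = e * discount 0 (Suc j)"
    if "j < K" "t \<le> 0" "\<And>t. t < 0 \<Longrightarrow> iter_conv j h t = e * discount 0 j" for j t
    using exp_conv_const_on_negative[of "w j" lam "iter_conv j h" "e * discount 0 j" t]
      that w_pos[of j] lam_pos exp_bounded_measurable[OF exp_bounded_iter_conv[OF h d, of j]]
    by (simp add: discount_Suc)
  have *: "j \<le> K \<Longrightarrow> t < 0 \<Longrightarrow> iter_conv j h t = e * discount 0 j" for j t
  proof (induction j arbitrary: t)
    case (Suc j)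
    then show ?case using step[of j t] by simp
  qed (simp add: e)
  then show "j \<le> K \<Longrightarrow> t < 0 \<Longrightarrow> iter_conv j h t = e * discount 0 j" .
  show "j < K \<Longrightarrow> t \<le> 0 \<Longrightarrow> iter_conv (Suc j) h t = e * discount 0 (Suc j)"
    by (rule step) (auto intro: *)
qed

lemma iter_conv_has_derivative:
  assumes h: "exp_bounded d C h" and d: "d < lam" and e: "\<And>t. t < 0 \<Longrightarrow> h t = e" and cont: "continuous_on {0..} h"
    and j: "j < K" and t: "0 \<le> t"
  shows "(iter_conv (Suc j) h has_real_derivative w j * iter_conv j h t - (lam + w j) * iter_conv (Suc j) h t) (at t within {0..})"
proof -
  have step: "(iter_conv (Suc j) h has_real_derivative w j * iter_conv j h t - (lam + w j) * iter_conv (Suc j) h t) (at t within {0..})"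
    if "continuous_on {0..} (iter_conv j h)" "j < K" "0 \<le> t" for j t
    unfolding iter_conv.simps
    using that w_pos[of j] lam_pos d iter_conv_const_on_negative(1)[OF h d e, of j]
    by (intro exp_conv_has_derivative[OF exp_bounded_iter_conv[OF h d, of j]]) auto
  have "j \<le> K \<Longrightarrow> continuous_on {0..} (iter_conv j h)" for j
  proof (induction j)
    case (Suc j)
    then show ?case
      using step[of j] by (intro DERIV_continuous_on) auto
  qed (simp add: cont)
  then show ?thesis using step j t by simp
qed

text \<open>The reproductive value of a vertex with \<open>j\<close> children.\<close>

definition rep_value :: "nat \<Rightarrow> real" where
  "rep_value j = (\<Sum>k=j..<K. discount 0 (Suc k)) / discount 0 j"

text \<open>The coefficients that make a combination of the equations for
  \<open>iter_conv (Suc j)\<close> telescope: \<open>coeff j * w j\<close> is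
  \<open>rep_value j\<close>, and \<open>coeff j * (lam + w j)\<close> is
  \<open>1 + rep_value (Suc j)\<close>.\<close>

definition coeff :: "nat \<Rightarrow> real" where
  "coeff j = rep_value j / w j"

lemma rep_value_0: "rep_value 0 = 1"
  using sum_discount by (simp add: rep_value_def atLeast0LessThan)

lemma rep_value_K: "rep_value K = 0"
  by (simp add: rep_value_def)

lemma rep_value_pos: "j < K \<Longrightarrow> 0 < rep_value j"
  unfolding rep_value_def using discount_pos[of 0] lam_pos by (intro divide_pos_pos sum_pos) auto

text \<open>First-step analysis: waiting for the next birth costs the factor
  \<open>w j / (w j + lam)\<close>, and the birth yields a child of value 1 and a parent with
  \<open>Suc j\<close> children.\<close>

lemma rep_value_rec:
  assumes "j < K"
  shows "rep_value j * (lam + w j) = w j * (1 + rep_value (Suc j))"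
proof -
  have p: "0 < discount 0 j" "0 < discount 0 (Suc j)" "0 < w j"
    using discount_pos[of 0] lam_pos assms w_pos by auto
  have "rep_value j * discount 0 j = discount 0 (Suc j) + (\<Sum>k=Suc j..<K. discount 0 (Suc k))"
    using p assms by (simp add: rep_value_def sum.atLeast_Suc_lessThan)
  also have "\<dots> = discount 0 (Suc j) * (1 + rep_value (Suc j))"
    using p by (simp add: rep_value_def distrib_left)
  finally have "rep_value j * discount 0 j = (w j / (w j + lam) * (1 + rep_value (Suc j))) * discount 0 j"
    by (simp add: discount_Suc mult_ac)
  then have "rep_value j = w j / (w j + lam) * (1 + rep_value (Suc j))"
    using p(1) by (metis less_irrefl mult_right_cancel)
  then show ?thesis using p lam_pos by (simp add: field_simps)
qed

lemma coeff_pos: "j < K \<Longrightarrow> 0 < coeff j"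
  using rep_value_pos w_pos by (simp add: coeff_def)

text \<open>The sum of the positive coefficients dominates each of them, so
  \<open>eps * coeff j \<le> 1\<close>; equivalently, the birth rate \<open>w j\<close> is at least
  \<open>eps * rep_value j\<close>. Hence the modified kernel keeps nonnegative weights.\<close>

definition eps :: real where "eps = 1 / (\<Sum>j<K. coeff j)"

definition weight :: "nat \<Rightarrow> real" where "weight j = 1 - eps * coeff j"

lemma eps_pos: "0 < eps"
  unfolding eps_def using K_pos coeff_pos by (intro divide_pos_pos sum_pos) auto

lemma weight_nonneg:
  assumes j: "j < K" shows "0 \<le> weight j"
proof -
  have "coeff j \<le> (\<Sum>j<K. coeff j)"
    using j coeff_pos by (intro member_le_sum) (auto intro: less_imp_le)
  moreover have "0 < coeff j" using j coeff_pos by auto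
  ultimately show ?thesis by (simp add: weight_def eps_def)
qed

definition coeff_total :: real where "coeff_total = (\<Sum>j<K. coeff j * discount 0 (Suc j))"

lemma coeff_total_pos: "0 < coeff_total"
  unfolding coeff_total_def using K_pos coeff_pos discount_pos[of 0] lam_pos
  by (intro sum_pos mult_pos_pos) auto

lemma sum_weight_discount: "(\<Sum>j<K. weight j * discount 0 (Suc j)) = 1 - eps * coeff_total"
  using sum_discount
  by (simp add: weight_def coeff_total_def left_diff_distrib sum_subtractf sum_distrib_left mult.assoc)

text \<open>Both sums are continuous in \<open>d\<close> and strictly below 1 at
  \<open>d = 0\<close>: the first is \<open>1 - eps * coeff_total\<close> there, the second is
  termwise smaller than the sum in \<open>root\<close>. The first drives the fixed-point iteration,
  the second is the contraction factor for second moments.\<close>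

lemma exists_decay_rate:
  "\<exists>d. 0 < d \<and> d < lam \<and> (\<Sum>j<K. weight j * discount d (Suc j)) < 1
     \<and> (\<Sum>j<K. \<Prod>i<Suc j. w i / (w i + 2 * (lam - d))) < 1"
proof -
  have nz: "w i + lam - 0 \<noteq> 0" "w i + 2 * (lam - 0) \<noteq> 0" if "j < K" "i < Suc j" for i j
    using w_pos[of i] lam_pos that by auto
  have "((\<lambda>d. \<Sum>j<K. weight j * discount d (Suc j)) \<longlongrightarrow> (\<Sum>j<K. weight j * discount 0 (Suc j))) (at_right 0)"
    unfolding discount_def by (intro tendsto_intros nz(1)) auto
  moreover have "(\<Sum>j<K. weight j * discount 0 (Suc j)) < 1"
    using sum_weight_discount eps_pos coeff_total_pos by simp
  ultimately have 1: "\<forall>\<^sub>F d in at_right 0. (\<Sum>j<K. weight j * discount d (Suc j)) < 1"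
    by (rule order_tendstoD)
  have "((\<lambda>d. \<Sum>j<K. \<Prod>i<Suc j. w i / (w i + 2 * (lam - d))) \<longlongrightarrow> (\<Sum>j<K. \<Prod>i<Suc j. w i / (w i + 2 * (lam - 0)))) (at_right 0)"
    by (intro tendsto_intros nz(2)) auto
  moreover have "(\<Sum>j<K. \<Prod>i<Suc j. w i / (w i + 2 * (lam - 0))) < (\<Sum>j<K. \<Prod>i<Suc j. w i / (w i + lam))"
  proof (rule sum_strict_mono)
    fix j assume "j \<in> {..<K}"
    then have "w i / (w i + 2 * (lam - 0)) < w i / (w i + lam) \<and> 0 < w i / (w i + 2 * (lam - 0))" if "i < Suc j" for i
      using w_pos[of i] lam_pos that by (auto intro!: divide_strict_left_mono)
    then show "(\<Prod>i<Suc j. w i / (w i + 2 * (lam - 0))) < (\<Prod>i<Suc j. w i / (w i + lam))"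
      by (intro prod_mono_strict[of 0]) (force intro: less_imp_le)+
  qed (use K_pos in auto)
  ultimately have 2: "\<forall>\<^sub>F d in at_right 0. (\<Sum>j<K. \<Prod>i<Suc j. w i / (w i + 2 * (lam - d))) < 1"
    unfolding root by (rule order_tendstoD)
  have 3: "\<forall>\<^sub>F d in at_right 0. 0 < d \<and> d < lam"
    using lam_pos by (auto simp: eventually_at_right_field)
  from eventually_conj[OF 1 eventually_conj[OF 2 3]] show ?thesis
    using eventually_happens' trivial_limit_at_right_real by blast
qed

definition renewal_op :: "(real \<Rightarrow> real) \<Rightarrow> real \<Rightarrow> real" where
  "renewal_op h t = (\<Sum>j<K. weight j * iter_conv (Suc j) h t)"

text \<open>For \<open>t \<ge> 0\<close> the sum of \<open>coeff j * iter_conv (Suc j) b t\<close>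
  should be \<open>- exp (- lam * t) / lam\<close>; moving \<open>eps\<close> times this sum out of
  the renewal equation leaves the present inhomogeneity. The value at negative times is the one that
  makes \<open>b = - 1 / (lam * coeff_total)\<close> consistent there.\<close>

definition source :: "real \<Rightarrow> real" where
  "source t = (if 0 \<le> t then (1 - eps / lam) * exp (- lam * t) else - (eps / lam))"

lemma exp_bounded_renewal_op:
  assumes "exp_bounded d C h" "d < lam"
  shows "exp_bounded d (C * (\<Sum>j<K. weight j * discount d (Suc j))) (renewal_op h)"
proof -
  have "exp_bounded d (\<Sum>j<K. weight j * (C * discount d (Suc j))) (\<lambda>t. \<Sum>j<K. weight j * iter_conv (Suc j) h t)"
    using assms by (intro exp_bounded_sum exp_bounded_iter_conv weight_nonneg) auto
  then show ?thesis by (simp add: renewal_op_def[abs_def] sum_distrib_left mult.left_commute)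
qed

lemma renewal_op_diff:
  assumes "exp_bounded d C f" "exp_bounded d C' g" "d < lam"
  shows "renewal_op (\<lambda>t. f t - g t) t = renewal_op f t - renewal_op g t"
  unfolding renewal_op_def sum_subtractf[symmetric] right_diff_distrib[symmetric]
  by (intro sum.cong refl) (use iter_conv_diff[OF assms] in \<open>simp del: iter_conv.simps\<close>)

lemma renewal_op_continuous:
  assumes "exp_bounded d C h" "d < lam" "\<And>t. t < 0 \<Longrightarrow> h t = e" "continuous_on {0..} h"
  shows "continuous_on {0..} (renewal_op h)"
  unfolding renewal_op_def[abs_def]
  by (intro continuous_intros DERIV_continuous_on[OF iter_conv_has_derivative[OF assms]]) auto

lemma renewal_op_const_on_negative:
  assumes "exp_bounded d C h" "d < lam" "\<And>t. t < 0 \<Longrightarrow> h t = e" "t < 0"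
  shows "renewal_op h t = e * (1 - eps * coeff_total)"
  unfolding renewal_op_def sum_weight_discount[symmetric] sum_distrib_left
  using assms(4) by (intro sum.cong refl) (simp add: iter_conv_const_on_negative(2)[OF assms(1-3)] del: iter_conv.simps)

lemma exp_bounded_source:
  assumes "0 < d" "d < lam"
  shows "exp_bounded d (1 + eps / lam) source"
  unfolding exp_bounded_def
proof (intro conjI allI)
  show "source \<in> borel_measurable borel" unfolding source_def[abs_def] by measurable
  have e: "0 < eps / lam" using eps_pos lam_pos by simp
  then show "0 \<le> 1 + eps / lam" by simp
  fix t
  show "\<bar>source t\<bar> \<le> (1 + eps / lam) * exp (- d * t)"
  proof (cases "0 \<le> t")
    case True
    then have "exp (- lam * t) \<le> exp (- d * t)" using assms by (simp add: mult_right_mono)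
    then show ?thesis using True e by (simp add: source_def abs_mult) (intro mult_mono, auto)
  next
    case False
    then have "1 \<le> exp (- d * t)" using assms by (simp add: mult_nonneg_nonpos)
    then have "1 + eps / lam \<le> (1 + eps / lam) * exp (- d * t)" using e by simp
    then show ?thesis using False eps_pos lam_pos by (simp add: source_def)
  qed
qed

text \<open>A Neumann series in the weighted norm. Constancy on the negative axis and continuity on
  \<open>{0..}\<close> are carried along because \<open>iter_conv_has_derivative\<close> asks for
  both; \<open>b (- 1)\<close> just names the constant.\<close>

lemma fixed_point_exists:
  assumes d: "0 < d" "d < lam" and p: "(\<Sum>j<K. weight j * discount d (Suc j)) < 1"
  shows "\<exists>B b. exp_bounded d B b \<and> continuous_on {0..} b \<and> (\<forall>t<0. b t = b (- 1))
    \<and> (\<forall>t. b t = source t + renewal_op b t)"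
proof -
  define q where "q = (\<Sum>j<K. weight j * discount d (Suc j))"
  have q: "0 \<le> q" "q < 1"
    using p unfolding q_def
    by (auto intro!: sum_nonneg mult_nonneg_nonneg weight_nonneg less_imp_le[OF discount_pos] simp: d)
  define C where "C = 1 + eps / lam"
  define h where "h n = (renewal_op ^^ n) source" for n
  have h_Suc: "h (Suc n) = renewal_op (h n)" and h_0: "h 0 = source" for n by (simp_all add: h_def)
  have h: "exp_bounded d (C * q ^ n) (h n)" for n
  proof (induction n)
    case (Suc n)
    from exp_bounded_renewal_op[OF this d(2)] show ?case by (simp add: h_Suc q_def mult_ac)
  qed (use exp_bounded_source[OF d] in \<open>simp add: h_0 C_def\<close>)
  have h_neg: "\<exists>e. \<forall>t<0. h n t = e" for n
  proof (induction n)
    case (Suc n)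
    then obtain e where "\<And>t. t < 0 \<Longrightarrow> h n t = e" by blast
    from renewal_op_const_on_negative[OF h d(2) this] show ?case unfolding h_Suc by blast
  qed (auto simp: h_0 source_def)
  have h_cont: "continuous_on {0..} (h n)" for n
  proof (induction n)
    case 0
    have "continuous_on {0..} (\<lambda>t. (1 - eps / lam) * exp (- lam * t))" by (intro continuous_intros)
    then show ?case unfolding h_0 by (rule continuous_on_cong[THEN iffD1, rotated -1]) (auto simp: source_def)
  next
    case (Suc n)
    obtain e where "\<And>t. t < 0 \<Longrightarrow> h n t = e" using h_neg by blast
    from renewal_op_continuous[OF h d(2) this Suc] show ?case unfolding h_Suc .
  qed
  have h_le: "\<bar>h n t\<bar> \<le> C * exp (- d * t) * q ^ n" for n t
    using h[of n] by (auto simp: exp_bounded_def mult_ac)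
  have h_sum: "summable (\<lambda>n. C * exp (- d * t) * q ^ n)" for t
    using q by (intro summable_mult summable_geometric) auto
  have summ: "summable (\<lambda>n. \<bar>h n t\<bar>)" for t
    by (rule summable_comparison_test'[OF h_sum, where N=0]) (use h_le in auto)
  define b where "b t = (\<Sum>n. h n t)" for t
  have tail_le: "\<bar>b t - (\<Sum>k<n. h k t)\<bar> \<le> C * q ^ n / (1 - q) * exp (- d * t)" for n t
  proof -
    have "b t - (\<Sum>k<n. h k t) = (\<Sum>k. h (k + n) t)"
      unfolding b_def using suminf_split_initial_segment[OF summable_rabs_cancel[OF summ], of t n] by simp
    also have "\<bar>\<dots>\<bar> \<le> (\<Sum>k. \<bar>h (k + n) t\<bar>)"
      by (rule summable_rabs[OF summable_ignore_initial_segment[OF summ]])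
    also have "\<dots> \<le> (\<Sum>k. C * exp (- d * t) * q ^ n * q ^ k)"
    proof (rule suminf_le)
      show "\<bar>h (k + n) t\<bar> \<le> C * exp (- d * t) * q ^ n * q ^ k" for k
        using h_le[of "k + n" t] by (simp add: power_add mult_ac)
    qed (use q in \<open>auto intro!: summable_mult summable_geometric summable_ignore_initial_segment[OF summ]\<close>)
    also have "\<dots> = C * q ^ n / (1 - q) * exp (- d * t)"
      using q by (subst suminf_mult) (auto simp: suminf_geometric)
    finally show ?thesis .
  qed
  have b_meas[measurable]: "b \<in> borel_measurable borel"
    unfolding b_def[abs_def] using exp_bounded_measurable[OF h] by measurable
  have C0: "0 \<le> C" using h[of 0] by (simp add: exp_bounded_def)
  have h_meas[measurable]: "h n \<in> borel_measurable borel" for n by (rule exp_bounded_measurable[OF h])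
  have tail: "exp_bounded d (C * q ^ n / (1 - q)) (\<lambda>t. b t - (\<Sum>k<n. h k t))" for n
    unfolding exp_bounded_def using q C0 tail_le by (intro conjI allI) auto
  have b: "exp_bounded d (C / (1 - q)) b" using tail[of 0] by simp
  have partial: "\<exists>C. exp_bounded d C (\<lambda>t. \<Sum>k<n. h k t)" for n
    using exp_bounded_sum[of "{..<n}" d "\<lambda>k. C * q ^ k" h "\<lambda>_. 1"] h by auto
  have partial_op: "(\<Sum>k<Suc n. h k t) = source t + renewal_op (\<lambda>t. \<Sum>k<n. h k t) t" for n t
  proof (induction n arbitrary: t)
    case 0
    have "exp_bounded d 0 (\<lambda>_. 0)" by (simp add: exp_bounded_def)
    from renewal_op_diff[OF this this d(2)] show ?case by (simp add: h_0)
  next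
    case (Suc n)
    obtain C' where C': "exp_bounded d C' (\<lambda>t. \<Sum>k<Suc n. h k t)" using partial by blast
    have "(\<lambda>t. \<Sum>k<n. h k t) = (\<lambda>t. (\<Sum>k<Suc n. h k t) - h n t)" by simp
    then have "renewal_op (\<lambda>t. \<Sum>k<n. h k t) t = renewal_op (\<lambda>t. \<Sum>k<Suc n. h k t) t - renewal_op (h n) t"
      by (simp only: renewal_op_diff[OF C' h d(2)])
    then have "renewal_op (\<lambda>t. \<Sum>k<Suc n. h k t) t = renewal_op (\<lambda>t. \<Sum>k<n. h k t) t + h (Suc n) t"
      by (simp only: h_Suc)
    then show ?case using Suc[of t] by simp
  qed
  have fixed: "b t = source t + renewal_op b t" for t
  proof -
    define D where "D = C / (1 - q) * exp (- d * t)"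
    \<comment> \<open>The defect is the tail of the series after \<open>Suc n\<close> terms minus
      the image of the tail after \<open>n\<close> terms; both are of order
      \<open>q ^ n\<close>.\<close>
    have le: "\<bar>b t - (source t + renewal_op b t)\<bar> \<le> D * (1 + 1) * q ^ n" for n
    proof -
      obtain C' where C': "exp_bounded d C' (\<lambda>t. \<Sum>k<n. h k t)" using partial by blast
      have 1: "renewal_op (\<lambda>t. b t - (\<Sum>k<n. h k t)) t = renewal_op b t - renewal_op (\<lambda>t. \<Sum>k<n. h k t) t"
        by (rule renewal_op_diff[OF b C' d(2)])
      have "b t - (source t + renewal_op b t) = (b t - (\<Sum>k<Suc n. h k t)) - renewal_op (\<lambda>t. b t - (\<Sum>k<n. h k t)) t"
        unfolding 1 partial_op by simp
      also have "\<bar>\<dots>\<bar> \<le> \<bar>b t - (\<Sum>k<Suc n. h k t)\<bar> + \<bar>renewal_op (\<lambda>t. b t - (\<Sum>k<n. h k t)) t\<bar>" by linarith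
      also have "\<bar>b t - (\<Sum>k<Suc n. h k t)\<bar> \<le> C * q ^ Suc n / (1 - q) * exp (- d * t)" by (rule tail_le)
      also have "\<dots> \<le> D * q ^ n"
      proof -
        have "q ^ Suc n \<le> q ^ n" using q by (intro power_decreasing) auto
        then have "C / (1 - q) * exp (- d * t) * q ^ Suc n \<le> C / (1 - q) * exp (- d * t) * q ^ n"
          using C0 q by (intro mult_left_mono) auto
        then show ?thesis by (simp add: D_def mult_ac)
      qed
      also have "\<bar>renewal_op (\<lambda>t. b t - (\<Sum>k<n. h k t)) t\<bar> \<le> C * q ^ n / (1 - q) * q * exp (- d * t)"
        using exp_bounded_renewal_op[OF tail[of n] d(2)] unfolding exp_bounded_def q_def by blast
      also have "\<dots> = D * q ^ n * q" by (simp add: D_def)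
      also have "\<dots> \<le> D * q ^ n * 1"
        using q C0 by (intro mult_left_mono) (auto simp: D_def)
      finally show ?thesis by (simp add: algebra_simps)
    qed
    have "(\<lambda>n. D * (1 + 1) * q ^ n) \<longlonglongrightarrow> D * (1 + 1) * 0"
      using q by (intro tendsto_intros LIMSEQ_power_zero) auto
    then have "\<bar>b t - (source t + renewal_op b t)\<bar> \<le> D * (1 + 1) * 0"
      by (rule LIMSEQ_le_const) (use le in blast)
    then show ?thesis by simp
  qed
  have b_neg: "b t = b (- 1)" if "t < 0" for t
  proof -
    have "h n t = h n (- 1)" for n using h_neg[of n] that by (metis neg_less_0_iff_less zero_less_one)
    then show ?thesis by (simp add: b_def)
  qed
  have b_cont: "continuous_on {0..} b"
  proof (rule uniform_limit_theorem)
    show "uniform_limit {0..} (\<lambda>n t. \<Sum>k<n. h k t) b sequentially"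
      unfolding b_def[abs_def]
    proof (rule Weierstrass_m_test)
      show "norm (h n t) \<le> C * q ^ n" if "t \<in> {0..}" for n t
      proof -
        have "C * exp (- d * t) * q ^ n \<le> C * 1 * q ^ n"
          using that d q C0 by (intro mult_right_mono mult_left_mono) auto
        then show ?thesis using h_le[of n t] by simp
      qed
      show "summable (\<lambda>n. C * q ^ n)" using q by (intro summable_mult summable_geometric) auto
    qed
    show "\<forall>\<^sub>F n in sequentially. continuous_on {0..} (\<lambda>t. \<Sum>k<n. h k t)"
      by (intro always_eventually allI continuous_intros h_cont)
  qed simp
  show ?thesis using b b_cont b_neg fixed by blast
qed

text \<open>
  Passing from \<open>renewal_op\<close> to the renewal equation amounts to the identity \<open>J = 0\<close> below. It holds
  because the mean total reproductive value, discounted by \<open>exp (- lam * t)\<close>, is constant in time.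
\<close>

lemma renewal_solution:
  "\<exists>d B c b. 0 < d \<and> d < lam \<and> (\<Sum>j<K. \<Prod>i<Suc j. w i / (w i + 2 * (lam - d))) < 1 \<and> 0 < c
    \<and> exp_bounded d B b \<and> (\<forall>t<0. b t = - c)
    \<and> (\<forall>t. b t = (if 0 \<le> t then exp (- lam * t) else 0) + (\<Sum>j<K. iter_conv (Suc j) b t))"
proof -
  obtain d where d: "0 < d" "d < lam" "(\<Sum>j<K. weight j * discount d (Suc j)) < 1"
    "(\<Sum>j<K. \<Prod>i<Suc j. w i / (w i + 2 * (lam - d))) < 1"
    using exists_decay_rate by blast
  obtain B b where b: "exp_bounded d B b" "continuous_on {0..} b" "\<And>t. t < 0 \<Longrightarrow> b t = b (- 1)"
    "\<And>t. b t = source t + renewal_op b t"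
    using fixed_point_exists[OF d(1-3)] by blast
  \<comment> \<open>Forced by the fixed-point equation at negative times, where
    \<open>source\<close> is \<open>- (eps / lam)\<close> and the kernel has mass
    \<open>1 - eps * coeff_total\<close>.\<close>
  define c where "c = 1 / (lam * coeff_total)"
  have c: "0 < c" using lam_pos coeff_total_pos by (simp add: c_def)
  have "b (- 1) = - (eps / lam) + b (- 1) * (1 - eps * coeff_total)"
    using b(4)[of "- 1"] renewal_op_const_on_negative[OF b(1) d(2) b(3), of "- 1"] by (simp add: source_def)
  then have "eps * (b (- 1) * coeff_total) = eps * (- (1 / lam))" by (simp add: algebra_simps)
  then have "b (- 1) * coeff_total = - (1 / lam)" using eps_pos by (metis less_irrefl mult_left_cancel)
  then have b1: "b (- 1) = - c" using coeff_total_pos lam_pos by (simp add: c_def field_simps)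
  then have b_neg: "b t = - c" if "t < 0" for t using b(3)[OF that] by simp
  \<comment> \<open>Read \<open>b t\<close> as \<open>exp (- lam * t) * m t - c\<close> with
    \<open>m\<close> the mean size. The sum of \<open>coeff j\<close> times the mean number of
    children of rank \<open>Suc j\<close> has as derivative the mean total reproductive value
    \<open>exp (lam * t)\<close>; integrating from 0 and discounting suggests
    \<open>J t = 0\<close>.\<close>
  define J where "J t = lam * (\<Sum>j<K. coeff j * iter_conv (Suc j) b t) + exp (- lam * t)" for t
  have op_eq: "renewal_op b t = (\<Sum>j<K. iter_conv (Suc j) b t) - eps * (\<Sum>j<K. coeff j * iter_conv (Suc j) b t)" for t
    by (simp add: renewal_op_def weight_def left_diff_distrib sum_subtractf sum_distrib_left mult.assoc del: iter_conv.simps)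
  \<comment> \<open>The telescoped sum is \<open>b t\<close> minus the full renewal sum, and the
    equation already solved by \<open>b\<close> expresses it through \<open>J\<close>. The result is
    a homogeneous linear equation, so \<open>J\<close> vanishes once \<open>J 0 = 0\<close>.\<close>
  have J_deriv: "(J has_real_derivative - eps * J t) (at t within {0..})" if t: "0 \<le> t" for t
  proof -
    have der: "(J has_real_derivative lam * (\<Sum>j<K. coeff j * (w j * iter_conv j b t - (lam + w j) * iter_conv (Suc j) b t))
        + - lam * exp (- lam * t)) (at t within {0..})"
      unfolding J_def[abs_def]
    proof (intro DERIV_add DERIV_cmult DERIV_sum)
      show "(iter_conv (Suc j) b has_real_derivative w j * iter_conv j b t - (lam + w j) * iter_conv (Suc j) b t) (at t within {0..})"
        if "j \<in> {..<K}" for j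
        using that by (intro iter_conv_has_derivative[OF b(1) d(2) b_neg b(2) _ t]) auto
      show "((\<lambda>t. exp (- lam * t)) has_real_derivative - lam * exp (- lam * t)) (at t within {0..})"
        by (auto intro!: derivative_eq_intros)
    qed
    have sum1: "(\<Sum>j<K. coeff j * (w j * iter_conv j b t - (lam + w j) * iter_conv (Suc j) b t))
        = b t - (\<Sum>j<K. iter_conv (Suc j) b t)"
    proof -
      have "coeff j * (w j * iter_conv j b t - (lam + w j) * iter_conv (Suc j) b t)
          = (rep_value j * iter_conv j b t - rep_value (Suc j) * iter_conv (Suc j) b t) - iter_conv (Suc j) b t"
        if "j < K" for j
      proof -
        have "0 < w j" using w_pos that by auto
        then have cw: "coeff j * w j = rep_value j" by (simp add: coeff_def)
        moreover have "coeff j * (lam + w j) = 1 + rep_value (Suc j)"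
          using rep_value_rec[OF that] \<open>0 < w j\<close> by (simp add: coeff_def field_simps)
        ultimately show ?thesis
          by (simp only: right_diff_distrib mult.assoc[symmetric]) (simp add: algebra_simps del: iter_conv.simps)
      qed
      then have "(\<Sum>j<K. coeff j * (w j * iter_conv j b t - (lam + w j) * iter_conv (Suc j) b t))
        = (\<Sum>j<K. rep_value j * iter_conv j b t - rep_value (Suc j) * iter_conv (Suc j) b t) - (\<Sum>j<K. iter_conv (Suc j) b t)"
        by (simp add: sum_subtractf[symmetric] del: iter_conv.simps)
      also have "(\<Sum>j<K. rep_value j * iter_conv j b t - rep_value (Suc j) * iter_conv (Suc j) b t) = b t"
        by (subst sum_lessThan_telescope') (simp add: rep_value_0 rep_value_K)
      finally show ?thesis .
    qed
    have sum2: "b t - (\<Sum>j<K. iter_conv (Suc j) b t) = (1 - eps / lam) * exp (- lam * t) - eps * (\<Sum>j<K. coeff j * iter_conv (Suc j) b t)"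
      using b(4)[of t] t op_eq[of t] by (simp add: source_def del: iter_conv.simps)
    have "lam * ((1 - eps / lam) * E - eps * S) + - lam * E = - eps * (lam * S + E)" for E S
      using lam_pos by (simp add: field_simps)
    with der show ?thesis unfolding sum1 sum2 J_def[of t] by simp
  qed
  have J_0: "J 0 = 0"
  proof -
    have "(\<Sum>j<K. coeff j * iter_conv (Suc j) b 0) = - c * coeff_total"
      unfolding coeff_total_def sum_distrib_left
      by (intro sum.cong refl) (simp add: iter_conv_const_on_negative(2)[OF b(1) d(2) b_neg] del: iter_conv.simps)
    then show ?thesis using lam_pos coeff_total_pos by (simp add: J_def c_def del: iter_conv.simps)
  qed
  have J: "J t = 0" if t: "0 \<le> t" for t
  proof -
    have "\<exists>r. \<forall>t\<in>{0..}. exp (eps * t) * J t = r"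
    proof (rule has_field_derivative_zero_constant)
      fix t :: real assume "t \<in> {0..}"
      then show "((\<lambda>t. exp (eps * t) * J t) has_field_derivative 0) (at t within {0..})"
        by (auto intro!: derivative_eq_intros J_deriv)
    qed simp
    then obtain r where "\<And>t. 0 \<le> t \<Longrightarrow> exp (eps * t) * J t = r" by auto
    from this[of 0] this[OF t] J_0 show ?thesis by simp
  qed
  have renewal: "b t = (if 0 \<le> t then exp (- lam * t) else 0) + (\<Sum>j<K. iter_conv (Suc j) b t)" for t
  proof (cases "0 \<le> t")
    case True
    then have "lam * (\<Sum>j<K. coeff j * iter_conv (Suc j) b t) = - exp (- lam * t)"
      using J[OF True] by (simp add: J_def del: iter_conv.simps)
    then have "(\<Sum>j<K. coeff j * iter_conv (Suc j) b t) = - exp (- lam * t) / lam"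
      using lam_pos by (simp add: field_simps del: iter_conv.simps)
    then show ?thesis using True b(4)[of t] unfolding op_eq by (simp add: source_def algebra_simps del: iter_conv.simps)
  next
    case False
    have "(\<Sum>j<K. iter_conv (Suc j) b t) = (\<Sum>j<K. - c * discount 0 (Suc j))"
      using False by (intro sum.cong refl) (simp add: iter_conv_const_on_negative(2)[OF b(1) d(2) b_neg] del: iter_conv.simps)
    also have "\<dots> = - c" by (simp only: sum_distrib_left[symmetric] sum_discount mult_1_right)
    finally show ?thesis using False b_neg by simp
  qed
  show ?thesis using d c b(1) b_neg renewal by blast
qed

end

section \<open>Exponential waiting times\<close>

lemma malthusian_parameter_exists:
  fixes w :: "nat \<Rightarrow> real"
  assumes K: "2 \<le> K" and w: "\<And>j. j < K \<Longrightarrow> 0 < w j"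
  shows "\<exists>lam>0. (\<Sum>j<K. \<Prod>i<Suc j. w i / (w i + lam)) = 1"
proof -
  define f where "f x = (\<Sum>j<K. \<Prod>i<Suc j. w i / (w i + x))" for x
  \<comment> \<open>Each product is at most its first factor, so \<open>f X\<close> is at most
    \<open>K * w 0 / (w 0 + X)\<close>, which is \<open>K / (K + 1)\<close> for this choice.\<close>
  define X where "X = real K * w 0"
  have w0: "0 < w 0" and X: "0 < X" using K w[of 0] by (auto simp: X_def)
  have f0: "f 0 = real K"
  proof -
    have "(\<Prod>i<Suc j. w i / (w i + 0)) = 1" if "j < K" for j
    proof (intro prod.neutral ballI)
      fix i assume "i \<in> {..<Suc j}"
      then have "0 < w i" using w that by auto
      then show "w i / (w i + 0) = 1" by simp
    qed
    then show ?thesis by (simp add: f_def)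
  qed
  have "f X \<le> (\<Sum>j<K. w 0 / (w 0 + X))"
    unfolding f_def
  proof (rule sum_mono)
    fix j assume j: "j \<in> {..<K}"
    have "(\<Prod>i<Suc j. w i / (w i + X)) = w 0 / (w 0 + X) * (\<Prod>i<j. w (Suc i) / (w (Suc i) + X))"
      by (subst prod.lessThan_Suc_shift) simp
    also have "\<dots> \<le> w 0 / (w 0 + X) * 1"
    proof (intro mult_left_mono prod_le_1 conjI)
      fix i assume "i \<in> {..<j}"
      then have "0 < w (Suc i)" using w j by auto
      then show "0 \<le> w (Suc i) / (w (Suc i) + X)" "w (Suc i) / (w (Suc i) + X) \<le> 1" using X by auto
    qed (use w0 X in auto)
    finally show "(\<Prod>i<Suc j. w i / (w i + X)) \<le> w 0 / (w 0 + X)" by simp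
  qed
  also have "\<dots> \<le> 1" using w0 X by (simp add: X_def divide_le_eq_1)
  finally have fX: "f X \<le> 1" .
  have "\<exists>x\<ge>0. x \<le> X \<and> f x = 1"
  proof (rule IVT2')
    show "1 \<le> f 0" using f0 K by simp
    show "continuous_on {0..X} f"
      unfolding f_def
    proof (intro continuous_intros ballI)
      fix j i x assume "j \<in> {..<K}" "i \<in> {..<Suc j}" "x \<in> {0..X}"
      then show "w i + x \<noteq> 0" using w[of i] by auto
    qed
  qed (use X fX in auto)
  then obtain x where x: "0 \<le> x" "f x = 1" by blast
  moreover have "x \<noteq> 0" using x f0 K by auto
  ultimately show ?thesis unfolding f_def by (intro exI[of _ x]) auto
qed

section \<open>Canonical law of the waiting times of one vertex\<close>

locale exp_rates =
  fixes K :: nat and w :: "nat \<Rightarrow> real"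
  assumes K_ge_2: "2 \<le> K" and w_pos: "\<And>j. j < K \<Longrightarrow> 0 < w j"
begin

definition clock :: "(nat \<Rightarrow> real) measure" where
  "clock = PiM {1..K} (\<lambda>i. exp_measure (w (i - 1)))"

text \<open>The truncation makes the birth times nonnegative everywhere, not only almost everywhere.\<close>

definition birth :: "nat \<Rightarrow> (nat \<Rightarrow> real) \<Rightarrow> real" where
  "birth i u = (\<Sum>j=1..i. max 0 (u j))"

lemma prob_space_clock: "prob_space clock"
  unfolding clock_def by (intro prob_space_PiM prob_space_exponential_density w_pos) auto

sublocale clock: prob_space clock
  by (rule prob_space_clock)

lemma measurable_clock_coord: "i \<in> {1..K} \<Longrightarrow> (\<lambda>u. u i) \<in> borel_measurable clock"
proof -
  assume i: "i \<in> {1..K}"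
  have "(\<lambda>u. u i) \<in> measurable clock (exp_measure (w (i - 1)))"
    unfolding clock_def by (rule measurable_component_singleton[OF i])
  then show ?thesis by (simp cong: measurable_cong_sets)
qed

lemma birth_measurable: "i \<le> K \<Longrightarrow> birth i \<in> borel_measurable clock"
  unfolding birth_def[abs_def] by (intro borel_measurable_sum borel_measurable_max measurable_clock_coord) auto

lemma birth_nonneg: "0 \<le> birth i u"
  unfolding birth_def by (intro sum_nonneg) auto

lemma distr_clock_coord: "i \<in> {1..K} \<Longrightarrow> distr clock borel (\<lambda>u. u i) = exp_measure (w (i - 1))"
proof -
  assume i: "i \<in> {1..K}"
  have "distr clock (exp_measure (w (i - 1))) (\<lambda>u. u i) = exp_measure (w (i - 1))"
    unfolding clock_def using i
    by (intro distr_PiM_component prob_space_exponential_density w_pos) auto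
  then show ?thesis by (simp cong: distr_cong)
qed

lemma indep_vars_clock_coords: "clock.indep_vars (\<lambda>_. borel) (\<lambda>i u. u i) {1..K}"
proof (subst clock.indep_vars_iff_distr_eq_PiM')
  have "distr clock (PiM {1..K} (\<lambda>_. borel)) (\<lambda>x. \<lambda>i\<in>{1..K}. x i) = distr clock clock (\<lambda>x. x)"
  proof (rule distr_cong)
    show "sets (PiM {1..K} (\<lambda>_. borel)) = sets clock"
      unfolding clock_def by (intro sets_PiM_cong) auto
  qed (auto simp: clock_def space_PiM PiE_def extensional_restrict)
  also have "\<dots> = PiM {1..K} (\<lambda>i. exp_measure (w (i - 1)))" by (simp add: clock_def)
  also have "\<dots> = PiM {1..K} (\<lambda>i. distr clock borel (\<lambda>u. u i))"
    by (rule PiM_cong[OF refl]) (rule distr_clock_coord[symmetric])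
  finally show "distr clock (PiM {1..K} (\<lambda>_. borel)) (\<lambda>x. \<lambda>i\<in>{1..K}. x i) = PiM {1..K} (\<lambda>i. distr clock borel (\<lambda>u. u i))" .
qed (use K_ge_2 measurable_clock_coord in auto)

lemma birth_Suc: "birth (Suc j) u = birth j u + max 0 (u (Suc j))"
  by (simp add: birth_def)

text \<open>The last waiting time is independent of the earlier ones, so Fubini's theorem separates
  it; the truncation at 0 disappears because the exponential law charges positive numbers only. This
  is the probabilistic side of one \<open>exp_conv\<close>.\<close>

lemma integral_birth_Suc:
  fixes f :: "real \<Rightarrow> real"
  assumes f[measurable]: "f \<in> borel_measurable borel" and bound: "\<And>y. \<bar>f y\<bar> \<le> B" and j: "j < K"
  shows "(\<integral>u. f (birth (Suc j) u) \<partial>clock) = (\<integral>x. (\<integral>u. f (birth j u + x) \<partial>clock) \<partial>exp_measure (w j))"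
proof -
  have wj: "0 < w j" using j w_pos by simp
  define X where "X u = max 0 (u (Suc j))" for u :: "nat \<Rightarrow> real"
  have X[measurable]: "X \<in> borel_measurable clock"
    unfolding X_def using j by (intro borel_measurable_max measurable_clock_coord) auto
  have S[measurable]: "birth j \<in> borel_measurable clock" using j by (intro birth_measurable) simp
  have "clock.indep_vars (\<lambda>_. borel) (\<lambda>i u. max 0 (u i)) {1..K}"
    by (rule clock.indep_vars_compose2[OF indep_vars_clock_coords]) auto
  then have "clock.indep_vars (\<lambda>_. borel) (\<lambda>i u. max 0 (u i)) (insert (Suc j) {1..j})"
    by (rule clock.indep_vars_subset) (use j in auto)
  then have indep: "clock.indep_var borel X borel (birth j)"
    unfolding X_def birth_def by (intro clock.indep_vars_sum) auto
  have joint: "distr clock borel X \<Otimes>\<^sub>M distr clock borel (birth j) = distr clock (borel \<Otimes>\<^sub>M borel) (\<lambda>u. (X u, birth j u))"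
    using indep unfolding clock.indep_var_distribution_eq by simp
  interpret D1: prob_space "distr clock borel X" by (rule clock.prob_space_distr) measurable
  interpret D2: prob_space "distr clock borel (birth j)" by (rule clock.prob_space_distr) measurable
  interpret D: pair_prob_space "distr clock borel X" "distr clock borel (birth j)" by unfold_locales
  have int: "integrable (distr clock borel X \<Otimes>\<^sub>M distr clock borel (birth j)) (\<lambda>(x, y). f (y + x))"
    using bound by (intro D.integrable_const_bound[where B=B]) (auto simp: split_beta')
  have "(\<integral>u. f (birth (Suc j) u) \<partial>clock) = (\<integral>u. (\<lambda>(x, y). f (y + x)) (X u, birth j u) \<partial>clock)"
    by (simp add: birth_Suc X_def)
  also have "\<dots> = (\<integral>p. (\<lambda>(x, y). f (y + x)) p \<partial>distr clock (borel \<Otimes>\<^sub>M borel) (\<lambda>u. (X u, birth j u)))"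
    by (rule integral_distr[symmetric]) measurable
  also have "\<dots> = (\<integral>x. \<integral>y. f (y + x) \<partial>distr clock borel (birth j) \<partial>distr clock borel X)"
    unfolding joint[symmetric] using D.integral_fst'[OF int] by simp
  also have "\<dots> = (\<integral>x. (\<integral>u. f (birth j u + x) \<partial>clock) \<partial>distr clock borel X)"
    by (subst integral_distr) auto
  also have "\<dots> = (\<integral>v. (\<integral>u. f (birth j u + X v) \<partial>clock) \<partial>clock)"
    by (rule integral_distr) measurable
  also have "\<dots> = (\<integral>x. (\<integral>u. f (birth j u + max 0 x) \<partial>clock) \<partial>distr clock borel (\<lambda>u. u (Suc j)))"
    unfolding X_def using j measurable_clock_coord[of "Suc j"] by (intro integral_distr[symmetric]) auto
  also have "distr clock borel (\<lambda>u. u (Suc j)) = exp_measure (w j)"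
    using distr_clock_coord[of "Suc j"] j by simp
  also have "(\<integral>x. (\<integral>u. f (birth j u + max 0 x) \<partial>clock) \<partial>exp_measure (w j)) = (\<integral>x. (\<integral>u. f (birth j u + x) \<partial>clock) \<partial>exp_measure (w j))"
    by (rule integral_cong_AE) (use AE_exp_measure_pos[OF wj] in \<open>auto elim!: eventually_mono simp: max_def\<close>)
  finally show ?thesis .
qed

lemma birth_moment:
  assumes k: "0 \<le> k"
  shows "j \<le> K \<Longrightarrow> (\<integral>u. exp (- k * birth j u) \<partial>clock) = (\<Prod>i<j. w i / (w i + k))"
proof (induction j)
  case 0
  then show ?case by (simp add: birth_def clock.prob_space)
next
  case (Suc j)
  have wj: "0 < w j" using Suc w_pos by simp
  have [measurable]: "birth j \<in> borel_measurable clock" using Suc by (intro birth_measurable) simp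
  have "(\<integral>u. exp (- k * birth (Suc j) u) \<partial>clock) = (\<integral>u. exp (- k * max 0 (birth (Suc j) u)) \<partial>clock)"
    using birth_nonneg[of "Suc j"] by (simp add: max_def)
  also have "\<dots> = (\<integral>x. (\<integral>u. exp (- k * max 0 (birth j u + x)) \<partial>clock) \<partial>exp_measure (w j))"
    using Suc k by (intro integral_birth_Suc[where B=1]) auto
  also have "\<dots> = (\<integral>x. exp (- k * x) * (\<integral>u. exp (- k * birth j u) \<partial>clock) \<partial>exp_measure (w j))"
  proof (rule integral_cong_AE)
    show "AE x in exp_measure (w j). (\<integral>u. exp (- k * max 0 (birth j u + x)) \<partial>clock) = exp (- k * x) * (\<integral>u. exp (- k * birth j u) \<partial>clock)"
      using AE_exp_measure_pos[OF wj]
    proof eventually_elim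
      case (elim x)
      have "exp (- k * max 0 (birth j u + x)) = exp (- k * x) * exp (- k * birth j u)" for u
        using birth_nonneg[of j u] elim by (simp add: max_def algebra_simps flip: exp_add)
      then show ?case by simp
    qed
  qed measurable
  also have "\<dots> = (\<Prod>i<Suc j. w i / (w i + k))"
    using Suc exp_measure_moment(2)[of "w j" k] wj k by simp
  finally show ?case .
qed

lemma iter_conv_eq_integral:
  assumes "malthusian_rates K w lam" and h: "exp_bounded d C h" and d: "0 < d" "d < lam"
  shows "j \<le> K \<Longrightarrow> malthusian_rates.iter_conv w lam j h t = (\<integral>u. exp (- lam * birth j u) * h (t - birth j u) \<partial>clock)"
proof (induction j arbitrary: t)
  interpret malthusian_rates K w lam by fact
  case 0
  then show ?case by (simp add: birth_def clock.prob_space)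
next
  interpret malthusian_rates K w lam by fact
  case (Suc j)
  have wj: "0 < w j" using Suc w_pos by simp
  have hm[measurable]: "h \<in> borel_measurable borel" by (rule exp_bounded_measurable[OF h])
  \<comment> \<open>\<open>integral_birth_Suc\<close> asks for a bounded integrand, but
    \<open>exp (- lam * y) * h (t - y)\<close> may be unbounded for negative \<open>y\<close>.
    Truncating at 0 changes nothing, as \<open>birth\<close> is nonnegative.\<close>
  define f where "f y = exp (- lam * max 0 y) * h (t - max 0 y)" for y
  have fm: "f \<in> borel_measurable borel" unfolding f_def[abs_def] by measurable
  have C: "0 \<le> C" using h by (simp add: exp_bounded_def)
  have fb: "\<bar>f y\<bar> \<le> C * exp (- d * t)" for y
  proof -
    have "\<bar>f y\<bar> \<le> exp (- lam * max 0 y) * (C * exp (- d * (t - max 0 y)))"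
      using h by (simp add: f_def abs_mult exp_bounded_def)
    also have "\<dots> = exp (- ((lam - d) * max 0 y)) * (C * exp (- d * t))"
      by (simp add: algebra_simps flip: exp_add)
    also have "\<dots> \<le> 1 * (C * exp (- d * t))"
      using C d by (intro mult_right_mono) auto
    finally show ?thesis by simp
  qed
  have "(\<integral>u. exp (- lam * birth (Suc j) u) * h (t - birth (Suc j) u) \<partial>clock) = (\<integral>u. f (birth (Suc j) u) \<partial>clock)"
    using birth_nonneg[of "Suc j"] by (simp add: f_def max_def)
  also have "\<dots> = (\<integral>x. (\<integral>u. f (birth j u + x) \<partial>clock) \<partial>exp_measure (w j))"
    using Suc by (intro integral_birth_Suc[OF fm fb]) auto
  also have "\<dots> = (\<integral>x. exp (- lam * x) * iter_conv j h (t - x) \<partial>exp_measure (w j))"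
  proof (rule integral_cong_AE)
    show "AE x in exp_measure (w j). (\<integral>u. f (birth j u + x) \<partial>clock) = exp (- lam * x) * iter_conv j h (t - x)"
      using AE_exp_measure_pos[OF wj]
    proof eventually_elim
      case (elim x)
      have "f (birth j u + x) = exp (- lam * x) * (exp (- lam * birth j u) * h (t - x - birth j u))" for u
        using birth_nonneg[of j u] elim by (simp add: f_def max_def algebra_simps flip: exp_add)
      then show ?case using Suc by simp
    qed
    have [measurable]: "iter_conv j h \<in> borel_measurable borel"
      using exp_bounded_measurable[OF exp_bounded_iter_conv[OF h d(2)]] Suc by simp
    show "(\<lambda>x. exp (- lam * x) * iter_conv j h (t - x)) \<in> borel_measurable (exp_measure (w j))" by measurable
    have [measurable]: "birth j \<in> borel_measurable clock" using Suc by (intro birth_measurable) simp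
    note fm[measurable]
    show "(\<lambda>x. \<integral>u. f (birth j u + x) \<partial>clock) \<in> borel_measurable (exp_measure (w j))" by measurable
  qed
  finally show ?case by (simp add: exp_conv_def)
qed

lemma branching_renewal_exists:
  "\<exists>lam d c B b. branching_renewal clock {1..K} birth lam d c B b"
proof -
  obtain lam where lam: "0 < lam" "(\<Sum>j<K. \<Prod>i<Suc j. w i / (w i + lam)) = 1"
    using malthusian_parameter_exists[of K w] K_ge_2 w_pos by blast
  interpret R: malthusian_rates K w lam using lam w_pos by unfold_locales auto
  have mr: "malthusian_rates K w lam" by unfold_locales
  have sum_eq: "(\<Sum>i\<in>{1..K}. f i) = (\<Sum>j<K. f (Suc j))" for f :: "nat \<Rightarrow> real"
    by (simp add: sum.atLeast1_atMost_eq)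
  interpret branching clock "{1..K}" birth lam
  proof unfold_locales
    show "(\<Sum>i\<in>{1..K}. \<integral>u. exp (- lam * birth i u) \<partial>clock) = 1"
      unfolding sum_eq lam(2)[symmetric] using lam by (intro sum.cong birth_moment) auto
  qed (use K_ge_2 lam birth_nonneg birth_measurable in auto)
  obtain d B c b where b: "0 < d" "d < lam" "(\<Sum>j<K. \<Prod>i<Suc j. w i / (w i + 2 * (lam - d))) < 1" "0 < c"
    "exp_bounded d B b" "\<And>t. t < 0 \<Longrightarrow> b t = - c"
    "\<And>t. b t = (if 0 \<le> t then exp (- lam * t) else 0) + (\<Sum>j<K. R.iter_conv (Suc j) b t)"
    using R.renewal_solution by blast
  have "branching_renewal clock {1..K} birth lam d c B b"
  proof unfold_locales
    have "contraction d = (\<Sum>j<K. \<Prod>i<Suc j. w i / (w i + 2 * (lam - d)))"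
      unfolding contraction_def sum_eq
    proof (intro sum.cong refl)
      fix j assume "j \<in> {..<K}"
      then show "(\<integral>u. exp (- 2 * (lam - d) * birth (Suc j) u) \<partial>clock) = (\<Prod>i<Suc j. w i / (w i + 2 * (lam - d)))"
        using birth_moment[of "2 * (lam - d)" "Suc j"] b by simp
    qed
    then show "contraction d < 1" using b by simp
    show "b t = (if 0 \<le> t then exp (- lam * t) else 0) + (\<Sum>i\<in>{1..K}. \<integral>u. exp (- lam * birth i u) * b (t - birth i u) \<partial>clock)" for t
    proof -
      have "(\<Sum>j<K. R.iter_conv (Suc j) b t) = (\<Sum>j<K. \<integral>u. exp (- lam * birth (Suc j) u) * b (t - birth (Suc j) u) \<partial>clock)"
        by (intro sum.cong refl iter_conv_eq_integral[OF mr b(5,1,2)]) auto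
      then show ?thesis unfolding sum_eq by (subst b(7)) (simp only:)
    qed
    show "\<bar>b t\<bar> \<le> B * exp (- d * t)" for t using b(5) by (simp add: exp_bounded_def)
    show "b \<in> borel_measurable borel" by (rule exp_bounded_measurable[OF b(5)])
  qed (use K_ge_2 b in auto)
  then show ?thesis by blast
qed

end

section \<open>Transfer to the given probability space\<close>

context exp_rates begin

text \<open>The waiting time of \<open>y @ [i]\<close> becomes coordinate \<open>i\<close> of the
  mark of \<open>y\<close>. Independence is used at two levels: among the children of one
  \<open>y\<close> it gives the mark the law \<open>clock\<close>, and across the disjoint sibling
  groups it gives the product over all \<open>y\<close>.\<close>

lemma distr_coordinates:
  fixes \<sigma> :: "nat list \<Rightarrow> 'a \<Rightarrow> real"
  assumes M: "prob_space M"
    and indep: "prob_space.indep_vars M (\<lambda>_. borel) \<sigma> (lists {1..K} - {[]})"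
    and dist: "\<And>y i. y \<in> lists {1..K} \<Longrightarrow> i \<in> {1..K} \<Longrightarrow>
           distributed M lborel (\<sigma> (y @ [i])) (exponential_density (w (i - 1)))"
  defines "S \<equiv> (\<lambda>\<omega>. \<lambda>y\<in>lists {1..K}. \<lambda>i\<in>{1..K}. \<sigma> (y @ [i]) \<omega>)"
  shows "S \<in> measurable M (PiM (lists {1..K}) (\<lambda>_. clock))"
    and "distr M (PiM (lists {1..K}) (\<lambda>_. clock)) S = PiM (lists {1..K}) (\<lambda>_. clock)"
proof -
  interpret M: prob_space M by (rule M)
  let ?A = "{1..K}" and ?L = "lists {1..K}"
  have A: "?A \<noteq> {}" using K_ge_2 by auto
  have L: "?L \<noteq> {}" by auto
  have rv: "\<sigma> (y @ [i]) \<in> borel_measurable M" if "y \<in> ?L" "i \<in> ?A" for y i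
    using dist[OF that] by (auto simp: distributed_def cong: measurable_cong_sets)
  have sets_clock: "sets clock = sets (PiM ?A (\<lambda>_. borel))"
    unfolding clock_def by (intro sets_PiM_cong) auto
  define V where "V y \<omega> = (\<lambda>i\<in>?A. \<sigma> (y @ [i]) \<omega>)" for y \<omega>
  have V_meas: "V y \<in> measurable M clock" if "y \<in> ?L" for y
    unfolding measurable_cong_sets[OF refl sets_clock] V_def[abs_def]
    using rv that by (intro measurable_restrict) auto
  have V_law: "distr M clock (V y) = clock" if y: "y \<in> ?L" for y
  proof -
    have "M.indep_vars (\<lambda>j. PiM {y @ [j]} (\<lambda>_. borel)) (\<lambda>j \<omega>. restrict (\<lambda>x. \<sigma> x \<omega>) {y @ [j]}) ?A"
      using y by (intro M.indep_vars_restrict[OF indep]) (auto simp: disjoint_family_on_def)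
    then have "M.indep_vars (\<lambda>_. borel) (\<lambda>i \<omega>. (\<lambda>g. g (y @ [i])) (restrict (\<lambda>x. \<sigma> x \<omega>) {y @ [i]})) ?A"
      by (rule M.indep_vars_compose2) simp
    then have "M.indep_vars (\<lambda>_. borel) (\<lambda>i. \<sigma> (y @ [i])) ?A" by simp
    then have "distr M (PiM ?A (\<lambda>_. borel)) (V y) = PiM ?A (\<lambda>i. distr M borel (\<sigma> (y @ [i])))"
      using A rv y unfolding V_def[abs_def] by (subst (asm) M.indep_vars_iff_distr_eq_PiM') auto
    also have "\<dots> = clock"
      unfolding clock_def
    proof (rule PiM_cong[OF refl])
      fix i assume i: "i \<in> ?A"
      have "distr M borel (\<sigma> (y @ [i])) = distr M lborel (\<sigma> (y @ [i]))" by (intro distr_cong) auto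
      also have "\<dots> = exp_measure (w (i - 1))" using dist[OF y i] by (simp add: distributed_def)
      finally show "distr M borel (\<sigma> (y @ [i])) = exp_measure (w (i - 1))" .
    qed
    finally show ?thesis using sets_clock by (simp cong: distr_cong)
  qed
  have "M.indep_vars (\<lambda>y. PiM ((\<lambda>i. y @ [i]) ` ?A) (\<lambda>_. borel)) (\<lambda>y \<omega>. restrict (\<lambda>x. \<sigma> x \<omega>) ((\<lambda>i. y @ [i]) ` ?A)) ?L"
    by (intro M.indep_vars_restrict[OF indep]) (auto simp: disjoint_family_on_def)
  then have "M.indep_vars (\<lambda>_. clock) (\<lambda>y \<omega>. (\<lambda>g. \<lambda>i\<in>?A. g (y @ [i])) (restrict (\<lambda>x. \<sigma> x \<omega>) ((\<lambda>i. y @ [i]) ` ?A))) ?L"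
  proof (rule M.indep_vars_compose2)
    fix y
    show "(\<lambda>g. \<lambda>i\<in>?A. g (y @ [i])) \<in> measurable (PiM ((\<lambda>i. y @ [i]) ` ?A) (\<lambda>_. borel)) clock"
      unfolding measurable_cong_sets[OF refl sets_clock]
      by (intro measurable_restrict measurable_component_singleton) auto
  qed
  moreover have "(\<lambda>g. \<lambda>i\<in>?A. g (y @ [i])) (restrict (\<lambda>x. \<sigma> x \<omega>) ((\<lambda>i. y @ [i]) ` ?A)) = V y \<omega>" for y \<omega>
    by (auto simp: V_def restrict_def)
  ultimately have "M.indep_vars (\<lambda>_. clock) V ?L" by (simp cong: M.indep_vars_cong)
  then have "distr M (PiM ?L (\<lambda>_. clock)) S = PiM ?L (\<lambda>y. distr M clock (V y))"
    using L V_meas unfolding S_def V_def[symmetric] by (subst (asm) M.indep_vars_iff_distr_eq_PiM') auto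
  also have "\<dots> = PiM ?L (\<lambda>_. clock)" by (rule PiM_cong[OF refl V_law])
  finally show "distr M (PiM ?L (\<lambda>_. clock)) S = PiM ?L (\<lambda>_. clock)" .
  show "S \<in> measurable M (PiM ?L (\<lambda>_. clock))"
    unfolding S_def V_def[symmetric] using V_meas by (intro measurable_restrict) auto
qed

end

theorem theorem2p3:
  fixes M :: "'a measure" and K :: nat and w :: "nat \<Rightarrow> real"
    and \<sigma> :: "nat list \<Rightarrow> 'a \<Rightarrow> real"
  assumes "K \<ge> 2"
    and "\<And>j. j < K \<Longrightarrow> w j > 0"
    and "prob_space M"
    and "prob_space.indep_vars M (\<lambda>_. borel) \<sigma> (lists {1..K} - {[]})"
    and "\<And>y i. y \<in> lists {1..K} \<Longrightarrow> i \<in> {1..K} \<Longrightarrow>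
           distributed M lborel (\<sigma> (y @ [i])) (exponential_density (w (i - 1)))"
  shows "\<exists>h::real. AE \<omega> in M. (\<lambda>n. generation_entropy K \<sigma> n \<omega> / real n) \<longlonglongrightarrow> h"
proof -
  interpret E: exp_rates K w using assms(1,2) by unfold_locales
  interpret M: prob_space M by (rule assms(3))
  obtain lam d c B b where "branching_renewal E.clock {1..K} E.birth lam d c B b"
    using E.branching_renewal_exists by blast
  then interpret R: branching_renewal E.clock "{1..K}" E.birth lam d c B b .
  define S where "S \<omega> = (\<lambda>y\<in>lists {1..K}. \<lambda>i\<in>{1..K}. \<sigma> (y @ [i]) \<omega>)" for \<omega>
  have S: "S \<in> measurable M R.tree_space" "distr M R.tree_space S = R.tree_space"
    unfolding S_def[abs_def] R.tree_space_def R.words_def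
    by (rule E.distr_coordinates[OF assms(3,4)]; erule (1) assms(5))+
  have "AE s in distr M R.tree_space S.
      (\<forall>x\<in>R.words. ((\<lambda>t. real (card {y. x @ y \<in> R.alive t s}) / real (card (R.alive t s))) \<longlongrightarrow> R.mass x s / R.W s) at_top)
    \<and> (\<lambda>n. - (\<Sum>x\<in>R.gen n. R.mass x s / R.W s * ln (R.mass x s / R.W s)) / real n) \<longlonglongrightarrow> R.ent_mean"
    unfolding S(2) by (rule R.AE_entropy_tendsto)
  note lim = AE_distrD[OF S(1) this]
  \<comment> \<open>\<open>birth\<close> truncates waiting times at 0 and \<open>birth_time\<close>
    does not; off this null set they agree.\<close>
  have "AE \<omega> in M. \<forall>y\<in>lists {1..K}. \<forall>i\<in>{1..K}. 0 \<le> \<sigma> (y @ [i]) \<omega>"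
  proof (intro AE_ball_countable' AE_finite_allI)
    fix y i assume yi: "y \<in> lists {1..K}" "i \<in> {1..K}"
    then have "0 < w (i - 1)" by (intro assms(2)) auto
    have law: "distr M lborel (\<sigma> (y @ [i])) = exp_measure (w (i - 1))"
      using assms(5)[OF yi] by (simp add: distributed_def)
    have pos: "AE x in distr M lborel (\<sigma> (y @ [i])). 0 < x"
      unfolding law by (rule AE_exp_measure_pos) fact
    have meas: "\<sigma> (y @ [i]) \<in> measurable M lborel" using assms(5)[OF yi] by (simp add: distributed_def)
    from AE_distrD[OF meas pos] show "AE \<omega> in M. 0 \<le> \<sigma> (y @ [i]) \<omega>" by eventually_elim simp
  qed auto
  with lim have "AE \<omega> in M. (\<lambda>n. generation_entropy K \<sigma> n \<omega> / real n) \<longlonglongrightarrow> R.ent_mean"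
  proof eventually_elim
    case (elim \<omega>)
    \<comment> \<open>\<open>tau\<close> unfolds a word from the front and \<open>birth_time\<close>
      from the back; \<open>tau_append\<close> at the last letter reconciles them.\<close>
    have tau: "R.tau x (S \<omega>) = birth_time \<sigma> x \<omega>" if "x \<in> R.words" for x
      using that
    proof (induction x rule: rev_induct)
      case (snoc i y)
      then have yi: "y \<in> lists {1..K}" "i \<in> {1..K}" by (auto simp: R.words_def simp del: One_nat_def)
      have "R.tau (y @ [i]) (S \<omega>) = R.tau y (S \<omega>) + E.birth i (R.shift_word y (S \<omega>) [])"
        by (simp add: R.tau_append del: One_nat_def)
      also have "R.shift_word y (S \<omega>) [] = S \<omega> y"
        using R.shift_word_apply[of y "[]"] yi by (simp add: R.words_def del: One_nat_def)
      also have "E.birth i (S \<omega> y) = (\<Sum>j=1..i. \<sigma> (y @ [j]) \<omega>)"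
        unfolding E.birth_def using yi elim(2) by (intro sum.cong refl) (auto simp: S_def max_def simp del: One_nat_def)
      finally show ?case using snoc yi by (simp add: birth_time_snoc R.words_def del: One_nat_def)
    qed (simp add: birth_time_Nil del: One_nat_def)
    have alive: "R.alive t (S \<omega>) = growing_tree K \<sigma> t \<omega>" for t
      unfolding R.alive_def growing_tree_def R.words_def[symmetric]
      by (intro Collect_cong conj_cong refl) (simp only: tau)
    have gen: "R.gen n = generation K n" for n
      by (simp add: R.gen_def generation_def R.words_def del: One_nat_def)
    \<comment> \<open>Convergence is known for this \<open>\<omega>\<close>, so \<open>Lim\<close>
      is the actual limit and not its unspecified value.\<close>
    have size: "relative_size K \<sigma> x \<omega> = R.mass x (S \<omega>) / R.W (S \<omega>)" if "x \<in> R.words" for x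
      unfolding relative_size_def alive[symmetric] using elim(1) that by (intro tendsto_Lim) (auto simp del: One_nat_def)
    have "generation_entropy K \<sigma> n \<omega> = - (\<Sum>x\<in>R.gen n. R.mass x (S \<omega>) / R.W (S \<omega>) * ln (R.mass x (S \<omega>) / R.W (S \<omega>)))" for n
      unfolding generation_entropy_def gen[symmetric] using size R.gen_words by (simp del: One_nat_def)
    then show ?case using elim(1) by (simp del: One_nat_def)
  qed
  then show ?thesis by blast
qed

end
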